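(* Let $G$ be a finite group, let $k$ be a field of characteristic $p>0$ and let $c$ be a block idempotent of $kG$. Then for any choice of maximal $(kG,c)$-Brauer pair $(P,f)$, Alperin's weak fusion theorem holds for the fusion system $\mathcal{F}_{(P,f)}(kGc)$.
   Context: Brauer pairs. A block idempotent of $kG$ is a primitive idempotent of $Z(kG)$. $G$ acts on $kG$ by conjugation, ${}^{x}a=xax^{-1}$, and $(kG)^P$ denotes the fixed points of a subgroup $P$. For a $p$-subgroup $P\le G$, the Brauer homomorphism $\mathrm{Br}_P\colon(kG)^P\to kC_G(P)$, $\sum_{g\in G}\alpha_g g\mapsto\sum_{g\in C_G(P)}\alpha_g g$, is a surjective $k$-algebra homomorphism. A $kG$-Brauer pair is a pair $(P,e)$ with $P$ a $p$-subgroup of $G$ and $e$ a block idempotent of $kC_G(P)$; for a block idempotent $c$ of $kG$ it is a $(kG,c)$-Brauer pair if $\mathrm{Br}_P(c)e=e$. An idempotent $i\in(kG)^P$ is associated to $(P,e)$ if $e\,\mathrm{Br}_P(i)=\mathrm{Br}_P(i)\ne0$. One writes $(Q,f)\le(P,e)$ if $Q\le P$ and every primitive idempotent $i$ of $(kG)^P$ associated to $(P,e)$ is also associated to $(Q,f)$; this is a partial order, respected by the conjugation action ${}^{x}(P,e)=({}^{x}P,{}^{x}e)$ of $G$. A maximal $(kG,c)$-Brauer pair is one that is maximal for $\le$ among $(kG,c)$-Brauer pairs. For every Brauer pair $(P,e)$ and $Q\le P$ there is a unique block idempotent $e_Q$ of $kC_G(Q)$ with $(Q,e_Q)\le(P,e)$.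 Fusion systems. For a finite $p$-group $P$, a fusion system $\mathcal{F}$ over $P$ is a subcategory of the category of finite groups whose objects are the subgroups of $P$, such that for all $Q,R\le P$: (i) $\mathrm{Hom}_{\mathcal{F}}(Q,R)$ contains all homomorphisms $Q\to R$ induced by conjugation with elements of $P$, and all its elements are injective; (ii) for $\varphi\in\mathrm{Hom}_{\mathcal{F}}(Q,R)$, the isomorphism $Q\to\varphi(Q)$, $u\mapsto\varphi(u)$, and its inverse are morphisms in $\mathcal{F}$. $\mathrm{Aut}_{\mathcal{F}}(Q):=\mathrm{Hom}_{\mathcal{F}}(Q,Q)$. A subgroup $Q\le P$ is fully $\mathcal{F}$-normalized if $|N_P(Q)|\ge|N_P(Q')|$ for every $Q'\le P$ that is $\mathcal{F}$-isomorphic to $Q$; it is $\mathcal{F}$-centric if $C_P(R)=Z(R)$ for all $R\le P$ that are $\mathcal{F}$-isomorphic to $Q$. The fusion system $\langle S\rangle$ generated by a collection $S$ of morphisms between subgroups of $P$ is the intersection of all fusion systems over $P$ containing $S$. Alperin's weak fusion theorem holds for $\mathcal{F}$ if $\mathcal{F}=\langle\mathrm{Aut}_{\mathcal{F}}(Q)\mid Q\in\mathcal{C}\rangle$, where $\mathcal{C}$ is the set of subgroups of $P$ which are $\mathcal{F}$-centric and fully $\mathcal{F}$-normalized. For a block idempotent $c$ of $kG$ and a maximal $(kG,c)$-Brauer pair $(P,e)$, $\mathcal{F}_{(P,e)}(kGc)$ is the fusion system over $P$ in which $\mathrm{Hom}(Q,R)$ is the set of homomorphisms $\varphi\colon Q\to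 R$ for which there is $x\in G$ with $\varphi(u)=xux^{-1}$ for all $u\in Q$ and ${}^{x}(Q,e_Q)\le(R,e_R)$. *)

theory Defs
  imports "HOL-Algebra.Group_Action" "HOL-Algebra.Ring"
begin

section \<open>Idempotents and centres\<close>

definition idempotents :: "('a, 'm) ring_scheme \<Rightarrow> 'a set" where
  "idempotents R = {i \<in> carrier R. i \<otimes>\<^bsub>R\<^esub> i = i}"

definition primitive_idempotent :: "('a, 'm) ring_scheme \<Rightarrow> 'a \<Rightarrow> bool" where
  "primitive_idempotent R i \<longleftrightarrow>
     i \<in> idempotents R \<and> i \<noteq> \<zero>\<^bsub>R\<^esub> \<and>
     (\<forall>a \<in> idempotents R. \<forall>b \<in> idempotents R.
        a \<otimes>\<^bsub>R\<^esub> b = \<zero>\<^bsub>R\<^esub> \<and> b \<otimes>\<^bsub>R\<^esub> a = \<zero>\<^bsub>R\<^esub> \<and> i = a \<oplus>\<^bsub>R\<^esub> b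
          \<longrightarrow> a = \<zero>\<^bsub>R\<^esub> \<or> b = \<zero>\<^bsub>R\<^esub>)"

definition ring_center :: "('a, 'm) ring_scheme \<Rightarrow> ('a, 'm) ring_scheme" where
  "ring_center R = R\<lparr>carrier := {z \<in> carrier R. \<forall>a \<in> carrier R. z \<otimes>\<^bsub>R\<^esub> a = a \<otimes>\<^bsub>R\<^esub> z}\<rparr>"


section \<open>Subgroups\<close>

definition p_subgroup :: "nat \<Rightarrow> 'g set \<Rightarrow> ('g, 'm) monoid_scheme \<Rightarrow> bool" where
  "p_subgroup p H G \<longleftrightarrow> subgroup H G \<and> (\<exists>n. card H = p ^ n)"

definition centralizer :: "('g, 'm) monoid_scheme \<Rightarrow> 'g set \<Rightarrow> 'g set" where
  "centralizer G H = {g \<in> carrier G. \<forall>h \<in> H. g \<otimes>\<^bsub>G\<^esub> h = h \<otimes>\<^bsub>G\<^esub> g}"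

definition conj_elem :: "('g, 'm) monoid_scheme \<Rightarrow> 'g \<Rightarrow> 'g \<Rightarrow> 'g" where
  "conj_elem G x u = x \<otimes>\<^bsub>G\<^esub> u \<otimes>\<^bsub>G\<^esub> inv\<^bsub>G\<^esub> x"


section \<open>Group algebras of finite groups\<close>

text \<open>An element of \<open>kG\<close> is its coefficient function, extended by \<open>0\<close> outside \<open>carrier G\<close>, so that
  \<open>kH\<close> is literally a subset of \<open>kG\<close> for a subgroup \<open>H\<close>. No finiteness condition is put on the
  support: the definition is only meaningful for finite \<open>G\<close>.\<close>

definition group_algebra :: "('g, 'm) monoid_scheme \<Rightarrow> ('g \<Rightarrow> 'k::field) ring" where
  "group_algebra G =
     \<lparr>carrier = {a. \<forall>g. g \<notin> carrier G \<longrightarrow> a g = 0},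
      mult = (\<lambda>a b g. \<Sum>(x, y) \<in> {(x, y) \<in> carrier G \<times> carrier G. x \<otimes>\<^bsub>G\<^esub> y = g}. a x * b y),
      one = (\<lambda>g. if g = \<one>\<^bsub>G\<^esub> then 1 else 0),
      zero = (\<lambda>_. 0),
      add = (\<lambda>a b g. a g + b g)\<rparr>"

definition basis_elem :: "'g \<Rightarrow> 'g \<Rightarrow> 'k::field" where
  "basis_elem x = (\<lambda>g. if g = x then 1 else 0)"

definition conj_alg :: "('g, 'm) monoid_scheme \<Rightarrow> 'g \<Rightarrow> ('g \<Rightarrow> 'k::field) \<Rightarrow> 'g \<Rightarrow> 'k" where
  "conj_alg G x a =
     basis_elem x \<otimes>\<^bsub>group_algebra G\<^esub> a \<otimes>\<^bsub>group_algebra G\<^esub> basis_elem (inv\<^bsub>G\<^esub> x)"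

definition fixed_algebra :: "('g, 'm) monoid_scheme \<Rightarrow> 'g set \<Rightarrow> ('g \<Rightarrow> 'k::field) ring" where
  "fixed_algebra G P =
     (group_algebra G)\<lparr>carrier := {a \<in> carrier (group_algebra G). \<forall>u \<in> P. conj_alg G u a = a}\<rparr>"

definition block_idempotent :: "('g, 'm) monoid_scheme \<Rightarrow> ('g \<Rightarrow> 'k::field) \<Rightarrow> bool" where
  "block_idempotent G c \<longleftrightarrow> primitive_idempotent (ring_center (group_algebra G)) c"


section \<open>Brauer pairs\<close>

abbreviation centralizer_algebra :: "('g, 'm) monoid_scheme \<Rightarrow> 'g set \<Rightarrow> ('g \<Rightarrow> 'k::field) ring" where
  "centralizer_algebra G P \<equiv> group_algebra (G\<lparr>carrier := centralizer G P\<rparr>)"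

definition brauer_hom ::
  "('g, 'm) monoid_scheme \<Rightarrow> 'g set \<Rightarrow> ('g \<Rightarrow> 'k::field) \<Rightarrow> 'g \<Rightarrow> 'k" where
  "brauer_hom G P a = (\<lambda>g. if g \<in> centralizer G P then a g else 0)"

text \<open>Throughout, a pair \<open>(P, e)\<close> is passed as two consecutive arguments, and the prime is the
  characteristic of the coefficient field.\<close>

definition brauer_pair :: "('g, 'm) monoid_scheme \<Rightarrow> 'g set \<Rightarrow> ('g \<Rightarrow> 'k::field) \<Rightarrow> bool" where
  "brauer_pair G P e \<longleftrightarrow>
     p_subgroup CHAR('k) P G \<and> block_idempotent (G\<lparr>carrier := centralizer G P\<rparr>) e"

definition block_brauer_pair ::
  "('g, 'm) monoid_scheme \<Rightarrow> ('g \<Rightarrow> 'k::field) \<Rightarrow> 'g set \<Rightarrow> ('g \<Rightarrow> 'k) \<Rightarrow> bool" where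
  "block_brauer_pair G c P e \<longleftrightarrow>
     brauer_pair G P e \<and> brauer_hom G P c \<otimes>\<^bsub>centralizer_algebra G P\<^esub> e = e"

definition associated_idempotent ::
  "('g, 'm) monoid_scheme \<Rightarrow> ('g \<Rightarrow> 'k::field) \<Rightarrow> 'g set \<Rightarrow> ('g \<Rightarrow> 'k) \<Rightarrow> bool" where
  "associated_idempotent G i P e \<longleftrightarrow>
     i \<in> idempotents (fixed_algebra G P) \<and>
     e \<otimes>\<^bsub>centralizer_algebra G P\<^esub> brauer_hom G P i = brauer_hom G P i \<and>
     brauer_hom G P i \<noteq> \<zero>\<^bsub>centralizer_algebra G P\<^esub>"

text \<open>\<open>brauer_le G Q f P e\<close> is \<open>(Q, f) \<le> (P, e)\<close>.\<close>

definition brauer_le ::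
  "('g, 'm) monoid_scheme \<Rightarrow> 'g set \<Rightarrow> ('g \<Rightarrow> 'k::field) \<Rightarrow> 'g set \<Rightarrow> ('g \<Rightarrow> 'k) \<Rightarrow> bool" where
  "brauer_le G Q f P e \<longleftrightarrow>
     brauer_pair G Q f \<and> brauer_pair G P e \<and> Q \<subseteq> P \<and>
     (\<forall>i. primitive_idempotent (fixed_algebra G P) i \<and> associated_idempotent G i P e
            \<longrightarrow> associated_idempotent G i Q f)"

definition maximal_brauer_pair ::
  "('g, 'm) monoid_scheme \<Rightarrow> ('g \<Rightarrow> 'k::field) \<Rightarrow> 'g set \<Rightarrow> ('g \<Rightarrow> 'k) \<Rightarrow> bool" where
  "maximal_brauer_pair G c P e \<longleftrightarrow>
     block_brauer_pair G c P e \<and>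
     (\<forall>R f. block_brauer_pair G c R f \<and> brauer_le G P e R f \<longrightarrow> R = P \<and> f = e)"

text \<open>\<open>sub_block G P e Q\<close> is \<open>e\<^sub>Q\<close>, which exists and is unique for every Brauer pair \<open>(P, e)\<close> and
  subgroup \<open>Q\<close> of \<open>P\<close>.\<close>

definition sub_block ::
  "('g, 'm) monoid_scheme \<Rightarrow> 'g set \<Rightarrow> ('g \<Rightarrow> 'k::field) \<Rightarrow> 'g set \<Rightarrow> 'g \<Rightarrow> 'k" where
  "sub_block G P e Q =
     (THE f. block_idempotent (G\<lparr>carrier := centralizer G Q\<rparr>) f \<and> brauer_le G Q f P e)"


section \<open>Fusion systems\<close>

text \<open>A morphism from \<open>Q\<close> to \<open>R\<close> is a triple \<open>(Q, \<phi>, R)\<close> with \<open>\<phi>\<close> equal to \<open>undefined\<close> outside \<open>Q\<close>,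
  so that equality of triples is equality of morphisms. Since the objects of a fusion system over
  \<open>P\<close> are always all subgroups of \<open>P\<close>, a fusion system is represented by its set of morphisms.\<close>

type_synonym 'g morphism = "'g set \<times> ('g \<Rightarrow> 'g) \<times> 'g set"

definition subgroup_morphisms :: "('g, 'm) monoid_scheme \<Rightarrow> 'g morphism set" where
  "subgroup_morphisms P =
     {(Q, \<phi>, R). subgroup Q P \<and> subgroup R P \<and>
        \<phi> \<in> hom (P\<lparr>carrier := Q\<rparr>) (P\<lparr>carrier := R\<rparr>) \<inter> extensional Q}"

definition Hom :: "'g morphism set \<Rightarrow> 'g set \<Rightarrow> 'g set \<Rightarrow> ('g \<Rightarrow> 'g) set" where
  "Hom F Q R = {\<phi>. (Q, \<phi>, R) \<in> F}"

definition fusion_system :: "('g, 'm) monoid_scheme \<Rightarrow> 'g morphism set \<Rightarrow> bool" where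
  "fusion_system P F \<longleftrightarrow>
     F \<subseteq> subgroup_morphisms P \<and>
     (\<forall>Q. subgroup Q P \<longrightarrow> (\<lambda>u\<in>Q. u) \<in> Hom F Q Q) \<and>
     (\<forall>Q R S. \<forall>\<phi> \<in> Hom F Q R. \<forall>\<psi> \<in> Hom F R S. compose Q \<psi> \<phi> \<in> Hom F Q S) \<and>
     (\<forall>Q R. \<forall>x \<in> carrier P. subgroup Q P \<and> subgroup R P \<and> conj_elem P x ` Q \<subseteq> R
        \<longrightarrow> (\<lambda>u\<in>Q. conj_elem P x u) \<in> Hom F Q R) \<and>
     (\<forall>Q R. \<forall>\<phi> \<in> Hom F Q R. inj_on \<phi> Q) \<and>
     (\<forall>Q R. \<forall>\<phi> \<in> Hom F Q R. \<phi> \<in> Hom F Q (\<phi> ` Q) \<and>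
        (\<lambda>v\<in>\<phi> ` Q. inv_into Q \<phi> v) \<in> Hom F (\<phi> ` Q) Q)"

definition generated_fusion_system ::
  "('g, 'm) monoid_scheme \<Rightarrow> 'g morphism set \<Rightarrow> 'g morphism set" where
  "generated_fusion_system P S = \<Inter> {F. fusion_system P F \<and> S \<subseteq> F}"

definition fusion_isomorphic :: "'g morphism set \<Rightarrow> 'g set \<Rightarrow> 'g set \<Rightarrow> bool" where
  "fusion_isomorphic F Q R \<longleftrightarrow>
     (\<exists>\<phi> \<in> Hom F Q R. \<exists>\<psi> \<in> Hom F R Q.
        compose Q \<psi> \<phi> = (\<lambda>u\<in>Q. u) \<and> compose R \<phi> \<psi> = (\<lambda>v\<in>R. v))"

definition fully_normalized ::
  "('g, 'm) monoid_scheme \<Rightarrow> 'g morphism set \<Rightarrow> 'g set \<Rightarrow> bool" where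
  "fully_normalized P F Q \<longleftrightarrow>
     (\<forall>R. subgroup R P \<and> fusion_isomorphic F Q R
        \<longrightarrow> card (normalizer P R) \<le> card (normalizer P Q))"

definition fusion_centric ::
  "('g, 'm) monoid_scheme \<Rightarrow> 'g morphism set \<Rightarrow> 'g set \<Rightarrow> bool" where
  "fusion_centric P F Q \<longleftrightarrow>
     (\<forall>R. subgroup R P \<and> fusion_isomorphic F Q R
        \<longrightarrow> centralizer P R = centralizer (P\<lparr>carrier := R\<rparr>) R)"

definition alperin_weak_fusion :: "('g, 'm) monoid_scheme \<Rightarrow> 'g morphism set \<Rightarrow> bool" where
  "alperin_weak_fusion P F \<longleftrightarrow>
     F = generated_fusion_system P
           {(Q, \<phi>, Q) | Q \<phi>. subgroup Q P \<and> fusion_centric P F Q \<and> fully_normalized P F Q \<and>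
              \<phi> \<in> Hom F Q Q}"

text \<open>The fusion system of \<open>kGc\<close> on \<open>(P, e)\<close>; the block \<open>c\<close> only enters through the choice of a
  maximal \<open>(kG, c)\<close>-Brauer pair \<open>(P, e)\<close>.\<close>

definition block_fusion_system ::
  "('g, 'm) monoid_scheme \<Rightarrow> 'g set \<Rightarrow> ('g \<Rightarrow> 'k::field) \<Rightarrow> 'g morphism set" where
  "block_fusion_system G P e =
     {(Q, \<phi>, R) \<in> subgroup_morphisms (G\<lparr>carrier := P\<rparr>).
        \<exists>x \<in> carrier G. (\<forall>u \<in> Q. \<phi> u = conj_elem G x u) \<and>
          brauer_le G (conj_elem G x ` Q) (conj_alg G x (sub_block G P e Q))
                      R (sub_block G P e R)}"

end

theory Submission
  imports Defs "HOL-Algebra.Sylow" "HOL-Algebra.Left_Coset" "HOL-Library.Function_Algebras"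
begin

text \<open>
  Write \<open>e\<^sub>Q\<close> for the block of \<open>kC\<^sub>G(Q)\<close> with \<open>(Q, e\<^sub>Q) \<le> (P, f)\<close>. Over a field that is not
  a splitting field the fusion system need not be saturated: the inner automorphisms of \<open>P\<close> need
  not form a Sylow \<open>p\<close>-subgroup of \<open>Aut\<^sub>F(P)\<close>. What replaces the Sylow axiom is a conjugacy
  theorem for Brauer pairs, and this holds over every field of characteristic \<open>p\<close>.

  \<^emph>\<open>Conjugacy\<close> (\<open>top_pair_exists\<close>). Let \<open>(T, e)\<close> be a Brauer pair and let \<open>N\<close> be a group of
  elements stabilizing it and containing \<open>T C\<^sub>G(T)\<close>. Then some pair \<open>(D, h)\<close> above \<open>(T, e)\<close> with
  \<open>D \<le> N\<close> has the property that every pair above \<open>(T, e)\<close> inside \<open>N\<close> is contained in an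
  \<open>N\<close>-conjugate of \<open>(D, h)\<close>. The group \<open>D\<close> is a defect group of the primitive idempotent \<open>e\<close> of
  the commutative algebra \<open>(kC\<^sub>G(T))\<^sup>N\<close>, that is, a minimal \<open>p\<close>-subgroup from which \<open>e\<close> is a
  relative trace; expanding this trace under \<open>Br\<^sub>S\<close> (\<open>Br_trace\<close>) compares \<open>(D, h)\<close> with any other
  pair \<open>(S, h')\<close>.

  \<^emph>\<open>Subpairs.\<close> That \<open>e\<^sub>Q\<close> exists (\<open>sub_pair_exists\<close>) and that \<open>\<le>\<close> is transitive
  (\<open>brauer_le_trans\<close>) rest on the same two tools: the formula for \<open>Br\<^sub>S\<close> of a relative trace, and
  Fitting's lemma (\<open>prim_corner\<close>), by which \<open>iAi\<close> is local for a primitive idempotent \<open>i\<close>.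

  \<^emph>\<open>Fusion.\<close> The conjugacy theorem is used three times. For the trivial pair \<open>(1, c)\<close> and \<open>N = G\<close>
  it says that the maximal \<open>(kG, c)\<close>-Brauer pairs are conjugate (\<open>le_conj_P\<close>). For a fully
  normalized subgroup \<open>T\<close> of \<open>P\<close> and \<open>N = N\<^sub>G(T, e\<^sub>T)\<close>, together with the first case, it says that
  the pair of \<open>N\<^sub>P(T)\<close> is a largest one above \<open>(T, e\<^sub>T)\<close> in \<open>N\<close> (\<open>nrm_top\<close>). So every
  isomorphism from \<open>Q\<close> to \<open>T\<close> can be changed by an automorphism of \<open>T\<close> into one that extends to
  \<open>N\<^sub>P(Q)\<close> (\<open>extension\<close>), and by induction on the index of \<open>Q\<close> in \<open>P\<close> only the automorphisms of
  \<open>T\<close> remain. If \<open>T\<close> is centric, they belong to the generators. If not, then \<open>T C\<^sub>P(T) > T\<close>, and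
  the conjugacy theorem for \<open>N = T C\<^sub>G(T)\<close> gives a Frattini argument (\<open>frattini\<close>): each
  automorphism of \<open>T\<close> is an inner one times the restriction of an automorphism of \<open>T C\<^sub>P(T)\<close>, which
  is again generated by induction.
\<close>

section \<open>Actions of p-groups modulo p\<close>

lemma prime_CHAR_field:
  assumes "CHAR('k::field) > 0"
  shows "prime CHAR('k)"
  using prime_CHAR_semidom[where 'a = 'k] assms by simp

text \<open>Every orbit of a \<open>p\<close>-group that is not a single point has length divisible by \<open>p\<close>, so it
  contributes nothing to the sum of an invariant function in characteristic \<open>p\<close>. The
  multiplicativity of the Brauer homomorphism, the growth of normalizers in \<open>p\<close>-groups and the
  behaviour of relative traces under the Brauer homomorphism are all instances of this.\<close>

lemma sum_invariant_eq_sum_fixed: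
  fixes v :: "'b \<Rightarrow> 'k::field" and \<mu> :: "'g \<Rightarrow> 'b \<Rightarrow> 'b"
  assumes "group S" and card: "card (carrier S) = CHAR('k) ^ n" and pos: "CHAR('k) > 0"
    and fin: "finite \<Omega>"
    and closed: "\<And>s w. s \<in> carrier S \<Longrightarrow> w \<in> \<Omega> \<Longrightarrow> \<mu> s w \<in> \<Omega>"
    and one: "\<And>w. w \<in> \<Omega> \<Longrightarrow> \<mu> \<one>\<^bsub>S\<^esub> w = w"
    and mult: "\<And>s t w. s \<in> carrier S \<Longrightarrow> t \<in> carrier S \<Longrightarrow> w \<in> \<Omega> \<Longrightarrow>
      \<mu> (s \<otimes>\<^bsub>S\<^esub> t) w = \<mu> s (\<mu> t w)"
    and inv: "\<And>s w. s \<in> carrier S \<Longrightarrow> w \<in> \<Omega> \<Longrightarrow> v (\<mu> s w) = v w"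
  shows "(\<Sum>w\<in>\<Omega>. v w) = (\<Sum>w \<in> {w \<in> \<Omega>. \<forall>s \<in> carrier S. \<mu> s w = w}. v w)"
proof -
  interpret S: group S by fact
  define \<phi> where "\<phi> = (\<lambda>s. \<lambda>w\<in>\<Omega>. \<mu> s w)"
  have inverse: "\<mu> s (\<mu> (inv\<^bsub>S\<^esub> s) w) = w" "\<mu> (inv\<^bsub>S\<^esub> s) (\<mu> s w) = w"
    if "s \<in> carrier S" "w \<in> \<Omega>" for s w
    using that by (simp_all flip: mult add: one)
  have bij: "\<phi> s \<in> Bij \<Omega>" if "s \<in> carrier S" for s
  proof -
    have "bij_betw (\<mu> s) \<Omega> \<Omega>"
      using that closed inverse by (intro bij_betwI[where g = "\<mu> (inv\<^bsub>S\<^esub> s)"]) auto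
    then show ?thesis by (simp add: Bij_def \<phi>_def bij_betw_restrict_eq)
  qed
  interpret act: group_action S \<Omega> \<phi>
  proof (unfold group_action_def, intro group_hom.intro group_hom_axioms.intro homI)
    fix s t assume st: "s \<in> carrier S" "t \<in> carrier S"
    show "\<phi> s \<in> carrier (BijGroup \<Omega>)" using bij st by (simp add: BijGroup_def)
    have "\<phi> (s \<otimes>\<^bsub>S\<^esub> t) = compose \<Omega> (\<phi> s) (\<phi> t)"
      using st mult closed by (auto simp: \<phi>_def compose_def fun_eq_iff)
    then show "\<phi> (s \<otimes>\<^bsub>S\<^esub> t) = \<phi> s \<otimes>\<^bsub>BijGroup \<Omega>\<^esub> \<phi> t"
      using st bij by (simp add: BijGroup_def)
  qed (use group_BijGroup in \<open>auto intro: S.is_group\<close>)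
  have orbit: "orbit S \<phi> w = (\<lambda>s. \<mu> s w) ` carrier S" if "w \<in> \<Omega>" for w
    using that by (auto simp: orbit_def \<phi>_def)
  define Os where "Os = orbits S \<Omega> \<phi>"
  have part: "partition \<Omega> Os" unfolding Os_def by (rule act.orbit_partition)
  have union: "\<Union>Os = \<Omega>" using partition.partition_coverture[OF part] .
  have subs: "\<And>X. X \<in> Os \<Longrightarrow> X \<subseteq> \<Omega>" using union by blast
  have finOs: "finite Os" using union fin finite_UnionD by auto
  have disj: "\<And>X Y. X \<in> Os \<Longrightarrow> Y \<in> Os \<Longrightarrow> X \<noteq> Y \<Longrightarrow> X \<inter> Y = {}"
  proof (rule ccontr)
    fix X Y assume "X \<in> Os" "Y \<in> Os" "X \<noteq> Y" "X \<inter> Y \<noteq> {}"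
    then obtain w where "w \<in> X" "w \<in> Y" "w \<in> \<Omega>" using subs by blast
    then show False
      using partition.unique_class[OF part \<open>w \<in> \<Omega>\<close>] \<open>X \<in> Os\<close> \<open>Y \<in> Os\<close> \<open>X \<noteq> Y\<close> by blast
  qed
  let ?F = "{w \<in> \<Omega>. \<forall>s \<in> carrier S. \<mu> s w = w}"
  have one_orbit: "sum v X = sum v (X \<inter> ?F)" if X: "X \<in> Os" for X
  proof -
    obtain w where w: "w \<in> \<Omega>" "X = orbit S \<phi> w" using X by (auto simp: Os_def orbits_def)
    have Xw: "X = (\<lambda>s. \<mu> s w) ` carrier S" using w orbit by simp
    have wX: "w \<in> X" using Xw one[OF w(1)] by (metis S.one_closed imageI)
    have const: "sum v X = of_nat (card X) * v w"
      using Xw inv w(1) by (subst sum.cong[OF refl, of _ _ "\<lambda>_. v w"]) auto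
    show ?thesis
    proof (cases "w \<in> ?F")
      case True
      then have "X = {w}" using Xw by (auto intro: S.one_closed)
      then show ?thesis using True by simp
    next
      case False
      have "X \<inter> ?F = {}"
      proof (rule ccontr)
        assume "X \<inter> ?F \<noteq> {}"
        then obtain s where s: "s \<in> carrier S" "\<forall>t \<in> carrier S. \<mu> t (\<mu> s w) = \<mu> s w"
          using Xw by blast
        have "w = \<mu> s w" using s inverse(2)[OF s(1) w(1)] by simp
        then show False using s False w(1) by auto
      qed
      moreover have "of_nat (card X) = (0::'k)"
      proof -
        have "card X * card (stabilizer S \<phi> w) = CHAR('k) ^ n"
          using act.orbit_stabilizer_theorem[OF w(1)] w card by (simp add: order_def)
        then have "card X dvd CHAR('k) ^ n" by (metis dvd_triv_left)
        then obtain m where m: "card X = CHAR('k) ^ m"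
          using divides_primepow_nat[OF prime_CHAR_field[OF pos]] by blast
        obtain s where s: "s \<in> carrier S" "\<mu> s w \<noteq> w" using False w(1) by blast
        have "m \<noteq> 0"
        proof
          assume "m = 0"
          then have "card X = 1" using m by simp
          then have "X = {w}" using wX by (metis card_1_singletonE singletonD)
          then show False using Xw s by blast
        qed
        then show ?thesis unfolding of_nat_eq_0_iff_char_dvd m by simp
      qed
      ultimately show ?thesis using const by simp
    qed
  qed
  have "sum v \<Omega> = sum v (\<Union>Os)" by (simp add: union)
  also have "\<dots> = (\<Sum>X\<in>Os. sum v X)"
    using disj finite_subset[OF subs fin] by (subst sum.Union_disjoint) auto
  also have "\<dots> = (\<Sum>X\<in>Os. sum v (X \<inter> ?F))" by (simp add: one_orbit)
  also have "\<dots> = sum v (\<Union>X\<in>Os. X \<inter> ?F)"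
    using disj finOs subs fin by (subst sum.UNION_disjoint) (auto intro: finite_subset)
  also have "(\<Union>X\<in>Os. X \<inter> ?F) = ?F" using union by blast
  finally show ?thesis .
qed

section \<open>Group algebras as convolution algebras\<close>

lemma sum_fun_apply: "(\<Sum>i\<in>I. (F i :: 'a \<Rightarrow> 'b::comm_monoid_add)) x = (\<Sum>i\<in>I. F i x)"
  by (induction I rule: infinite_finite_induct) auto

text \<open>Gaussian elimination, one coordinate at a time.\<close>

lemma linear_dependence:
  fixes v :: "'i \<Rightarrow> 'x \<Rightarrow> 'k::field"
  assumes "finite X" "finite I" "card X < card I"
  shows "\<exists>c. (\<exists>l\<in>I. c l \<noteq> 0) \<and> (\<forall>x\<in>X. (\<Sum>l\<in>I. c l * v l x) = 0)"
  using assms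
proof (induction X arbitrary: I v rule: finite_induct)
  case empty
  then have "I \<noteq> {}" by auto
  then show ?case by (intro exI[of _ "\<lambda>_. 1"]) auto
next
  case (insert x X)
  show ?case
  proof (cases "\<forall>l\<in>I. v l x = 0")
    case True
    have "card X < card I" using insert by simp
    then obtain c where "\<exists>l\<in>I. c l \<noteq> 0" "\<forall>x\<in>X. (\<Sum>l\<in>I. c l * v l x) = 0"
      using insert.IH[of I v] insert.prems by blast
    then show ?thesis using True by (intro exI[of _ c]) auto
  next
    case False
    then obtain m where m: "m \<in> I" "v m x \<noteq> 0" by blast
    let ?I = "I - {m}"
    let ?w = "\<lambda>l y. v l y - v l x / v m x * v m y"
    have "card X < card ?I" using insert m by simp
    then obtain c where c: "\<exists>l\<in>?I. c l \<noteq> 0" "\<forall>y\<in>X. (\<Sum>l\<in>?I. c l * ?w l y) = 0"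
      using insert.IH[of ?I ?w] insert.prems by auto
    define d where "d = c(m := - (\<Sum>l\<in>?I. c l * v l x / v m x))"
    have "(\<Sum>l\<in>I. d l * v l y) = (\<Sum>l\<in>?I. c l * ?w l y)" for y
    proof -
      have dm: "d m = - (\<Sum>l\<in>?I. c l * v l x / v m x)" by (simp add: d_def)
      have "(\<Sum>l\<in>I. d l * v l y) = d m * v m y + (\<Sum>l\<in>?I. d l * v l y)"
        using m insert.prems by (simp add: sum.remove)
      also have "(\<Sum>l\<in>?I. d l * v l y) = (\<Sum>l\<in>?I. c l * v l y)"
        by (intro sum.cong) (auto simp: d_def)
      finally show ?thesis
        by (simp add: dm sum_distrib_left algebra_simps sum_subtractf)
    qed
    moreover have "(\<Sum>l\<in>?I. c l * ?w l x) = 0" using m by simp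
    moreover have "\<exists>l\<in>I. d l \<noteq> 0" using c(1) by (auto simp: d_def)
    ultimately show ?thesis using c(2) by (intro exI[of _ d]) auto
  qed
qed

text \<open>The group algebra is treated as the set of functions vanishing outside of the group, with
  pointwise addition and a convolution \<open>\<star>\<close> that is defined for all functions. As \<open>kH\<close> consists
  of the functions supported on \<open>H\<close>, all subalgebras that occur (\<open>kH\<close>, fixed points, centres) are
  subsets of one ring and share its multiplication. The parameter \<open>k\<close> only carries the type of
  the field.\<close>

locale modular_group_algebra = group G for G :: "('g, 'm) monoid_scheme" (structure) +
  fixes k :: "'k::field itself" and p :: nat
  assumes finG: "finite (carrier G)" and char_pos: "CHAR('k) > 0" and char_eq: "p = CHAR('k)"
begin

definition conv :: "('g \<Rightarrow> 'k) \<Rightarrow> ('g \<Rightarrow> 'k) \<Rightarrow> 'g \<Rightarrow> 'k" (infixl \<open>\<star>\<close> 70) where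
  "a \<star> b = (\<lambda>g. if g \<in> carrier G then \<Sum>x\<in>carrier G. a x * b (inv x \<otimes> g) else 0)"

definition act :: "'g \<Rightarrow> ('g \<Rightarrow> 'k) \<Rightarrow> 'g \<Rightarrow> 'k" where
  "act x a = (\<lambda>g. if g \<in> carrier G then a (inv x \<otimes> g \<otimes> x) else 0)"

text \<open>The group algebra \<open>kH\<close>.\<close>

definition alg :: "'g set \<Rightarrow> ('g \<Rightarrow> 'k) set" where
  "alg H = {a. \<forall>g. g \<notin> H \<longrightarrow> a g = 0}"

definition scale :: "'k \<Rightarrow> ('g \<Rightarrow> 'k) \<Rightarrow> 'g \<Rightarrow> 'k" where
  "scale c a = (\<lambda>g. c * a g)"

abbreviation unit :: "'g \<Rightarrow> 'k" where "unit \<equiv> basis_elem \<one>"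

lemma inv_cancel [simp]:
  "x \<in> carrier G \<Longrightarrow> y \<in> carrier G \<Longrightarrow> inv x \<otimes> (x \<otimes> y) = y"
  "x \<in> carrier G \<Longrightarrow> y \<in> carrier G \<Longrightarrow> x \<otimes> (inv x \<otimes> y) = y"
  by (simp_all flip: m_assoc)

lemma sum_translate:
  assumes "y \<in> carrier G"
  shows "(\<Sum>x\<in>carrier G. h (y \<otimes> x)) = (\<Sum>x\<in>carrier G. (h x :: 'k))"
  by (rule sum.reindex_bij_witness[where i = "\<lambda>x. inv y \<otimes> x" and j = "\<lambda>x. y \<otimes> x"])
    (use assms in auto)

lemma sum_conj:
  assumes "y \<in> carrier G"
  shows "(\<Sum>x\<in>carrier G. h (inv y \<otimes> x \<otimes> y)) = (\<Sum>x\<in>carrier G. (h x :: 'k))"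
  by (rule sum.reindex_bij_witness[where i = "\<lambda>x. y \<otimes> x \<otimes> inv y" and j = "\<lambda>x. inv y \<otimes> x \<otimes> y"])
    (use assms in \<open>auto simp: m_assoc\<close>)

lemma conv_pairs:
  "a \<star> b = (\<lambda>g. \<Sum>(x, y) \<in> {(x, y) \<in> carrier G \<times> carrier G. x \<otimes> y = g}. a x * b y)"
proof
  fix g
  show "(a \<star> b) g = (\<Sum>(x, y) \<in> {(x, y) \<in> carrier G \<times> carrier G. x \<otimes> y = g}. a x * b y)"
  proof (cases "g \<in> carrier G")
    case True
    then show ?thesis unfolding conv_def using True
      by (auto intro!: sum.reindex_bij_witness[where i = fst and j = "\<lambda>x. (x, inv x \<otimes> g)"])
  next
    case False
    then have "{(x, y) \<in> carrier G \<times> carrier G. x \<otimes> y = g} = {}" by auto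
    then show ?thesis using False by (simp only: conv_def) simp
  qed
qed

lemma conv_assoc: "(a \<star> b) \<star> c = a \<star> (b \<star> c)"
proof
  fix g
  show "((a \<star> b) \<star> c) g = (a \<star> (b \<star> c)) g"
  proof (cases "g \<in> carrier G")
    case g: True
    have "((a \<star> b) \<star> c) g
        = (\<Sum>x\<in>carrier G. \<Sum>y\<in>carrier G. a y * b (inv y \<otimes> x) * c (inv x \<otimes> g))"
      using g by (simp add: conv_def sum_distrib_right)
    also have "\<dots> = (\<Sum>y\<in>carrier G. \<Sum>x\<in>carrier G. a y * b (inv y \<otimes> x) * c (inv x \<otimes> g))"
      by (rule sum.swap)
    also have "\<dots> = (\<Sum>y\<in>carrier G. \<Sum>x\<in>carrier G. a y * b x * c (inv x \<otimes> (inv y \<otimes> g)))"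
    proof (rule sum.cong[OF refl])
      fix y assume y: "y \<in> carrier G"
      show "(\<Sum>x\<in>carrier G. a y * b (inv y \<otimes> x) * c (inv x \<otimes> g))
          = (\<Sum>x\<in>carrier G. a y * b x * c (inv x \<otimes> (inv y \<otimes> g)))"
        using sum_translate[OF y, of "\<lambda>x. a y * b (inv y \<otimes> x) * c (inv x \<otimes> g)"] y g
        by (simp add: inv_mult_group m_assoc cong: sum.cong)
    qed
    also have "\<dots> = (a \<star> (b \<star> c)) g"
      using g by (simp add: conv_def sum_distrib_left mult.assoc cong: sum.cong)
    finally show ?thesis .
  qed (simp add: conv_def)
qed

lemma conv_add_right: "a \<star> (b + c) = a \<star> b + a \<star> c"
  by (auto simp: conv_def fun_eq_iff distrib_left sum.distrib)

lemma conv_add_left: "(a + b) \<star> c = a \<star> c + b \<star> c"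
  by (auto simp: conv_def fun_eq_iff distrib_right sum.distrib)

lemma conv_diff_right: "a \<star> (b - c) = a \<star> b - a \<star> c"
  by (auto simp: conv_def fun_eq_iff right_diff_distrib sum_subtractf)

lemma conv_diff_left: "(a - b) \<star> c = a \<star> c - b \<star> c"
  by (auto simp: conv_def fun_eq_iff left_diff_distrib sum_subtractf)

lemma conv_zero [simp]: "0 \<star> a = 0" "a \<star> 0 = 0"
  by (auto simp: conv_def fun_eq_iff)

lemma conv_sum_right: "a \<star> (\<Sum>i\<in>I. F i) = (\<Sum>i\<in>I. a \<star> F i)"
  by (induction I rule: infinite_finite_induct)
    (simp_all only: not_False_eq_True sum.infinite sum.empty sum.insert conv_zero conv_add_right)

lemma conv_sum_left: "(\<Sum>i\<in>I. F i) \<star> a = (\<Sum>i\<in>I. F i \<star> a)"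
  by (induction I rule: infinite_finite_induct)
    (simp_all only: not_False_eq_True sum.infinite sum.empty sum.insert conv_zero conv_add_left)

lemmas conv_distribs = conv_add_right conv_add_left conv_diff_right conv_diff_left

lemma conv_scale: "scale r a \<star> b = scale r (a \<star> b)" "a \<star> scale r b = scale r (a \<star> b)"
  by (auto simp: conv_def scale_def fun_eq_iff sum_distrib_left mult_ac)

lemma scale_simps [simp]: "scale 0 a = 0" "scale 1 a = a" "scale r (scale s a) = scale (r * s) a"
  "scale r 0 = 0"
  by (auto simp: scale_def fun_eq_iff)

lemma alg_closed:
  "0 \<in> alg H" "a \<in> alg H \<Longrightarrow> b \<in> alg H \<Longrightarrow> a + b \<in> alg H"
  "a \<in> alg H \<Longrightarrow> b \<in> alg H \<Longrightarrow> a - b \<in> alg H" "a \<in> alg H \<Longrightarrow> scale r a \<in> alg H"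
  by (auto simp: alg_def scale_def)

lemma alg_mono: "H \<subseteq> K \<Longrightarrow> alg H \<subseteq> alg K"
  by (auto simp: alg_def)

lemma alg_sum: "(\<And>i. i \<in> I \<Longrightarrow> F i \<in> alg H) \<Longrightarrow> (\<Sum>i\<in>I. F i) \<in> alg H"
  by (induction I rule: infinite_finite_induct) (auto intro: alg_closed)

lemma conv_carrier: "a \<star> b \<in> alg (carrier G)"
  by (simp add: alg_def conv_def)

lemma conv_alg_subgroup:
  assumes "subgroup H G" "a \<in> alg H" "b \<in> alg H"
  shows "a \<star> b \<in> alg H"
proof -
  have "a x * b (inv x \<otimes> g) = 0" if "g \<in> carrier G" "g \<notin> H" "x \<in> carrier G" for x g
  proof (cases "x \<in> H \<and> inv x \<otimes> g \<in> H")
    case True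
    then have "x \<otimes> (inv x \<otimes> g) \<in> H" using assms(1) by (auto intro: subgroup.m_closed)
    then show ?thesis using that by simp
  qed (use assms in \<open>auto simp: alg_def\<close>)
  then show ?thesis by (auto simp: alg_def conv_def intro!: sum.neutral simp del: mult_eq_0_iff)
qed

lemma unit_alg: "subgroup H G \<Longrightarrow> unit \<in> alg H"
  by (auto simp: alg_def basis_elem_def subgroup.one_closed)

lemma unit_conv:
  assumes "a \<in> alg (carrier G)"
  shows "unit \<star> a = a" "a \<star> unit = a"
proof -
  have "inv x \<otimes> g = \<one> \<longleftrightarrow> x = g" if "x \<in> carrier G" "g \<in> carrier G" for x g
    using that by (metis inv_cancel(2) inv_closed r_one l_inv)
  then have "(a \<star> unit) g = a g" for g
    using assms finG
    by (simp add: conv_def basis_elem_def alg_def if_distrib[of "\<lambda>z. _ * z"] sum.delta'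
        cong: if_cong sum.cong)
  moreover have "(unit \<star> a) g = a g" for g
    using assms finG
    by (simp add: conv_def basis_elem_def alg_def if_distrib[of "\<lambda>z. z * _"] sum.delta
        cong: if_cong sum.cong)
  ultimately show "unit \<star> a = a" "a \<star> unit = a" by auto
qed

lemma act_add: "act x (a + b) = act x a + act x b" by (auto simp: act_def)
lemma act_diff: "act x (a - b) = act x a - act x b" by (auto simp: act_def)
lemma act_zero [simp]: "act x 0 = 0" by (auto simp: act_def)
lemma act_scale: "act x (scale r a) = scale r (act x a)" by (auto simp: act_def scale_def)
lemma act_sum: "act x (\<Sum>i\<in>I. F i) = (\<Sum>i\<in>I. act x (F i))"
  by (induction I rule: infinite_finite_induct)
    (simp_all only: not_False_eq_True sum.infinite sum.empty sum.insert act_zero act_add)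

lemma act_one: "a \<in> alg (carrier G) \<Longrightarrow> act \<one> a = a"
  by (auto simp: act_def alg_def)

lemma act_mult: "x \<in> carrier G \<Longrightarrow> y \<in> carrier G \<Longrightarrow> act (x \<otimes> y) a = act x (act y a)"
  by (auto simp: act_def inv_mult_group m_assoc)

lemma act_inv [simp]:
  assumes "x \<in> carrier G" "a \<in> alg (carrier G)"
  shows "act (inv x) (act x a) = a" "act x (act (inv x) a) = a"
  using assms by (simp_all flip: act_mult add: act_one)

lemma act_carrier [simp]: "act x a \<in> alg (carrier G)"
  by (simp add: act_def alg_def)

lemma act_conv:
  assumes x: "x \<in> carrier G"
  shows "act x (a \<star> b) = act x a \<star> act x b"
proof
  fix g
  show "act x (a \<star> b) g = (act x a \<star> act x b) g"
  proof (cases "g \<in> carrier G")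
    case g: True
    have "(act x a \<star> act x b) g
        = (\<Sum>y\<in>carrier G. a (inv x \<otimes> y \<otimes> x) * b (inv (inv x \<otimes> y \<otimes> x) \<otimes> (inv x \<otimes> g \<otimes> x)))"
      using g x by (simp add: conv_def act_def inv_mult_group m_assoc cong: sum.cong)
    also have "\<dots> = (\<Sum>y\<in>carrier G. a y * b (inv y \<otimes> (inv x \<otimes> g \<otimes> x)))"
      by (rule sum_conj[OF x, of "\<lambda>y. a y * b (inv y \<otimes> (inv x \<otimes> g \<otimes> x))"])
    finally show ?thesis using g x by (simp add: act_def conv_def)
  qed (simp add: act_def conv_def)
qed

lemma conj_alg_eq_act:
  assumes x: "x \<in> carrier G"
  shows "conj_alg G x a = act x (a :: 'g \<Rightarrow> 'k)"
proof
  fix g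
  have mult: "b \<otimes>\<^bsub>group_algebra G\<^esub> c = b \<star> c" for b c :: "'g \<Rightarrow> 'k"
    by (simp add: group_algebra_def conv_pairs)
  have left: "(basis_elem x \<star> b) h = b (inv x \<otimes> h)" if "h \<in> carrier G" for b h
    using that x finG
    by (simp add: conv_def basis_elem_def if_distrib[of "\<lambda>z. z * _"] sum.delta
        cong: if_cong sum.cong)
  have eq: "inv y \<otimes> h = inv x \<longleftrightarrow> y = h \<otimes> x" if "y \<in> carrier G" "h \<in> carrier G" for y h
  proof
    assume "inv y \<otimes> h = inv x"
    then have "y \<otimes> (inv y \<otimes> h) \<otimes> x = y" using that x by (simp add: m_assoc)
    then show "y = h \<otimes> x" using that x by simp
  qed (use that x in \<open>simp add: inv_mult_group m_assoc\<close>)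
  have right: "(b \<star> basis_elem (inv x)) h = b (h \<otimes> x)" if "h \<in> carrier G" for b h
    using that x finG
    by (simp add: conv_def basis_elem_def eq if_distrib[of "\<lambda>z. _ * z"] sum.delta'
        cong: if_cong sum.cong)
  show "conj_alg G x a g = act x a g"
  proof (cases "g \<in> carrier G")
    case True
    then show ?thesis unfolding conj_alg_def mult using x
      by (simp add: right left act_def m_assoc)
  qed (simp add: conj_alg_def mult conv_def act_def)
qed

section \<open>Primitive idempotents of subalgebras\<close>

definition subalg :: "('g \<Rightarrow> 'k) set \<Rightarrow> bool" where
  "subalg B \<longleftrightarrow> B \<subseteq> alg (carrier G) \<and> unit \<in> B \<and>
     (\<forall>a\<in>B. \<forall>b\<in>B. a + b \<in> B \<and> a - b \<in> B \<and> a \<star> b \<in> B) \<and> (\<forall>r. \<forall>a\<in>B. scale r a \<in> B)"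

definition prim :: "('g \<Rightarrow> 'k) set \<Rightarrow> ('g \<Rightarrow> 'k) \<Rightarrow> bool" where
  "prim B i \<longleftrightarrow> i \<in> B \<and> i \<star> i = i \<and> i \<noteq> 0 \<and>
     (\<forall>a\<in>B. \<forall>b\<in>B. a \<star> a = a \<and> b \<star> b = b \<and> a \<star> b = 0 \<and> b \<star> a = 0 \<and> i = a + b
        \<longrightarrow> a = 0 \<or> b = 0)"

lemma subalgD:
  assumes "subalg B"
  shows "a \<in> B \<Longrightarrow> a \<in> alg (carrier G)" "unit \<in> B" "0 \<in> B"
    "a \<in> B \<Longrightarrow> b \<in> B \<Longrightarrow> a + b \<in> B" "a \<in> B \<Longrightarrow> b \<in> B \<Longrightarrow> a - b \<in> B"
    "a \<in> B \<Longrightarrow> b \<in> B \<Longrightarrow> a \<star> b \<in> B" "a \<in> B \<Longrightarrow> scale r a \<in> B"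
proof -
  show "0 \<in> B" using assms unfolding subalg_def by (metis scale_simps(1))
qed (use assms in \<open>auto simp: subalg_def\<close>)

lemma subalg_sum: "subalg B \<Longrightarrow> (\<And>i. i \<in> I \<Longrightarrow> F i \<in> B) \<Longrightarrow> (\<Sum>i\<in>I. F i) \<in> B"
  by (induction I rule: infinite_finite_induct) (auto intro: subalgD)

lemma primD:
  assumes "prim B i"
  shows "i \<in> B" "i \<star> i = i" "i \<noteq> 0"
    "a \<in> B \<Longrightarrow> b \<in> B \<Longrightarrow> a \<star> a = a \<Longrightarrow> b \<star> b = b \<Longrightarrow> a \<star> b = 0 \<Longrightarrow> b \<star> a = 0 \<Longrightarrow> i = a + b
       \<Longrightarrow> a = 0 \<or> b = 0"
  using assms unfolding prim_def by blast+

primrec pow :: "('g \<Rightarrow> 'k) \<Rightarrow> nat \<Rightarrow> 'g \<Rightarrow> 'k" where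
  "pow t 0 = unit"
| "pow t (Suc n) = t \<star> pow t n"

lemma unit_carrier: "unit \<in> alg (carrier G)"
  by (rule unit_alg[OF subgroup_self])

lemma pow_closed: "subalg B \<Longrightarrow> t \<in> B \<Longrightarrow> pow t n \<in> B"
  by (induction n) (auto intro: subalgD)

lemma pow_carrier: "pow t n \<in> alg (carrier G)"
  by (cases n) (simp_all add: unit_carrier conv_carrier)

lemma pow_add: "pow t (m + n) = pow t m \<star> pow t n"
  by (induction m) (simp_all add: unit_conv pow_carrier conv_assoc)

lemma pow_commute:
  assumes "a \<in> alg (carrier G)" "b \<in> alg (carrier G)" "a \<star> b = b \<star> a"
  shows "pow a m \<star> b = b \<star> pow a m"
proof (induction m)
  case (Suc m)
  have "pow a (Suc m) \<star> b = a \<star> (b \<star> pow a m)" by (simp add: conv_assoc Suc)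
  also have "\<dots> = b \<star> (a \<star> pow a m)" by (metis conv_assoc assms(3))
  finally show ?case by simp
qed (simp add: unit_conv assms)

text \<open>Since the powers of \<open>t\<close> are linearly dependent, the lowest power occurring in a relation is a
  multiple of the next one.\<close>

lemma strongly_pi_regular:
  assumes B: "subalg B" and t: "t \<in> B"
  shows "\<exists>m. \<exists>u\<in>B. u \<star> t = t \<star> u \<and> pow t m = pow t (Suc m) \<star> u"
proof -
  note cl = subalgD[OF B]
  let ?I = "{..card (carrier G)}"
  obtain c where c: "\<exists>l\<in>?I. c l \<noteq> 0" "\<forall>x\<in>carrier G. (\<Sum>l\<in>?I. c l * pow t l x) = 0"
    using linear_dependence[OF finG, of ?I "pow t"] by auto
  have zero: "(\<Sum>l\<in>?I. scale (c l) (pow t l)) = 0"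
  proof
    fix x
    show "(\<Sum>l\<in>?I. scale (c l) (pow t l)) x = 0 x"
      using c(2) pow_carrier by (cases "x \<in> carrier G") (auto simp: sum_fun_apply scale_def alg_def)
  qed
  define m where "m = (LEAST l. l \<in> ?I \<and> c l \<noteq> 0)"
  have m: "m \<in> ?I" "c m \<noteq> 0"
    using LeastI_ex[of "\<lambda>l. l \<in> ?I \<and> c l \<noteq> 0"] c(1) unfolding m_def by auto
  have below: "c l = 0" if "l < m" for l
    using not_less_Least[of l "\<lambda>l. l \<in> ?I \<and> c l \<noteq> 0"] that m(1) unfolding m_def[symmetric] by auto
  let ?J = "{Suc m..card (carrier G)}"
  define u where "u = (\<Sum>l\<in>?J. scale (- c l / c m) (pow t (l - Suc m)))"
  have uB: "u \<in> B" unfolding u_def by (intro subalg_sum[OF B] cl pow_closed B t)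
  have tp: "t \<star> pow t n = pow t n \<star> t" for n using pow_commute[of t t n] cl(1)[OF t] by simp
  have comm: "u \<star> t = t \<star> u"
    unfolding u_def conv_sum_left conv_sum_right conv_scale tp ..
  have split: "?I = {..<m} \<union> insert m ?J" "{..<m} \<inter> insert m ?J = {}" using m(1) by auto
  have "(\<Sum>l\<in>?I. scale (c l) (pow t l)) = scale (c m) (pow t m) + (\<Sum>l\<in>?J. scale (c l) (pow t l))"
  proof -
    have "(\<Sum>l<m. scale (c l) (pow t l)) = 0" by (intro sum.neutral) (simp add: below)
    then show ?thesis unfolding split(1) using split(2) by (subst sum.union_disjoint) auto
  qed
  then have "scale (c m) (pow t m) + (\<Sum>l\<in>?J. scale (c l) (pow t l)) = 0" using zero by simp
  then have eq: "c m * pow t m x + (\<Sum>l\<in>?J. c l * pow t l x) = 0" for x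
    by (auto simp: fun_eq_iff scale_def sum_fun_apply)
  have "pow t m = (\<Sum>l\<in>?J. scale (- c l / c m) (pow t l))"
  proof
    fix x
    have "pow t m x = - (\<Sum>l\<in>?J. c l * pow t l x) / c m"
      using eq[of x] m(2) by (simp add: field_simps add_eq_0_iff)
    also have "\<dots> = (\<Sum>l\<in>?J. scale (- c l / c m) (pow t l)) x"
      by (simp add: sum_fun_apply scale_def sum_divide_distrib sum_negf)
    finally show "pow t m x = (\<Sum>l\<in>?J. scale (- c l / c m) (pow t l)) x" .
  qed
  also have "\<dots> = pow t (Suc m) \<star> u"
  proof -
    have "pow t (Suc m) \<star> pow t (l - Suc m) = pow t l" if "l \<in> ?J" for l
      using that by (simp flip: pow_add del: pow.simps)
    then show ?thesis unfolding u_def conv_sum_right conv_scale by (intro sum.cong refl) auto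
  qed
  finally show ?thesis using uB comm by blast
qed

text \<open>Fitting's lemma in the form that is used throughout: the corner of a primitive idempotent is a
  local ring.\<close>

lemma prim_corner:
  assumes B: "subalg B" and i: "prim B i" and s: "s \<in> B"
  defines "t \<equiv> i \<star> s \<star> i"
  shows "(\<exists>n. pow t n = 0) \<or> (\<exists>u\<in>B. i = t \<star> u)"
proof -
  note cl = subalgD[OF B]
  note iD = primD[OF i]
  have t: "t \<in> B" unfolding t_def by (intro cl(6) iD(1) s)
  have it: "i \<star> t = t" "t \<star> i = t"
    unfolding t_def using conv_assoc[of i i "s \<star> i"] by (simp_all add: conv_assoc iD(2))
  obtain m u where u: "u \<in> B" "u \<star> t = t \<star> u" and m: "pow t m = pow t (Suc m) \<star> u"
    using strongly_pi_regular[OF B t] by blast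
  define n where "n = Suc m"
  have step: "pow t n = pow t (Suc n) \<star> u"
    unfolding n_def by (metis conv_assoc m pow.simps(2))
  have ut: "pow u j \<star> t = t \<star> pow u j" for j using pow_commute u t cl by simp
  have utp: "pow t l \<star> pow u j = pow u j \<star> pow t l" for l j
    using pow_commute[of t "pow u j" l] ut t cl by (simp add: pow_carrier)
  have iter: "pow t n = pow t (n + j) \<star> pow u j" for j
  proof (induction j)
    case (Suc j)
    have "pow t (n + Suc j) = pow t j \<star> pow t (Suc n)"
      using pow_add[of t j "Suc n"] by (simp only: add.commute add_Suc add_Suc_right)
    then have "pow t (n + Suc j) \<star> pow u (Suc j) = pow t j \<star> (pow t (Suc n) \<star> u) \<star> pow u j"
      by (simp only: conv_assoc pow.simps(2)[of u])
    also have "\<dots> = pow t (n + j) \<star> pow u j"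
      unfolding step[symmetric] by (simp only: pow_add[symmetric] add.commute)
    finally show ?case using Suc by simp
  qed (simp add: unit_conv pow_carrier)
  \<comment> \<open>The idempotent of the Fitting decomposition with respect to \<open>t\<close>. It is a multiple of \<open>t\<close>, so it
    lies in the corner and must be \<open>0\<close> or \<open>i\<close>.\<close>
  define \<epsilon> where "\<epsilon> = pow t n \<star> pow u n"
  have \<epsilon>B: "\<epsilon> \<in> B" unfolding \<epsilon>_def using B t u pow_closed cl by simp
  have \<epsilon>t: "\<epsilon> \<star> pow t n = pow t n"
    unfolding \<epsilon>_def using iter[of n] utp[of n n] by (metis conv_assoc pow_add)
  have idem: "\<epsilon> \<star> \<epsilon> = \<epsilon>"
    by (subst (2 3) \<epsilon>_def) (simp add: conv_assoc[symmetric] \<epsilon>t)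
  have i\<epsilon>: "i \<star> \<epsilon> = \<epsilon>"
    unfolding \<epsilon>_def n_def by (simp add: conv_assoc[symmetric] it)
  have "pow t n \<star> i = pow t n"
  proof -
    have "pow t n = pow t m \<star> t"
      using pow_commute[of t t m] t cl by (simp add: n_def)
    then show ?thesis by (simp add: conv_assoc it)
  qed
  then have \<epsilon>i: "\<epsilon> \<star> i = \<epsilon>"
    unfolding \<epsilon>_def utp by (simp add: conv_assoc)
  have "\<epsilon> = 0 \<or> i - \<epsilon> = 0"
    using iD(4)[of \<epsilon> "i - \<epsilon>"] \<epsilon>B iD(1) cl
    by (simp add: idem conv_distribs i\<epsilon> \<epsilon>i iD(2))
  then show ?thesis
  proof
    assume "\<epsilon> = 0"
    then show ?thesis using \<epsilon>t by auto
  next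
    assume "i - \<epsilon> = 0"
    then have "i = t \<star> (pow t m \<star> pow u n)"
      using \<epsilon>_def n_def by (simp add: conv_assoc)
    moreover have "pow t m \<star> pow u n \<in> B" using B t u pow_closed cl by simp
    ultimately show ?thesis by blast
  qed
qed

text \<open>Fitting's lemma after a multiplicative map: if the image of an element of the corner is an
  idempotent, nilpotency means that this image is zero.\<close>

lemma prim_corner_image:
  assumes B: "subalg B" and i: "prim B i" and s: "s \<in> B"
    and hom: "\<And>a b. a \<in> B \<Longrightarrow> b \<in> B \<Longrightarrow> \<phi> (a \<star> b) = \<phi> a \<star> \<phi> b" and "\<phi> 0 = 0"
    and j: "\<phi> (i \<star> s \<star> i) \<star> \<phi> (i \<star> s \<star> i) = \<phi> (i \<star> s \<star> i)"
  shows "\<phi> (i \<star> s \<star> i) = 0 \<or> (\<exists>u\<in>B. i = i \<star> s \<star> i \<star> u)"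
proof -
  let ?t = "i \<star> s \<star> i"
  have t: "?t \<in> B" using B i s by (simp add: subalgD primD)
  from prim_corner[OF B i s] show ?thesis
  proof
    assume "\<exists>n. pow ?t n = 0"
    then obtain n where n: "pow ?t n = 0" by blast
    have "\<phi> (pow ?t (Suc n)) = \<phi> ?t" for n
    proof (induction n)
      case 0
      show ?case using subalgD(1)[OF B t] by (simp add: unit_conv)
    next
      case (Suc n)
      have "\<phi> (pow ?t (Suc (Suc n))) = \<phi> ?t \<star> \<phi> (pow ?t (Suc n))"
        unfolding pow.simps(2)[of ?t "Suc n"] by (rule hom[OF t pow_closed[OF B t]])
      then show ?case using Suc j by simp
    qed
    from this[of n] have "\<phi> ?t = 0" using n \<open>\<phi> 0 = 0\<close> by simp
    then show ?thesis ..
  qed blast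
qed

text \<open>A family of orthogonal nonzero idempotents with sum \<open>1\<close> that has as many members as possible
  consists of primitive idempotents; the number of members is bounded by linear independence.\<close>

lemma primitive_decomposition:
  assumes B: "subalg B"
  shows "\<exists>I. finite I \<and> (\<forall>i\<in>I. prim B i) \<and> \<Sum>I = unit"
proof -
  note cl = subalgD[OF B]
  define P where "P I \<longleftrightarrow> finite I \<and> (\<forall>i\<in>I. i \<in> B \<and> i \<star> i = i \<and> i \<noteq> 0) \<and>
    (\<forall>i\<in>I. \<forall>j\<in>I. i \<noteq> j \<longrightarrow> i \<star> j = 0) \<and> \<Sum>I = unit" for I
  have bound: "card I < Suc (card (carrier G))" if I: "P I" for I
  proof (rule ccontr)
    assume "\<not> ?thesis"
    then have "card (carrier G) < card I" by simp
    then obtain c where c: "\<exists>l\<in>I. c l \<noteq> 0" "\<forall>x\<in>carrier G. (\<Sum>l\<in>I. c l * l x) = 0"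
      using linear_dependence[OF finG, of I "\<lambda>l. l"] I by (auto simp: P_def)
    have zero: "(\<Sum>l\<in>I. scale (c l) l) = 0"
    proof
      fix x
      have "l x = 0" if "x \<notin> carrier G" "l \<in> I" for l
        using cl(1)[of l] I that by (auto simp: P_def alg_def)
      then show "(\<Sum>l\<in>I. scale (c l) l) x = 0 x"
        using c(2) by (cases "x \<in> carrier G") (auto simp: sum_fun_apply scale_def intro!: sum.neutral)
    qed
    obtain l where l: "l \<in> I" "c l \<noteq> 0" using c(1) by blast
    have "0 = l \<star> (\<Sum>l\<in>I. scale (c l) l)" using zero by simp
    also have "\<dots> = (\<Sum>m\<in>I. if m = l then scale (c l) l else 0)"
      unfolding conv_sum_right conv_scale using I l by (intro sum.cong) (auto simp: P_def)
    also have "\<dots> = scale (c l) l" using I l by (simp add: P_def)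
    finally have "scale (c l) l = 0" by simp
    then have "scale (inverse (c l)) (scale (c l) l) = 0" by simp
    then show False using l I by (auto simp: P_def)
  qed
  have "unit \<noteq> 0" by (auto simp: fun_eq_iff basis_elem_def)
  then have "P {unit}" using cl by (simp add: P_def unit_conv unit_carrier)
  then obtain I where I: "P I" and max: "\<And>J. P J \<Longrightarrow> card J \<le> card I"
    using ex_has_greatest_nat[of P "{unit}" card "Suc (card (carrier G))"] bound by blast
  have "prim B e" if e: "e \<in> I" for e
  proof (rule ccontr)
    assume "\<not> prim B e"
    then obtain a b where ab: "a \<in> B" "b \<in> B" "a \<star> a = a" "b \<star> b = b" "a \<star> b = 0" "b \<star> a = 0"
      "e = a + b" "a \<noteq> 0" "b \<noteq> 0"
      using I e by (auto simp: prim_def P_def)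
    let ?J = "insert a (insert b (I - {e}))"
    have eab: "e \<star> a = a" "a \<star> e = a" "e \<star> b = b" "b \<star> e = b"
      using ab by (simp_all add: conv_distribs)
    have orth: "f \<star> a = 0" "a \<star> f = 0" "f \<star> b = 0" "b \<star> f = 0" if "f \<in> I - {e}" for f
    proof -
      have "f \<star> e = 0" "e \<star> f = 0" using I e that by (auto simp: P_def)
      then show "f \<star> a = 0" "a \<star> f = 0" "f \<star> b = 0" "b \<star> f = 0"
        using conv_assoc[of f e a] conv_assoc[of a e f] conv_assoc[of f e b] conv_assoc[of b e f]
        by (simp_all add: eab)
    qed
    have new: "a \<notin> I - {e}" "b \<notin> I - {e}" "a \<noteq> b" using orth[of a] orth[of b] ab by auto
    have "\<Sum>?J = a + (b + \<Sum>(I - {e}))" using new I by (simp add: P_def)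
    also have "\<dots> = unit"
      using I e sum.remove[of I e "\<lambda>x. x"] by (simp add: P_def ab(7) add.assoc)
    finally have "\<Sum>?J = unit" .
    moreover have "i \<star> j = 0" if "i \<in> ?J" "j \<in> ?J" "i \<noteq> j" for i j
    proof -
      have "\<forall>i\<in>I - {e}. \<forall>j\<in>I - {e}. i \<noteq> j \<longrightarrow> i \<star> j = 0" using I by (simp add: P_def)
      then show ?thesis using that orth ab(5,6) by (elim insertE) simp_all
    qed
    moreover have "finite ?J" "\<forall>i\<in>?J. i \<in> B \<and> i \<star> i = i \<and> i \<noteq> 0"
      using I ab(1-4,8,9) by (simp_all add: P_def)
    ultimately have "P ?J" unfolding P_def by blast
    moreover have "card ?J = Suc (card I)"
      using new I card.remove[of I e] e by (simp add: P_def)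
    ultimately show False using max[of ?J] by simp
  qed
  then show ?thesis using I by (auto simp: P_def)
qed

section \<open>Fixed points, centres and the Brauer homomorphism\<close>

text \<open>\<open>fixed P\<close> is \<open>(kG)\<^sup>P\<close>, and \<open>center H\<close> is \<open>Z(kH)\<close>.\<close>

definition fixed :: "'g set \<Rightarrow> ('g \<Rightarrow> 'k) set" where
  "fixed P = {a \<in> alg (carrier G). \<forall>u\<in>P. act u a = a}"

definition center :: "'g set \<Rightarrow> ('g \<Rightarrow> 'k) set" where
  "center H = {z \<in> alg H. \<forall>a\<in>alg H. z \<star> a = a \<star> z}"

abbreviation psub :: "'g set \<Rightarrow> bool" where "psub S \<equiv> p_subgroup p S G"
abbreviation cen :: "'g set \<Rightarrow> 'g set" where "cen Q \<equiv> centralizer G Q"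
abbreviation Br :: "'g set \<Rightarrow> ('g \<Rightarrow> 'k) \<Rightarrow> 'g \<Rightarrow> 'k" where "Br Q \<equiv> brauer_hom G Q"
abbreviation cset :: "'g \<Rightarrow> 'g set \<Rightarrow> 'g set" where "cset x Q \<equiv> conj_elem G x ` Q"
abbreviation blk :: "'g set \<Rightarrow> ('g \<Rightarrow> 'k) \<Rightarrow> bool" where "blk Q \<equiv> prim (center (cen Q))"

lemma psubD: "psub S \<Longrightarrow> subgroup S G" "psub S \<Longrightarrow> S \<subseteq> carrier G"
  by (auto simp: p_subgroup_def dest: subgroup.subset)

lemma prime_char: "prime p"
  unfolding char_eq by (rule prime_CHAR_field[OF char_pos])

lemma psub_subset:
  assumes "psub S" "subgroup H G" "H \<subseteq> S"
  shows "psub H"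
proof -
  have "subgroup H (G\<lparr>carrier := S\<rparr>)"
    using assms by (intro subgroup_incl) (auto dest: psubD)
  then have "card (rcosets\<^bsub>G\<lparr>carrier := S\<rparr>\<^esub> H) * card H = card S"
    using group.lagrange[OF subgroup_imp_group[OF psubD(1)[OF assms(1)]]] by (simp add: order_def)
  then have "card H dvd card S" by (rule dvdI[OF trans[OF sym mult.commute]])
  then show ?thesis
    using assms(1,2) divides_primepow_nat[OF prime_char] by (auto simp: p_subgroup_def)
qed

lemma cen_subset: "cen Q \<subseteq> carrier G"
  by (auto simp: centralizer_def)

lemma cen_subgroup:
  assumes Q: "Q \<subseteq> carrier G"
  shows "subgroup (cen Q) G"
proof
  fix x y assume xy: "x \<in> cen Q" "y \<in> cen Q"
  then show "x \<otimes> y \<in> cen Q"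
  proof -
    have "x \<otimes> y \<otimes> h = h \<otimes> (x \<otimes> y)" if "h \<in> Q" for h
    proof -
      have c: "x \<in> carrier G" "y \<in> carrier G" "h \<in> carrier G" "x \<otimes> h = h \<otimes> x" "y \<otimes> h = h \<otimes> y"
        using xy that Q by (auto simp: centralizer_def)
      have "x \<otimes> y \<otimes> h = x \<otimes> (y \<otimes> h)" using c by (simp add: m_assoc)
      also have "\<dots> = (x \<otimes> h) \<otimes> y" unfolding c(5) using c(1-3) by (simp add: m_assoc)
      also have "\<dots> = h \<otimes> (x \<otimes> y)" unfolding c(4) using c(1-3) by (simp add: m_assoc)
      finally show ?thesis .
    qed
    then show ?thesis using xy by (auto simp: centralizer_def)
  qed
next
  fix x assume x: "x \<in> cen Q"
  have "inv x \<otimes> h = h \<otimes> inv x" if "h \<in> Q" for h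
  proof -
    have c: "x \<in> carrier G" "h \<in> carrier G" "x \<otimes> h = h \<otimes> x"
      using x that Q by (auto simp: centralizer_def)
    then have "inv x \<otimes> (x \<otimes> h) \<otimes> inv x = inv x \<otimes> (h \<otimes> x) \<otimes> inv x" by simp
    then show ?thesis using c(1,2) by (simp add: m_assoc)
  qed
  then show "inv x \<in> cen Q" using x by (auto simp: centralizer_def)
qed (use Q in \<open>auto simp: centralizer_def\<close>)

lemma cen_antimono: "Q \<subseteq> P \<Longrightarrow> cen P \<subseteq> cen Q"
  by (auto simp: centralizer_def)

lemma cen_conj:
  assumes "Q \<subseteq> carrier G" "g \<in> carrier G"
  shows "g \<in> cen Q \<longleftrightarrow> (\<forall>u\<in>Q. inv u \<otimes> g \<otimes> u = g)"
proof -
  have "g \<otimes> u = u \<otimes> g \<longleftrightarrow> inv u \<otimes> g \<otimes> u = g" if "u \<in> Q" for u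
  proof
    have u: "u \<in> carrier G" using that assms by blast
    { assume "g \<otimes> u = u \<otimes> g"
      then show "inv u \<otimes> g \<otimes> u = g" using u assms by (simp add: m_assoc) }
    { assume "inv u \<otimes> g \<otimes> u = g"
      then have "u \<otimes> (inv u \<otimes> g \<otimes> u) = u \<otimes> g" by simp
      then show "g \<otimes> u = u \<otimes> g" using u assms by (simp add: m_assoc) }
  qed
  then show ?thesis using assms by (auto simp: centralizer_def)
qed

lemma mem_cset:
  assumes "x \<in> carrier G" "Q \<subseteq> carrier G"
  shows "g \<in> cset x Q \<longleftrightarrow> g \<in> carrier G \<and> inv x \<otimes> g \<otimes> x \<in> Q"
proof
  assume "g \<in> cset x Q"
  then show "g \<in> carrier G \<and> inv x \<otimes> g \<otimes> x \<in> Q"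
    using assms by (auto simp: conj_elem_def m_assoc subset_iff)
next
  assume g: "g \<in> carrier G \<and> inv x \<otimes> g \<otimes> x \<in> Q"
  then have "g = conj_elem G x (inv x \<otimes> g \<otimes> x)" using assms by (simp add: conj_elem_def m_assoc)
  then show "g \<in> cset x Q" using g by blast
qed

lemma conj_elem_closed: "x \<in> carrier G \<Longrightarrow> u \<in> carrier G \<Longrightarrow> conj_elem G x u \<in> carrier G"
  by (simp add: conj_elem_def)

lemma conj_elem_mult:
  "x \<in> carrier G \<Longrightarrow> y \<in> carrier G \<Longrightarrow> u \<in> carrier G \<Longrightarrow>
    conj_elem G (x \<otimes> y) u = conj_elem G x (conj_elem G y u)"
  by (simp add: conj_elem_def inv_mult_group m_assoc)

lemma conj_elem_one: "u \<in> carrier G \<Longrightarrow> conj_elem G \<one> u = u"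
  by (simp add: conj_elem_def)

lemma conj_elem_inv [simp]:
  assumes "x \<in> carrier G" "u \<in> carrier G"
  shows "conj_elem G (inv x) (conj_elem G x u) = u" "conj_elem G x (conj_elem G (inv x) u) = u"
  using assms by (simp_all flip: conj_elem_mult add: conj_elem_one)

lemma conj_elem_eq_iff:
  assumes "s \<in> carrier G" "x \<in> carrier G"
  shows "conj_elem G s x = x \<longleftrightarrow> x \<otimes> s = s \<otimes> x"
proof
  assume "conj_elem G s x = x"
  then have "s \<otimes> x \<otimes> inv s \<otimes> s = x \<otimes> s" by (simp add: conj_elem_def)
  then show "x \<otimes> s = s \<otimes> x" using assms by (simp add: m_assoc)
next
  assume "x \<otimes> s = s \<otimes> x"
  then have "conj_elem G s x = x \<otimes> s \<otimes> inv s" by (simp add: conj_elem_def)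
  then show "conj_elem G s x = x" using assms by (simp add: m_assoc)
qed

lemma cset_subset: "x \<in> carrier G \<Longrightarrow> Q \<subseteq> carrier G \<Longrightarrow> cset x Q \<subseteq> carrier G"
  by (auto simp: conj_elem_def subset_iff)

lemma cset_mult:
  "x \<in> carrier G \<Longrightarrow> y \<in> carrier G \<Longrightarrow> Q \<subseteq> carrier G \<Longrightarrow> cset (x \<otimes> y) Q = cset x (cset y Q)"
  by (force simp: conj_elem_mult image_image subset_iff intro!: image_cong)

lemma cset_one: "Q \<subseteq> carrier G \<Longrightarrow> cset \<one> Q = Q"
  by (force simp: conj_elem_one subset_iff)

lemma cset_inv [simp]:
  assumes "x \<in> carrier G" "Q \<subseteq> carrier G"
  shows "cset (inv x) (cset x Q) = Q" "cset x (cset (inv x) Q) = Q"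
  using assms by (simp_all add: cset_one flip: cset_mult)

lemma inj_conj: "x \<in> carrier G \<Longrightarrow> inj_on (conj_elem G x) (carrier G)"
  by (metis conj_elem_inv(1) inj_onI)

lemma card_cset: "x \<in> carrier G \<Longrightarrow> Q \<subseteq> carrier G \<Longrightarrow> card (cset x Q) = card Q"
  by (meson card_image inj_conj inj_on_subset)

lemma cset_subgroup:
  assumes x: "x \<in> carrier G" and H: "subgroup H G"
  shows "subgroup (cset x H) G"
proof -
  interpret H: subgroup H G by fact
  have "conj_elem G x u \<otimes> conj_elem G x v = conj_elem G x (u \<otimes> v)"
    "inv (conj_elem G x u) = conj_elem G x (inv u)" if "u \<in> H" "v \<in> H" for u v
    using that x by (simp_all add: conj_elem_def m_assoc inv_mult_group)
  moreover have "conj_elem G x \<one> = \<one>" using x by (simp add: conj_elem_def)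
  ultimately show ?thesis
    using x by unfold_locales (auto simp: conj_elem_closed intro: image_eqI[of _ _ \<one>])
qed

lemma cset_self:
  assumes H: "subgroup H G" and x: "x \<in> H"
  shows "cset x H = H"
proof -
  interpret H: subgroup H G by fact
  show ?thesis
  proof
    show "cset x H \<subseteq> H" using x by (auto simp: conj_elem_def)
    show "H \<subseteq> cset x H" using x by (auto simp: mem_cset H.subset)
  qed
qed

lemma psub_cset: "x \<in> carrier G \<Longrightarrow> psub S \<Longrightarrow> psub (cset x S)"
  by (auto simp: p_subgroup_def cset_subgroup card_cset subgroup.subset)

lemma cen_cset:
  assumes "x \<in> carrier G" "Q \<subseteq> carrier G"
  shows "cen (cset x Q) = cset x (cen Q)"
proof -
  have *: "cset x (cen Q) \<subseteq> cen (cset x Q)" if "x \<in> carrier G" "Q \<subseteq> carrier G" for x Q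
  proof
    fix g assume "g \<in> cset x (cen Q)"
    then obtain h where h: "h \<in> carrier G" "\<forall>u\<in>Q. h \<otimes> u = u \<otimes> h" "g = x \<otimes> h \<otimes> inv x"
      by (auto simp: centralizer_def conj_elem_def)
    have "g \<otimes> conj_elem G x u = conj_elem G x u \<otimes> g" if "u \<in> Q" for u
    proof -
      have u: "u \<in> carrier G" using that \<open>Q \<subseteq> carrier G\<close> by blast
      have "g \<otimes> conj_elem G x u = x \<otimes> (h \<otimes> u) \<otimes> inv x"
        using h u \<open>x \<in> carrier G\<close> by (simp add: conj_elem_def m_assoc)
      also have "\<dots> = x \<otimes> (u \<otimes> h) \<otimes> inv x" using h that by simp
      also have "\<dots> = conj_elem G x u \<otimes> g"
        using h(1,3) u \<open>x \<in> carrier G\<close> by (simp add: conj_elem_def m_assoc)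
      finally show ?thesis .
    qed
    then show "g \<in> cen (cset x Q)" using h \<open>x \<in> carrier G\<close> by (auto simp: centralizer_def)
  qed
  have "cset (inv x) (cen (cset x Q)) \<subseteq> cen Q"
    using *[of "inv x" "cset x Q"] assms by (simp add: cset_subset)
  then have "cset x (cset (inv x) (cen (cset x Q))) \<subseteq> cset x (cen Q)" by blast
  then show ?thesis using *[OF assms] assms cen_subset by auto
qed

lemma fixed_subalg:
  assumes "P \<subseteq> carrier G"
  shows "subalg (fixed P)"
proof -
  have "act u unit = unit" if "u \<in> P" for u
  proof
    fix g
    have u: "u \<in> carrier G" using that assms by blast
    have "inv u \<otimes> g \<otimes> u = \<one> \<longleftrightarrow> g = \<one>" if g: "g \<in> carrier G"
    proof
      assume "inv u \<otimes> g \<otimes> u = \<one>"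
      then have "u \<otimes> (inv u \<otimes> g \<otimes> u) \<otimes> inv u = \<one>" using u by simp
      then show "g = \<one>" using u g by (simp add: m_assoc)
    qed (use u in simp)
    then show "act u unit g = unit g" by (auto simp: act_def basis_elem_def)
  qed
  then show ?thesis
    using assms
    by (auto simp: subalg_def fixed_def unit_carrier alg_closed conv_carrier act_add act_diff act_conv
        act_scale subset_iff)
qed

lemma fixed_antimono: "Q \<subseteq> P \<Longrightarrow> fixed P \<subseteq> fixed Q"
  by (auto simp: fixed_def)

lemma fixed_apply:
  "a \<in> fixed P \<Longrightarrow> u \<in> P \<Longrightarrow> g \<in> carrier G \<Longrightarrow> a (inv u \<otimes> g \<otimes> u) = a g"
  unfolding fixed_def act_def fun_eq_iff mem_Collect_eq by metis

lemma fixedI: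
  assumes "a \<in> alg (carrier G)" "\<And>u g. u \<in> P \<Longrightarrow> g \<in> carrier G \<Longrightarrow> a (inv u \<otimes> g \<otimes> u) = a g"
  shows "a \<in> fixed P"
  using assms by (auto simp: fixed_def act_def alg_def fun_eq_iff)

lemma alg_cen_carrier: "a \<in> alg (cen Q) \<Longrightarrow> a \<in> alg (carrier G)"
  using alg_mono[OF cen_subset] by blast

lemma alg_cen_fixed:
  assumes Q: "Q \<subseteq> carrier G" and a: "a \<in> alg (cen Q)"
  shows "a \<in> fixed Q"
proof (rule fixedI)
  fix u g assume u: "u \<in> Q" and g: "g \<in> carrier G"
  have uG: "u \<in> carrier G" using u Q by blast
  show "a (inv u \<otimes> g \<otimes> u) = a g"
  proof (cases "inv u \<otimes> g \<otimes> u \<in> cen Q \<or> g \<in> cen Q")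
    case True
    have "inv u \<otimes> g \<otimes> u = g"
    proof (cases "g \<in> cen Q")
      case False
      then have "inv u \<otimes> g \<otimes> u \<in> cen Q" using True by blast
      then have "(inv u \<otimes> g \<otimes> u) \<otimes> u = u \<otimes> (inv u \<otimes> g \<otimes> u)"
        using u by (auto simp: centralizer_def)
      then have "(inv u \<otimes> g \<otimes> u) \<otimes> u = g \<otimes> u" using uG g by (simp add: m_assoc)
      then show ?thesis using uG g by simp
    qed (use cen_conj Q u g in auto)
    then show ?thesis by simp
  qed (use a in \<open>auto simp: alg_def\<close>)
qed (rule alg_cen_carrier[OF a])

lemma Br_alg: "Br Q a \<in> alg (cen Q)"
  by (simp add: alg_def brauer_hom_def)

lemma Br_id: "a \<in> alg (cen Q) \<Longrightarrow> Br Q a = a"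
  by (auto simp: alg_def brauer_hom_def)

lemma Br_diff: "Br Q (a - b) = Br Q a - Br Q b" by (auto simp: brauer_hom_def)
lemma Br_zero [simp]: "Br Q 0 = 0" by (auto simp: brauer_hom_def)

lemma Br_sum: "Br Q (\<Sum>i\<in>I. F i) = (\<Sum>i\<in>I. Br Q (F i))"
  by (rule ext) (simp add: brauer_hom_def sum_fun_apply)

lemma Br_unit: "Q \<subseteq> carrier G \<Longrightarrow> Br Q unit = unit"
  by (intro Br_id unit_alg cen_subgroup)

lemma Br_Br: "T \<subseteq> S \<Longrightarrow> Br S (Br T a) = Br S a"
  using cen_antimono[of T S] by (fastforce simp: brauer_hom_def fun_eq_iff)

text \<open>The convolution product at a point of \<open>C\<^sub>G(S)\<close> is the sum of an \<open>S\<close>-invariant function.\<close>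

lemma Br_conv:
  assumes S: "psub S" and a: "a \<in> fixed S" and b: "b \<in> fixed S"
  shows "Br S (a \<star> b) = Br S a \<star> Br S b"
proof
  fix g
  show "Br S (a \<star> b) g = (Br S a \<star> Br S b) g"
  proof (cases "g \<in> cen S")
    case False
    then show ?thesis
      using conv_alg_subgroup[OF cen_subgroup[OF psubD(2)[OF S]] Br_alg Br_alg, of a b]
      by (simp add: brauer_hom_def alg_def)
  next
    case g: True
    have gG: "g \<in> carrier G" using g cen_subset by blast
    interpret S: subgroup S G using psubD(1)[OF S] .
    obtain n where n: "card S = CHAR('k) ^ n" using S by (auto simp: p_subgroup_def char_eq)
    let ?S = "G\<lparr>carrier := S\<rparr>"
    let ?v = "\<lambda>x. a x * b (inv x \<otimes> g)"
    have inv: "?v (conj_elem G s x) = ?v x" if "s \<in> S" "x \<in> carrier G" for s x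
    proof -
      have s: "s \<in> carrier G" "inv s \<in> S" using that by auto
      have "a (conj_elem G s x) = a x"
        using fixed_apply[OF a s(2) that(2)] s(1) by (simp add: conj_elem_def)
      moreover have "b (inv (conj_elem G s x) \<otimes> g) = b (inv x \<otimes> g)"
      proof -
        have "s \<otimes> g = g \<otimes> s" using g that(1) by (auto simp: centralizer_def)
        then have "inv (inv s) \<otimes> (inv x \<otimes> g) \<otimes> inv s = s \<otimes> inv x \<otimes> (g \<otimes> inv s)"
          using s that gG by (simp add: m_assoc)
        moreover have "g \<otimes> inv s = inv s \<otimes> g"
          using g s(2) by (auto simp: centralizer_def)
        ultimately have "inv (inv s) \<otimes> (inv x \<otimes> g) \<otimes> inv s = inv (conj_elem G s x) \<otimes> g"
          using s that gG by (simp add: m_assoc conj_elem_def inv_mult_group)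
        then show ?thesis
          using fixed_apply[OF b s(2), of "inv x \<otimes> g"] that(2) gG by simp
      qed
      ultimately show ?thesis by simp
    qed
    have cenS: "{x \<in> carrier G. \<forall>s\<in>S. conj_elem G s x = x} = cen S"
      using conj_elem_eq_iff by (auto simp: centralizer_def)
    have "(a \<star> b) g = (\<Sum>x\<in>carrier G. ?v x)" using gG by (simp add: conv_def)
    also have "\<dots> = (\<Sum>x \<in> {x \<in> carrier G. \<forall>s \<in> carrier ?S. conj_elem G s x = x}. ?v x)"
    proof (rule sum_invariant_eq_sum_fixed[where n = n])
      show "group ?S" by (rule subgroup_imp_group[OF psubD(1)[OF S]])
    qed (use n char_pos finG inv in \<open>auto simp: conj_elem_closed conj_elem_one conj_elem_mult\<close>)
    also have "\<dots> = (\<Sum>x\<in>cen S. ?v x)" by (simp add: cenS)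
    also have "\<dots> = (\<Sum>x\<in>carrier G. Br S a x * Br S b (inv x \<otimes> g))"
    proof (rule sum.mono_neutral_cong_left)
      interpret C: subgroup "cen S" G by (rule cen_subgroup[OF psubD(2)[OF S]])
      show "?v x = Br S a x * Br S b (inv x \<otimes> g)" if "x \<in> cen S" for x
        using that g by (simp add: brauer_hom_def C.m_closed)
    qed (use finG cen_subset in \<open>auto simp: brauer_hom_def\<close>)
    also have "\<dots> = (Br S a \<star> Br S b) g" using gG by (simp add: conv_def)
    finally show ?thesis using g by (simp add: brauer_hom_def)
  qed
qed

lemma centerD:
  "z \<in> center H \<Longrightarrow> z \<in> alg H" "z \<in> center H \<Longrightarrow> a \<in> alg H \<Longrightarrow> z \<star> a = a \<star> z"
  unfolding center_def by blast+

lemma centerI: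
  "z \<in> alg H \<Longrightarrow> (\<And>a. a \<in> alg H \<Longrightarrow> z \<star> a = a \<star> z) \<Longrightarrow> z \<in> center H"
  unfolding center_def by blast

lemma center_subalg:
  assumes H: "subgroup H G"
  shows "subalg (center H)"
proof -
  have carrier: "alg H \<subseteq> alg (carrier G)" by (rule alg_mono[OF subgroup.subset[OF H]])
  have mult: "a \<star> b \<in> center H" if a: "a \<in> center H" and b: "b \<in> center H" for a b
  proof (rule centerI)
    show "a \<star> b \<in> alg H" using conv_alg_subgroup[OF H] centerD(1) a b by blast
    fix c assume "c \<in> alg H"
    then have "b \<star> c = c \<star> b" "a \<star> c = c \<star> a" using centerD(2) a b by blast+
    then show "a \<star> b \<star> c = c \<star> (a \<star> b)" by (metis conv_assoc)
  qed
  moreover have "a + b \<in> center H" "a - b \<in> center H" "scale r a \<in> center H"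
    if ab: "a \<in> center H" "b \<in> center H" for a b r
  proof -
    note al = centerD(1)[OF ab(1)] centerD(1)[OF ab(2)]
    have c: "a \<star> d = d \<star> a" "b \<star> d = d \<star> b" if "d \<in> alg H" for d
      using centerD(2) ab that by blast+
    show "a + b \<in> center H" by (rule centerI) (simp_all add: al alg_closed conv_distribs c)
    show "a - b \<in> center H" by (rule centerI) (simp_all add: al alg_closed conv_distribs c)
    show "scale r a \<in> center H" by (rule centerI) (simp_all add: al alg_closed conv_scale c)
  qed
  moreover have "unit \<in> center H"
  proof (rule centerI[OF unit_alg[OF H]])
    fix a assume "a \<in> alg H"
    then have "a \<in> alg (carrier G)" using carrier by (rule subsetD[rotated])
    then show "unit \<star> a = a \<star> unit" by (simp only: unit_conv)
  qed
  moreover have "center H \<subseteq> alg (carrier G)" using carrier by (auto dest: centerD(1))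
  ultimately show ?thesis unfolding subalg_def by simp
qed

text \<open>The fixed points of \<open>H\<close> commute with the group elements in \<open>H\<close>, so that
  \<open>Z(kH) = kH \<inter> (kG)\<^sup>H\<close>.\<close>

lemma fixed_commute:
  assumes H: "H \<subseteq> carrier G" and z: "z \<in> fixed H" and a: "a \<in> alg H"
  shows "z \<star> a = a \<star> z"
proof
  fix g
  show "(z \<star> a) g = (a \<star> z) g"
  proof (cases "g \<in> carrier G")
    case g: True
    have "(z \<star> a) g = (\<Sum>x\<in>carrier G. z x * a (inv x \<otimes> g))" using g by (simp add: conv_def)
    also have "\<dots> = (\<Sum>y\<in>carrier G. z (g \<otimes> inv y) * a y)"
      by (rule sum.reindex_bij_witness[where i = "\<lambda>y. g \<otimes> inv y" and j = "\<lambda>x. inv x \<otimes> g"])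
        (use g in \<open>auto simp: inv_mult_group m_assoc\<close>)
    also have "\<dots> = (\<Sum>y\<in>carrier G. a y * z (inv y \<otimes> g))"
    proof (intro sum.cong refl)
      fix y assume y: "y \<in> carrier G"
      show "z (g \<otimes> inv y) * a y = a y * z (inv y \<otimes> g)"
      proof (cases "y \<in> H")
        case True
        have "z (inv y \<otimes> (g \<otimes> inv y) \<otimes> y) = z (g \<otimes> inv y)"
          by (rule fixed_apply[OF z True]) (use y g in simp)
        then show ?thesis using y g by (simp add: m_assoc)
      qed (use a in \<open>simp add: alg_def\<close>)
    qed
    also have "\<dots> = (a \<star> z) g" using g by (simp add: conv_def)
    finally show ?thesis .
  qed (simp add: conv_def)
qed

lemma center_fixed:
  assumes H: "subgroup H G" and z: "z \<in> center H"
  shows "z \<in> fixed H"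
proof -
  have "act u z = z" if u: "u \<in> H" for u
  proof -
    have uG: "u \<in> carrier G" using u subgroup.subset[OF H] by blast
    have mult: "b \<otimes>\<^bsub>group_algebra G\<^esub> c = b \<star> c" for b c :: "'g \<Rightarrow> 'k"
      by (simp add: group_algebra_def conv_pairs)
    have act: "act u a = basis_elem u \<star> a \<star> basis_elem (inv u)" for a :: "'g \<Rightarrow> 'k"
      using conj_alg_eq_act[OF uG, of a] by (simp add: conj_alg_def mult)
    have "basis_elem u \<in> alg H" using u by (auto simp: alg_def basis_elem_def)
    from centerD(2)[OF z this] have "act u z = z \<star> (basis_elem u \<star> basis_elem (inv u))"
      unfolding act by (metis conv_assoc)
    also have "basis_elem u \<star> basis_elem (inv u) = act u unit"
    proof -
      have "basis_elem u \<in> alg (carrier G)" using uG by (auto simp: alg_def basis_elem_def)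
      then show ?thesis by (simp add: act unit_conv)
    qed
    also have "\<dots> = unit"
      using subalgD(2)[OF fixed_subalg[OF subgroup.subset[OF H]]] u by (simp add: fixed_def)
    finally show ?thesis
      using centerD(1)[OF z] alg_mono[OF subgroup.subset[OF H]] by (simp add: unit_conv subset_iff)
  qed
  then show ?thesis
    using centerD(1)[OF z] alg_mono[OF subgroup.subset[OF H]] by (auto simp: fixed_def)
qed

text \<open>\<open>Br\<^sub>S\<close> is multiplicative and restricts to the identity on \<open>kC\<^sub>G(S)\<close>, so it maps central
  elements to central elements.\<close>

lemma Br_center:
  assumes S: "psub S" and T: "T \<subseteq> S" and z: "z \<in> center (cen T)" "z \<in> fixed S"
  shows "Br S z \<in> center (cen S)"
proof -
  have "Br S z \<star> a = a \<star> Br S z" if a: "a \<in> alg (cen S)" for a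
  proof -
    have aS: "a \<in> fixed S" by (rule alg_cen_fixed[OF psubD(2)[OF S] a])
    have "a \<in> alg (cen T)" using a alg_mono[OF cen_antimono[OF T]] by blast
    then have "z \<star> a = a \<star> z" by (rule centerD(2)[OF z(1)])
    then show ?thesis
      using Br_conv[OF S z(2) aS] Br_conv[OF S aS z(2)] by (simp add: Br_id[OF a])
  qed
  then show ?thesis using Br_alg by (rule centerI[rotated])
qed

section \<open>Conjugation\<close>

lemma act_alg:
  assumes "x \<in> carrier G" "H \<subseteq> carrier G" "a \<in> alg H"
  shows "act x a \<in> alg (cset x H)"
  using assms by (auto simp: alg_def act_def mem_cset)

lemma act_fixed:
  assumes x: "x \<in> carrier G" and P: "P \<subseteq> carrier G" and a: "a \<in> fixed P"
  shows "act x a \<in> fixed (cset x P)"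
proof -
  have "act (conj_elem G x u) (act x a) = act x a" if u: "u \<in> P" for u
  proof -
    have uG: "u \<in> carrier G" using u P by blast
    have "act (conj_elem G x u) (act x a) = act (conj_elem G x u \<otimes> x) a"
      using x uG by (simp add: act_mult conj_elem_closed)
    also have "conj_elem G x u \<otimes> x = x \<otimes> u" using x uG by (simp add: conj_elem_def m_assoc)
    also have "act (x \<otimes> u) a = act x a" using x uG u a by (simp add: act_mult fixed_def)
    finally show ?thesis .
  qed
  then show ?thesis by (auto simp: fixed_def)
qed

lemma act_center:
  assumes x: "x \<in> carrier G" and H: "subgroup H G" and z: "z \<in> center H"
  shows "act x z \<in> center (cset x H)"
proof -
  note HG = subgroup.subset[OF H]
  have "act x z \<star> a = a \<star> act x z" if a: "a \<in> alg (cset x H)" for a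
  proof -
    have aG: "a \<in> alg (carrier G)" using a alg_mono[OF cset_subset[OF x HG]] by blast
    have "act (inv x) a \<in> alg H" using act_alg[OF _ cset_subset[OF x HG] a, of "inv x"] x HG by simp
    then have "act x (z \<star> act (inv x) a) = act x (act (inv x) a \<star> z)"
      using centerD(2)[OF z] by simp
    then show ?thesis using x aG by (simp add: act_conv)
  qed
  then show ?thesis using act_alg[OF x HG centerD(1)[OF z]] by (rule centerI[rotated])
qed

lemma Br_act:
  assumes "x \<in> carrier G" "P \<subseteq> carrier G"
  shows "Br (cset x P) (act x a) = act x (Br P a)"
  using assms cen_subset[of P]
  by (auto simp: brauer_hom_def act_def cen_cset mem_cset fun_eq_iff)

lemma Br_fixed:
  assumes R: "R \<subseteq> carrier G" and Q: "Q \<subseteq> carrier G" and nrm: "\<And>x. x \<in> R \<Longrightarrow> cset x Q = Q"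
    and a: "a \<in> fixed R"
  shows "Br Q a \<in> fixed R"
proof -
  have "act x (Br Q a) = Br Q a" if "x \<in> R" for x
    using Br_act[of x Q a] that R Q nrm[OF that] a by (auto simp: fixed_def subset_iff)
  then show ?thesis using alg_cen_carrier[OF Br_alg] by (simp add: fixed_def)
qed

lemma prim_act:
  assumes x: "x \<in> carrier G" and B: "B \<subseteq> alg (carrier G)" and B': "B' \<subseteq> alg (carrier G)"
    and act: "\<And>a. a \<in> B \<Longrightarrow> act x a \<in> B'" and act': "\<And>a. a \<in> B' \<Longrightarrow> act (inv x) a \<in> B"
    and i: "prim B i"
  shows "prim B' (act x i)"
proof -
  note iD = primD[OF i]
  have ix: "inv x \<in> carrier G" using x by simp
  have undo: "act (inv x) (act x a) = a" if "a \<in> B" for a using x B that by auto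
  have forth: "act x (act (inv x) a) = a" if "a \<in> B'" for a using x B' that by auto
  have "act x i \<star> act x i = act x i" using x by (simp add: iD flip: act_conv)
  moreover have "act x i \<noteq> 0" using undo[OF iD(1)] iD(3) by auto
  moreover have "a = 0 \<or> b = 0" if ab: "a \<in> B'" "b \<in> B'" "a \<star> a = a" "b \<star> b = b" "a \<star> b = 0" "b \<star> a = 0"
    "act x i = a + b" for a b
  proof -
    have "act (inv x) a = 0 \<or> act (inv x) b = 0"
    proof (rule iD(4))
      show "i = act (inv x) a + act (inv x) b"
        using ab(7) undo[OF iD(1)] by (simp add: act_add[symmetric])
    qed (use ab act' in \<open>simp_all add: act_conv[OF ix, symmetric]\<close>)
    then show ?thesis using forth ab(1,2) by (metis act_zero)
  qed
  ultimately show ?thesis using act[OF iD(1)] by (simp add: prim_def)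
qed

lemma prim_fixed_act:
  assumes x: "x \<in> carrier G" and P: "P \<subseteq> carrier G" and i: "prim (fixed P) i"
  shows "prim (fixed (cset x P)) (act x i)"
proof (rule prim_act[OF x _ _ _ _ i])
  show "act (inv x) a \<in> fixed P" if "a \<in> fixed (cset x P)" for a
    using act_fixed[OF _ cset_subset[OF x P] that, of "inv x"] x P by simp
qed (auto simp: act_fixed[OF x P], auto simp: fixed_def)

lemma blk_act:
  assumes x: "x \<in> carrier G" and P: "P \<subseteq> carrier G" and e: "blk P e"
  shows "blk (cset x P) (act x e)"
proof (rule prim_act[OF x _ _ _ _ e])
  note C = cen_subgroup[OF P]
  show "center (cen P) \<subseteq> alg (carrier G)" "center (cen (cset x P)) \<subseteq> alg (carrier G)"
    using alg_cen_carrier centerD(1) by blast+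
  show "act x a \<in> center (cen (cset x P))" if "a \<in> center (cen P)" for a
    using act_center[OF x C that] by (simp add: cen_cset x P)
  show "act (inv x) a \<in> center (cen P)" if "a \<in> center (cen (cset x P))" for a
    using act_center[OF _ cset_subgroup[OF x C], of "inv x" a] that x P cen_subset
    by (simp add: cen_cset)
qed

section \<open>Brauer pairs in terms of convolution\<close>

lemma mult_subgroup:
  assumes "subgroup H G" "a \<in> alg H" "b \<in> alg H"
  shows "a \<otimes>\<^bsub>group_algebra (G\<lparr>carrier := H\<rparr>)\<^esub> b = a \<star> b"
proof
  fix g
  have "H \<subseteq> carrier G" by (rule subgroup.subset[OF assms(1)])
  then have sub: "{(x, y) \<in> H \<times> H. x \<otimes> y = g} \<subseteq> {(x, y) \<in> carrier G \<times> carrier G. x \<otimes> y = g}"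
    by blast
  have fin: "finite {(x, y) \<in> carrier G \<times> carrier G. x \<otimes> y = g}"
    by (rule finite_subset[of _ "carrier G \<times> carrier G"]) (use finG in auto)
  have zero: "a x * b y = 0" if "(x, y) \<notin> H \<times> H" for x y
    using that assms(2,3) unfolding alg_def by fastforce
  have "(\<Sum>(x, y) \<in> {(x, y) \<in> H \<times> H. x \<otimes> y = g}. a x * b y)
      = (\<Sum>(x, y) \<in> {(x, y) \<in> carrier G \<times> carrier G. x \<otimes> y = g}. a x * b y)"
  proof (rule sum.mono_neutral_left[OF fin sub], rule ballI)
    fix z assume "z \<in> {(x, y) \<in> carrier G \<times> carrier G. x \<otimes> y = g} - {(x, y) \<in> H \<times> H. x \<otimes> y = g}"
    then have "(fst z, snd z) \<notin> H \<times> H" by auto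
    then show "(case z of (x, y) \<Rightarrow> a x * b y) = 0" unfolding case_prod_beta by (rule zero)
  qed
  then show "(a \<otimes>\<^bsub>group_algebra (G\<lparr>carrier := H\<rparr>)\<^esub> b) g = (a \<star> b) g"
    by (simp add: group_algebra_def conv_pairs)
qed

lemma group_algebra_simps:
  "carrier (group_algebra (G\<lparr>carrier := H\<rparr>)) = alg H"
  "\<zero>\<^bsub>group_algebra (G\<lparr>carrier := H\<rparr>)\<^esub> = (0 :: 'g \<Rightarrow> 'k)"
  "a \<oplus>\<^bsub>group_algebra (G\<lparr>carrier := H\<rparr>)\<^esub> b = (a + b :: 'g \<Rightarrow> 'k)"
  by (auto simp: group_algebra_def alg_def fun_eq_iff)

lemma block_idempotent_iff:
  assumes H: "subgroup H G"
  shows "block_idempotent (G\<lparr>carrier := H\<rparr>) e \<longleftrightarrow> prim (center H) e"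
proof -
  let ?A = "group_algebra (G\<lparr>carrier := H\<rparr>) :: ('g \<Rightarrow> 'k) ring"
  have c: "carrier (ring_center ?A) = center H"
  proof -
    have "(\<forall>a\<in>alg H. z \<otimes>\<^bsub>?A\<^esub> a = a \<otimes>\<^bsub>?A\<^esub> z) \<longleftrightarrow> (\<forall>a\<in>alg H. z \<star> a = a \<star> z)" if "z \<in> alg H" for z
      using that by (intro ball_cong refl) (simp only: mult_subgroup[OF H])
    then show ?thesis unfolding ring_center_def center_def by (simp add: group_algebra_simps cong: conj_cong)
  qed
  have ops: "\<zero>\<^bsub>ring_center ?A\<^esub> = 0" "a \<oplus>\<^bsub>ring_center ?A\<^esub> b = a + b" for a b
    by (simp_all add: ring_center_def group_algebra_simps)
  have m: "a \<otimes>\<^bsub>ring_center ?A\<^esub> b = a \<star> b" if "a \<in> center H" "b \<in> center H" for a b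
    using that by (simp add: ring_center_def mult_subgroup[OF H] centerD(1))
  have idem: "idempotents (ring_center ?A) = {a \<in> center H. a \<star> a = a}"
    by (auto simp: idempotents_def c m)
  show ?thesis
    unfolding block_idempotent_def primitive_idempotent_def idem prim_def ops by (auto simp: m)
qed

lemma primitive_idempotent_fixed_iff:
  assumes "P \<subseteq> carrier G"
  shows "primitive_idempotent (fixed_algebra G P) i \<longleftrightarrow> prim (fixed P) i"
    and "idempotents (fixed_algebra G P) = {a \<in> fixed P. a \<star> a = a}"
proof -
  let ?A = "fixed_algebra G P :: ('g \<Rightarrow> 'k) ring"
  have c: "carrier ?A = fixed P"
    using assms
    by (auto simp: fixed_algebra_def group_algebra_def fixed_def alg_def conj_alg_eq_act subset_iff)
  have ops: "\<zero>\<^bsub>?A\<^esub> = 0" "a \<oplus>\<^bsub>?A\<^esub> b = a + b" "a \<otimes>\<^bsub>?A\<^esub> b = a \<star> b" for a b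
    by (auto simp: fixed_algebra_def group_algebra_def conv_pairs fun_eq_iff)
  show idem: "idempotents ?A = {a \<in> fixed P. a \<star> a = a}"
    by (auto simp: idempotents_def c ops)
  show "primitive_idempotent ?A i \<longleftrightarrow> prim (fixed P) i"
    unfolding primitive_idempotent_def idem prim_def ops by auto
qed

lemma brauer_pair_iff: "brauer_pair G P e \<longleftrightarrow> psub P \<and> blk P e"
  using block_idempotent_iff[OF cen_subgroup[OF psubD(2)]] by (auto simp: brauer_pair_def char_eq)

lemma associated_iff:
  assumes "P \<subseteq> carrier G" "e \<in> alg (cen P)"
  shows "associated_idempotent G i P e \<longleftrightarrow>
    i \<in> fixed P \<and> i \<star> i = i \<and> e \<star> Br P i = Br P i \<and> Br P i \<noteq> 0"
  using assms
  by (auto simp: associated_idempotent_def primitive_idempotent_fixed_iff group_algebra_simps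
      mult_subgroup[OF cen_subgroup] Br_alg)

lemma brauer_pairD:
  assumes "brauer_pair G P e"
  shows "psub P" "blk P e" "subgroup P G" "P \<subseteq> carrier G" "subgroup (cen P) G"
    "e \<in> center (cen P)" "e \<in> alg (cen P)" "e \<in> alg (carrier G)" "e \<in> fixed P" "e \<star> e = e" "e \<noteq> 0"
proof -
  show P: "psub P" and e: "blk P e" using assms by (auto simp: brauer_pair_iff)
  show "subgroup P G" "P \<subseteq> carrier G" using psubD[OF P] by blast+
  then show "subgroup (cen P) G" by (simp add: cen_subgroup)
  show "e \<in> center (cen P)" "e \<star> e = e" "e \<noteq> 0" using primD[OF e] by auto
  then show eP: "e \<in> alg (cen P)" "e \<in> alg (carrier G)" using centerD(1) alg_cen_carrier by blast+
  show "e \<in> fixed P" by (rule alg_cen_fixed[OF psubD(2)[OF P] eP(1)])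
qed

lemma brauer_leD:
  assumes "brauer_le G Q f P e"
  shows "brauer_pair G Q f" "brauer_pair G P e" "Q \<subseteq> P"
    "prim (fixed P) i \<Longrightarrow> associated_idempotent G i P e \<Longrightarrow> associated_idempotent G i Q f"
  using assms primitive_idempotent_fixed_iff(1)[OF brauer_pairD(4)]
  by (auto simp: brauer_le_def)

lemma brauer_leI:
  assumes "brauer_pair G Q f" "brauer_pair G P e" "Q \<subseteq> P"
    "\<And>i. prim (fixed P) i \<Longrightarrow> associated_idempotent G i P e \<Longrightarrow> associated_idempotent G i Q f"
  shows "brauer_le G Q f P e"
  using assms primitive_idempotent_fixed_iff(1)[OF brauer_pairD(4)[OF assms(2)]]
  by (auto simp: brauer_le_def)

lemma brauer_pair_conj:
  "x \<in> carrier G \<Longrightarrow> brauer_pair G P e \<Longrightarrow> brauer_pair G (cset x P) (act x e)"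
  by (auto simp: brauer_pair_iff psub_cset blk_act psubD)

lemma associated_conj:
  assumes x: "x \<in> carrier G" and P: "brauer_pair G P e" and i: "associated_idempotent G i P e"
  shows "associated_idempotent G (act x i) (cset x P) (act x e)"
proof -
  note D = brauer_pairD[OF P] and D' = brauer_pairD[OF brauer_pair_conj[OF x P]]
  have i: "i \<in> fixed P" "i \<star> i = i" "e \<star> Br P i = Br P i" "Br P i \<noteq> 0"
    using i associated_iff[OF D(4,7)] by auto
  have "act x (Br P i) \<noteq> 0"
    using i(4) act_inv(1)[OF x alg_cen_carrier[OF Br_alg]] by (metis act_zero)
  then show ?thesis
    using i by (simp add: associated_iff[OF D'(4,7)] act_fixed x D Br_act flip: act_conv)
qed

lemma brauer_le_conj:
  assumes x: "x \<in> carrier G" and le: "brauer_le G Q f P e"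
  shows "brauer_le G (cset x Q) (act x f) (cset x P) (act x e)"
proof -
  note leD = brauer_leD[OF le]
  note P = brauer_pairD[OF leD(2)]
  have ix: "inv x \<in> carrier G" using x by simp
  show ?thesis
  proof (rule brauer_leI)
    fix i assume i: "prim (fixed (cset x P)) i" "associated_idempotent G i (cset x P) (act x e)"
    have "prim (fixed P) (act (inv x) i)"
      using prim_fixed_act[OF ix cset_subset[OF x P(4)] i(1)] x P(4) by simp
    moreover have "associated_idempotent G (act (inv x) i) P e"
      using associated_conj[OF ix brauer_pair_conj[OF x leD(2)] i(2)] x P by simp
    ultimately have "associated_idempotent G (act (inv x) i) Q f" by (rule leD(4))
    from associated_conj[OF x leD(1) this]
    show "associated_idempotent G i (cset x Q) (act x f)"
      using x primD(1)[OF i(1)] by (simp add: fixed_def)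
  qed (use x leD brauer_pair_conj in auto)
qed

section \<open>Blocks and the Brauer homomorphism\<close>

lemma blk_cases:
  assumes P: "P \<subseteq> carrier G" and e: "blk P e" and z: "z \<in> center (cen P)" "z \<star> z = z"
  shows "z \<star> e = e \<or> z \<star> e = 0"
proof -
  note eD = primD[OF e] and cl = subalgD[OF center_subalg[OF cen_subgroup[OF P]]]
  have ze: "z \<star> e = e \<star> z" using centerD[of e "cen P"] centerD[of z "cen P"] eD(1) z(1) by blast
  have idem: "(z \<star> e) \<star> (z \<star> e) = z \<star> e"
  proof -
    have "(z \<star> e) \<star> (z \<star> e) = z \<star> (e \<star> z) \<star> e" by (simp only: conv_assoc)
    also have "\<dots> = z \<star> (z \<star> e) \<star> e" by (simp only: ze)
    also have "\<dots> = (z \<star> z) \<star> (e \<star> e)" by (simp only: conv_assoc)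
    finally show ?thesis by (simp only: z(2) eD(2))
  qed
  have e1: "e \<star> (z \<star> e) = z \<star> e" unfolding ze by (simp only: conv_assoc[symmetric] eD(2))
  have e2: "(z \<star> e) \<star> e = z \<star> e" by (simp only: conv_assoc eD(2))
  have "z \<star> e = 0 \<or> e - z \<star> e = 0"
  proof (rule eD(4))
    show "z \<star> e \<in> center (cen P)" "e - z \<star> e \<in> center (cen P)" by (intro cl(5,6) z(1) eD(1))+
  qed (simp_all add: conv_distribs idem e1 e2 eD(2))
  then show ?thesis by auto
qed

lemma blk_orth:
  assumes P: "P \<subseteq> carrier G" and e: "blk P e" "blk P e'" and ne: "e \<star> e' \<noteq> 0"
  shows "e = e'"
proof -
  note eD = primD[OF e(1)] and eD' = primD[OF e(2)]
  have "e \<star> e' = e'" using blk_cases[OF P e(2) eD(1,2)] ne by blast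
  moreover have "e \<star> e' = e' \<star> e" using centerD[of e "cen P"] centerD[of e' "cen P"] eD(1) eD'(1) by blast
  moreover have "e' \<star> e = e" using blk_cases[OF P e(1) eD'(1,2)] ne calculation by argo
  ultimately show ?thesis by simp
qed

lemma blk_sum:
  assumes P: "P \<subseteq> carrier G"
  shows "finite {e. blk P e}" "\<Sum>{e. blk P e} = unit"
proof -
  obtain I where I: "finite I" "\<forall>i\<in>I. blk P i" "\<Sum>I = unit"
    using primitive_decomposition[OF center_subalg[OF cen_subgroup[OF P]]] by blast
  have "e \<in> I" if e: "blk P e" for e
  proof -
    have "e \<in> alg (carrier G)" using primD(1)[OF e] centerD(1) alg_cen_carrier by blast
    then have "e = e \<star> \<Sum>I" by (simp add: I unit_conv)
    also have "\<dots> = (\<Sum>i\<in>I. e \<star> i)" by (rule conv_sum_right)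
    finally have "(\<Sum>i\<in>I. e \<star> i) \<noteq> 0" using primD(3)[OF e] by simp
    then obtain i where "i \<in> I" "e \<star> i \<noteq> 0"
      by (rule sum.not_neutral_contains_not_neutral)
    then show ?thesis using blk_orth[OF P e, of i] I by auto
  qed
  then have "{e. blk P e} = I" using I by blast
  then show "finite {e. blk P e}" "\<Sum>{e. blk P e} = unit" using I by simp_all
qed

text \<open>As the corner of \<open>i\<close> is local and \<open>Br\<^sub>P\<close> maps onto \<open>kC\<^sub>G(P)\<close>, the image of \<open>i\<close> lies
  entirely inside or entirely outside of each central summand of \<open>kC\<^sub>G(P)\<close>.\<close>

lemma prim_central_cases:
  assumes P: "psub P" and i: "prim (fixed P) i" and e: "e \<in> center (cen P)" "e \<star> e = e"
  shows "e \<star> Br P i = Br P i \<or> e \<star> Br P i = 0"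
proof -
  note PG = psubD(2)[OF P] and iD = primD[OF i]
  have eP: "e \<in> alg (cen P)" using centerD(1)[OF e(1)] .
  have eF: "e \<in> fixed P" by (rule alg_cen_fixed[OF PG eP])
  have comm: "e \<star> Br P i = Br P i \<star> e" by (rule centerD(2)[OF e(1) Br_alg])
  have idem: "Br P i \<star> Br P i = Br P i" using Br_conv[OF P iD(1) iD(1)] iD(2) by simp
  note cl = subalgD[OF fixed_subalg[OF PG]]
  have img: "Br P (i \<star> e \<star> i) = e \<star> Br P i"
  proof -
    have "Br P (i \<star> e \<star> i) = (Br P i \<star> e) \<star> Br P i"
      by (simp add: Br_conv[OF P] cl(6) iD(1) eF Br_id[OF eP])
    also have "\<dots> = (e \<star> Br P i) \<star> Br P i" by (simp only: comm)
    also have "\<dots> = e \<star> Br P i" by (simp only: conv_assoc idem)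
    finally show ?thesis .
  qed
  have "(e \<star> Br P i) \<star> (e \<star> Br P i) = e \<star> (Br P i \<star> e) \<star> Br P i" by (simp only: conv_assoc)
  also have "\<dots> = e \<star> (e \<star> Br P i) \<star> Br P i" by (simp only: comm)
  also have "\<dots> = (e \<star> e) \<star> (Br P i \<star> Br P i)" by (simp only: conv_assoc)
  also have "\<dots> = e \<star> Br P i" by (simp only: e(2) idem)
  finally have idem': "(e \<star> Br P i) \<star> (e \<star> Br P i) = e \<star> Br P i" .
  from prim_corner_image[OF fixed_subalg[OF PG] i eF, of "Br P"]
  have "e \<star> Br P i = 0 \<or> (\<exists>u\<in>fixed P. i = i \<star> e \<star> i \<star> u)"
    by (simp add: img idem' Br_conv[OF P])
  then show ?thesis
  proof
    assume "\<exists>u\<in>fixed P. i = i \<star> e \<star> i \<star> u"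
    then obtain u where u: "u \<in> fixed P" "i = i \<star> e \<star> i \<star> u" by blast
    have "Br P (i \<star> e \<star> i \<star> u) = Br P (i \<star> e \<star> i) \<star> Br P u"
      by (rule Br_conv[OF P _ u(1)]) (intro cl(6) iD(1) eF)
    then have "Br P i = e \<star> (Br P i \<star> Br P u)"
      unfolding u(2)[symmetric] unfolding img unfolding conv_assoc .
    then have "e \<star> Br P i = Br P i" by (metis conv_assoc e(2))
    then show ?thesis ..
  qed blast
qed

lemma associatedD:
  assumes "brauer_pair G P e" "associated_idempotent G i P e"
  shows "i \<in> fixed P" "i \<star> i = i" "e \<star> Br P i = Br P i" "Br P i \<star> e = Br P i" "Br P i \<noteq> 0"
    "Br P i \<star> Br P i = Br P i"
proof -
  note D = brauer_pairD[OF assms(1)]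
  show i: "i \<in> fixed P" "i \<star> i = i" and e: "e \<star> Br P i = Br P i" and "Br P i \<noteq> 0"
    using assms(2) associated_iff[OF D(4,7)] by auto
  show "Br P i \<star> e = Br P i" using centerD(2)[OF D(6) Br_alg, of i] e by simp
  show "Br P i \<star> Br P i = Br P i" using Br_conv[OF D(1) i(1) i(1)] i(2) by simp
qed

lemma associated_unique:
  assumes e: "brauer_pair G P e" "associated_idempotent G i P e"
    and f: "brauer_pair G P f" "associated_idempotent G j P f" and ne: "Br P i \<star> Br P j \<noteq> 0"
  shows "e = f"
proof -
  have "Br P i \<star> Br P j = Br P i \<star> (e \<star> f) \<star> Br P j"
    using associatedD(4)[OF e] associatedD(3)[OF f] by (metis conv_assoc)
  then have "e \<star> f \<noteq> 0" using ne by auto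
  then show ?thesis
    using blk_orth[of P e f] brauer_pairD(2,4)[OF e(1)] brauer_pairD(2)[OF f(1)] by blast
qed

lemma associated_unique':
  fixes e f :: "'g \<Rightarrow> 'k"
  assumes "brauer_pair G P e" "associated_idempotent G i P e"
    and "brauer_pair G P f" "associated_idempotent G i P f"
  shows "e = f"
  using associated_unique[OF assms] associatedD(5,6)[OF assms(1,2)] by simp

lemma prim_associated_exists:
  assumes P: "psub P" and i: "prim (fixed P) i" and ne: "Br P i \<noteq> 0"
  shows "\<exists>e. brauer_pair G P e \<and> associated_idempotent G i P e"
proof -
  note PG = psubD(2)[OF P]
  have "Br P i = unit \<star> Br P i" by (simp add: unit_conv alg_cen_carrier[OF Br_alg])
  also have "\<dots> = (\<Sum>e\<in>{e. blk P e}. e \<star> Br P i)"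
    unfolding blk_sum(2)[OF PG, symmetric] by (rule conv_sum_left)
  finally have "(\<Sum>e\<in>{e. blk P e}. e \<star> Br P i) \<noteq> 0" using ne by simp
  then obtain e where "e \<in> {e. blk P e}" "e \<star> Br P i \<noteq> 0"
    by (rule sum.not_neutral_contains_not_neutral)
  then have e: "blk P e" "e \<star> Br P i \<noteq> 0" by simp_all
  have pair: "brauer_pair G P e" using e(1) P by (simp add: brauer_pair_iff)
  note D = brauer_pairD[OF pair]
  have "e \<star> Br P i = Br P i" using prim_central_cases[OF P i D(6,10)] e(2) by blast
  then have "associated_idempotent G i P e"
    using ne primD[OF i] by (simp add: associated_iff[OF D(4,7)])
  then show ?thesis using pair by blast
qed

text \<open>Decompose \<open>1\<close> into primitive idempotents of \<open>(kG)\<^sup>P\<close>; one of them survives in \<open>e z\<close>.\<close>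

lemma brauer_pair_has_prim:
  assumes e: "brauer_pair G P e" and z: "z \<in> alg (cen P)" "e \<star> z \<noteq> 0"
  shows "\<exists>i. prim (fixed P) i \<and> associated_idempotent G i P e \<and> z \<star> Br P i \<noteq> 0"
proof -
  note D = brauer_pairD[OF e]
  obtain I where I: "finite I" "\<forall>i\<in>I. prim (fixed P) i" "\<Sum>I = unit"
    using primitive_decomposition[OF fixed_subalg[OF D(4)]] by blast
  have comm: "e \<star> z = z \<star> e" by (rule centerD(2)[OF D(6) z(1)])
  have "z \<star> e = (z \<star> e) \<star> Br P unit"
    by (simp add: Br_unit[OF D(4)] unit_conv conv_carrier)
  also have "\<dots> = (\<Sum>i\<in>I. (z \<star> e) \<star> Br P i)"
    unfolding I(3)[symmetric] Br_sum by (rule conv_sum_right)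
  finally have "(\<Sum>i\<in>I. (z \<star> e) \<star> Br P i) \<noteq> 0" using z(2) comm by simp
  then obtain i where "i \<in> I" "(z \<star> e) \<star> Br P i \<noteq> 0"
    by (rule sum.not_neutral_contains_not_neutral)
  then have i: "i \<in> I" "z \<star> (e \<star> Br P i) \<noteq> 0" by (simp_all only: conv_assoc not_False_eq_True)
  then have "e \<star> Br P i \<noteq> 0" by auto
  then have eq: "e \<star> Br P i = Br P i"
    using prim_central_cases[OF D(1) _ D(6,10), of i] I(2) i(1) by blast
  then have "Br P i \<noteq> 0" using i(2) by auto
  then have "associated_idempotent G i P e"
    using eq I(2) i(1) primD by (auto simp: associated_iff[OF D(4,7)])
  then show ?thesis using I(2) i eq by auto
qed

lemma brauer_pair_has_prim':
  assumes "brauer_pair G P e"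
  shows "\<exists>i. prim (fixed P) i \<and> associated_idempotent G i P e"
  using brauer_pair_has_prim[OF assms brauer_pairD(7)[OF assms]] brauer_pairD(10,11)[OF assms] by auto

section \<open>Relative traces\<close>

abbreviation shift :: "'g \<Rightarrow> 'g set \<Rightarrow> 'g set" (infixr \<open>\<rhd>\<close> 75) where
  "x \<rhd> X \<equiv> l_coset G x X"

text \<open>The relative trace from \<open>D\<close> to \<open>N\<close> sums the translates of a \<open>D\<close>-fixed element over the left
  cosets of \<open>D\<close> in \<open>N\<close>; on such an element, all members of a coset act alike.\<close>

definition cosets :: "'g set \<Rightarrow> 'g set \<Rightarrow> 'g set set" where
  "cosets N D = (\<lambda>x. x \<rhd> D) ` N"

definition coset_act :: "'g set \<Rightarrow> ('g \<Rightarrow> 'k) \<Rightarrow> 'g \<Rightarrow> 'k" where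
  "coset_act X a = act (SOME x. x \<in> X) a"

definition trace :: "'g set \<Rightarrow> 'g set \<Rightarrow> ('g \<Rightarrow> 'k) \<Rightarrow> 'g \<Rightarrow> 'k" where
  "trace D N a = (\<Sum>X\<in>cosets N D. coset_act X a)"

lemma l_coset_eq_iff:
  assumes D: "subgroup D G" and "x \<in> carrier G" "y \<in> carrier G"
  shows "x \<rhd> D = y \<rhd> D \<longleftrightarrow> inv x \<otimes> y \<in> D"
proof
  interpret D: subgroup D G by fact
  have mem: "g \<in> z \<rhd> D \<longleftrightarrow> g \<in> carrier G \<and> inv z \<otimes> g \<in> D" if "z \<in> carrier G" for g z
  proof
    assume g: "g \<in> carrier G \<and> inv z \<otimes> g \<in> D"
    then have "g = z \<otimes> (inv z \<otimes> g)" using that by simp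
    then show "g \<in> z \<rhd> D" using g unfolding l_coset_def by blast
  qed (use that in \<open>auto simp: l_coset_def\<close>)
  { assume "x \<rhd> D = y \<rhd> D"
    moreover have "y \<in> y \<rhd> D" using assms by (simp add: mem)
    ultimately have "y \<in> x \<rhd> D" by simp
    then show "inv x \<otimes> y \<in> D" using assms by (simp add: mem) }
  { assume xy: "inv x \<otimes> y \<in> D"
    have "inv x \<otimes> g \<in> D \<longleftrightarrow> inv y \<otimes> g \<in> D" if g: "g \<in> carrier G" for g
    proof -
      have "inv x \<otimes> g = (inv x \<otimes> y) \<otimes> (inv y \<otimes> g)" using g assms by (simp add: m_assoc)
      moreover have "inv y \<otimes> g = inv (inv x \<otimes> y) \<otimes> (inv x \<otimes> g)"
        using g assms by (simp add: m_assoc inv_mult_group)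
      ultimately show ?thesis using xy by (metis D.m_closed D.m_inv_closed)
    qed
    then show "x \<rhd> D = y \<rhd> D" using assms by (auto simp: mem) }
qed

lemma some_in_coset:
  assumes D: "subgroup D G" and x: "x \<in> carrier G"
  shows "(SOME y. y \<in> x \<rhd> D) \<in> carrier G" "(SOME y. y \<in> x \<rhd> D) \<rhd> D = x \<rhd> D"
    "(SOME y. y \<in> x \<rhd> D) \<in> x \<rhd> D"
proof -
  have "x \<in> x \<rhd> D" by (rule lcos_self[OF x D])
  then show *: "(SOME y. y \<in> x \<rhd> D) \<in> x \<rhd> D" by (rule someI)
  then show yG: "(SOME y. y \<in> x \<rhd> D) \<in> carrier G"
    using l_coset_subset_G[OF subgroup.subset[OF D] x] by blast
  show "(SOME y. y \<in> x \<rhd> D) \<rhd> D = x \<rhd> D"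
    using l_repr_independence[OF * x D] by simp
qed

lemma coset_act_eq:
  assumes D: "subgroup D G" and x: "x \<in> carrier G" and a: "a \<in> fixed D"
  shows "coset_act (x \<rhd> D) a = act x a"
proof -
  define y where "y = (SOME y. y \<in> x \<rhd> D)"
  have y: "y \<in> carrier G" "x \<rhd> D = y \<rhd> D" unfolding y_def using some_in_coset[OF D x] by auto
  have d: "inv x \<otimes> y \<in> D" using y l_coset_eq_iff[OF D x] by blast
  have "act y a = act (x \<otimes> (inv x \<otimes> y)) a" using x y by simp
  also have "\<dots> = act x (act (inv x \<otimes> y) a)" using x y by (intro act_mult) auto
  also have "act (inv x \<otimes> y) a = a" using d a by (simp add: fixed_def)
  finally show ?thesis by (simp add: coset_act_def flip: y_def)
qed

lemma cosets_finite: "N \<subseteq> carrier G \<Longrightarrow> finite (cosets N D)"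
  unfolding cosets_def using finG finite_subset by blast

lemma cosets_translate:
  assumes N: "subgroup N G" and D: "D \<subseteq> carrier G" and y: "y \<in> N"
  shows "(\<lambda>X. y \<rhd> X) ` cosets N D = cosets N D" "inj_on (\<lambda>X. y \<rhd> X) (cosets N D)"
proof -
  interpret N: subgroup N G by fact
  have move: "z \<rhd> (x \<rhd> D) = (z \<otimes> x) \<rhd> D" if "z \<in> N" "x \<in> N" for z x
    using that D lcos_m_assoc by simp
  have undo: "inv y \<rhd> (y \<rhd> X) = X" if "X \<in> cosets N D" for X
    using that y by (auto simp: cosets_def move)
  show "inj_on (\<lambda>X. y \<rhd> X) (cosets N D)" by (rule inj_on_inverseI[of _ "\<lambda>X. inv y \<rhd> X"]) (rule undo)
  have "X \<in> (\<lambda>X. y \<rhd> X) ` cosets N D" if X: "X \<in> cosets N D" for X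
  proof -
    obtain x where x: "x \<in> N" "X = x \<rhd> D" using X by (auto simp: cosets_def)
    then have "X = y \<rhd> ((inv y \<otimes> x) \<rhd> D)" using y by (simp add: move)
    then show ?thesis using x y by (auto simp: cosets_def)
  qed
  then show "(\<lambda>X. y \<rhd> X) ` cosets N D = cosets N D" using y by (auto simp: cosets_def move)
qed

lemma card_cosets:
  assumes N: "subgroup N G" and D: "subgroup D G" and DN: "D \<subseteq> N"
  shows "card (cosets N D) * card D = card N"
proof -
  let ?N = "G\<lparr>carrier := N\<rparr>"
  have "lcosets\<^bsub>?N\<^esub> D = cosets N D" by (auto simp: LCOSETS_def cosets_def)
  moreover have "subgroup D ?N" using subgroup_incl[OF D N DN] .
  moreover have "finite (carrier ?N)" using finG subgroup.subset[OF N] finite_subset by auto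
  ultimately show ?thesis
    using group.l_lagrange[OF subgroup_imp_group[OF N], of D] by (simp add: order_def)
qed

context
  fixes N D assumes N: "subgroup N G" and D: "subgroup D G" and DN: "D \<subseteq> N"
begin

interpretation N: subgroup N G by (rule N)
interpretation D: subgroup D G by (rule D)

lemma coset_act_translate:
  assumes X: "X \<in> cosets N D" and a: "a \<in> fixed D" and y: "y \<in> N"
  shows "coset_act (y \<rhd> X) a = act y (coset_act X a)"
proof -
  obtain x where x: "x \<in> N" "X = x \<rhd> D" using X by (auto simp: cosets_def)
  then have "y \<rhd> X = (y \<otimes> x) \<rhd> D" using y D.subset by (simp add: lcos_m_assoc)
  then show ?thesis using x y a by (simp add: coset_act_eq[OF D] act_mult)
qed

lemma trace_fixed:
  assumes a: "a \<in> fixed D"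
  shows "trace D N a \<in> fixed N"
proof -
  have "act y (trace D N a) = trace D N a" if y: "y \<in> N" for y
  proof -
    have "act y (trace D N a) = (\<Sum>X\<in>cosets N D. coset_act (y \<rhd> X) a)"
      unfolding trace_def act_sum using a y by (intro sum.cong refl) (simp add: coset_act_translate)
    also have "\<dots> = (\<Sum>X\<in>(\<lambda>X. y \<rhd> X) ` cosets N D. coset_act X a)"
      using cosets_translate(2)[OF N D.subset y] by (simp add: sum.reindex)
    finally show ?thesis using cosets_translate(1)[OF N D.subset y] by (simp add: trace_def)
  qed
  moreover have "trace D N a \<in> alg (carrier G)"
    unfolding trace_def coset_act_def by (intro alg_sum act_carrier)
  ultimately show ?thesis by (simp add: fixed_def)
qed

text \<open>The Mackey formula after applying \<open>Br\<^sub>S\<close>: only the cosets \<open>xD\<close> with \<open>S \<le> xDx\<inverse>\<close> survive.\<close>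

lemma Br_trace:
  assumes S: "psub S" "S \<subseteq> N" and a: "a \<in> fixed D"
  shows "Br S (trace D N a) = (\<Sum>X \<in> {X \<in> cosets N D. \<forall>s\<in>S. s \<rhd> X = X}. Br S (coset_act X a))"
proof
  fix g
  interpret S: subgroup S G by (rule psubD(1)[OF S(1)])
  obtain n where n: "card S = CHAR('k) ^ n" using S by (auto simp: p_subgroup_def char_eq)
  let ?S = "G\<lparr>carrier := S\<rparr>"
  show "Br S (trace D N a) g = (\<Sum>X \<in> {X \<in> cosets N D. \<forall>s\<in>S. s \<rhd> X = X}. Br S (coset_act X a)) g"
  proof (cases "g \<in> cen S")
    case g: True
    have gG: "g \<in> carrier G" using g cen_subset by blast
    have sub: "X \<subseteq> carrier G" if X: "X \<in> cosets N D" for X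
    proof -
      obtain x where "x \<in> N" "X = x \<rhd> D" using X unfolding cosets_def by (rule imageE)
      then show ?thesis using l_coset_subset_G[OF D.subset] N.subset by simp
    qed
    have "trace D N a g = (\<Sum>X\<in>cosets N D. coset_act X a g)"
      by (simp add: trace_def sum_fun_apply)
    also have "\<dots> = (\<Sum>X \<in> {X \<in> cosets N D. \<forall>s \<in> carrier ?S. s \<rhd> X = X}. coset_act X a g)"
    proof (rule sum_invariant_eq_sum_fixed[where n = n])
      show "group ?S" by (rule subgroup_imp_group[OF psubD(1)[OF S(1)]])
      fix s X assume sX: "s \<in> carrier ?S" "X \<in> cosets N D"
      then have s: "s \<in> S" "s \<in> N" "s \<in> carrier G" using S by auto
      show "s \<rhd> X \<in> cosets N D" using cosets_translate(1)[OF N D.subset s(2)] sX by blast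
      have "inv s \<otimes> g \<otimes> s = g" using g gG s(1) cen_conj[OF S.subset gG] by blast
      then show "coset_act (s \<rhd> X) a g = coset_act X a g"
        using gG by (simp add: coset_act_translate[OF sX(2) a s(2)] act_def)
    qed (use n char_pos cosets_finite[OF N.subset] sub in \<open>auto simp: lcos_mult_one lcos_m_assoc\<close>)
    finally show ?thesis using g by (simp add: brauer_hom_def sum_fun_apply)
  qed (simp add: brauer_hom_def sum_fun_apply)
qed

lemma conv_trace:
  assumes d: "d \<in> fixed N"
  shows "d \<star> trace D N a = trace D N (d \<star> a)" "trace D N a \<star> d = trace D N (a \<star> d)"
proof -
  have "coset_act X (d \<star> a) = d \<star> coset_act X a" "coset_act X (a \<star> d) = coset_act X a \<star> d"
    if X: "X \<in> cosets N D" for X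
  proof -
    obtain x where x: "x \<in> N" "X = x \<rhd> D" using X by (auto simp: cosets_def)
    have "(SOME y. y \<in> X) \<in> x \<rhd> D" using x some_in_coset(3)[OF D] by simp
    then have y: "(SOME y. y \<in> X) \<in> N" using x DN N.m_closed by (auto simp: l_coset_def subset_iff)
    then have "act (SOME y. y \<in> X) d = d" using d by (simp add: fixed_def)
    then show "coset_act X (d \<star> a) = d \<star> coset_act X a" "coset_act X (a \<star> d) = coset_act X a \<star> d"
      using y by (simp_all add: coset_act_def act_conv)
  qed
  then show "d \<star> trace D N a = trace D N (d \<star> a)" "trace D N a \<star> d = trace D N (a \<star> d)"
    by (simp_all add: trace_def conv_sum_right conv_sum_left)
qed

lemma trace_sum: "trace D N (\<Sum>i\<in>I. F i) = (\<Sum>i\<in>I. trace D N (F i))"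
  unfolding trace_def coset_act_def act_sum by (rule sum.swap)

lemma trace_of_fixed:
  assumes a: "a \<in> fixed N"
  shows "trace D N a = scale (of_nat (card (cosets N D))) a"
proof -
  have "coset_act X a = a" if "X \<in> cosets N D" for X
  proof -
    have "a \<in> fixed D" using a fixed_antimono[OF DN] by blast
    then show ?thesis using that a by (auto simp: cosets_def coset_act_eq[OF D] fixed_def)
  qed
  then show ?thesis
    by (auto simp: trace_def scale_def sum_fun_apply fun_eq_iff)
qed

lemma trace_alg:
  assumes C: "C \<subseteq> carrier G" "\<And>x. x \<in> N \<Longrightarrow> cset x C = C" and a: "a \<in> fixed D" "a \<in> alg C"
  shows "trace D N a \<in> alg C"
  unfolding trace_def
proof (rule alg_sum)
  fix X assume "X \<in> cosets N D"
  then obtain x where x: "x \<in> N" "X = x \<rhd> D" by (auto simp: cosets_def)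
  then show "coset_act X a \<in> alg C"
    using act_alg[OF _ C(1) a(2), of x] C(2)[OF x(1)] by (simp add: coset_act_eq[OF D _ a(1)])
qed

end

lemma trace_trace:
  assumes N: "subgroup N G" and D: "subgroup D G" and Q: "subgroup Q G" and DN: "D \<subseteq> N" and QD: "Q \<subseteq> D"
    and a: "a \<in> fixed Q"
  shows "trace D N (trace Q D a) = trace Q N a"
proof -
  interpret N: subgroup N G by fact
  interpret D: subgroup D G by fact
  interpret Q: subgroup Q G by fact
  define r where "r X = (SOME x. x \<in> X)" for X :: "'g set"
  have r: "r X \<in> N" "r X \<rhd> D = X" if X: "X \<in> cosets N D" for X
  proof -
    obtain x where x: "x \<in> N" "X = x \<rhd> D" using X by (auto simp: cosets_def)
    then show "r X \<rhd> D = X" "r X \<in> N"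
      using some_in_coset[OF D, of x] DN by (auto simp: r_def l_coset_def)
  qed
  have move: "y \<rhd> (z \<rhd> Q) = (y \<otimes> z) \<rhd> Q" if "y \<in> N" "z \<in> D" for y z
    using that Q.subset DN lcos_m_assoc by auto
  have "trace D N (trace Q D a) = (\<Sum>X\<in>cosets N D. \<Sum>Z\<in>cosets D Q. act (r X) (coset_act Z a))"
    by (simp add: trace_def coset_act_def act_sum r_def)
  also have "\<dots> = (\<Sum>X\<in>cosets N D. \<Sum>Z\<in>cosets D Q. coset_act (r X \<rhd> Z) a)"
  proof (intro sum.cong refl)
    fix X Z assume XZ: "X \<in> cosets N D" "Z \<in> cosets D Q"
    then obtain z where z: "z \<in> D" "Z = z \<rhd> Q" by (auto simp: cosets_def)
    have "r X \<in> carrier G" using r XZ by auto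
    then show "act (r X) (coset_act Z a) = coset_act (r X \<rhd> Z) a"
      using z r(1)[OF XZ(1)] by (simp add: move coset_act_eq[OF Q _ a] act_mult)
  qed
  also have "\<dots> = (\<Sum>(X, Z)\<in>cosets N D \<times> cosets D Q. coset_act (r X \<rhd> Z) a)"
    by (rule sum.cartesian_product)
  also have "\<dots> = (\<Sum>Y\<in>cosets N Q. coset_act Y a)"
  proof -
    have "bij_betw (\<lambda>(X, Z). r X \<rhd> Z) (cosets N D \<times> cosets D Q) (cosets N Q)"
    proof (rule bij_betw_imageI)
      show "inj_on (\<lambda>(X, Z). r X \<rhd> Z) (cosets N D \<times> cosets D Q)"
      proof (rule inj_onI, clarify)
        fix X Z X' Z'
        assume *: "X \<in> cosets N D" "Z \<in> cosets D Q" "X' \<in> cosets N D" "Z' \<in> cosets D Q" "r X \<rhd> Z = r X' \<rhd> Z'"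
        then obtain z z' where z: "z \<in> D" "Z = z \<rhd> Q" "z' \<in> D" "Z' = z' \<rhd> Q" by (auto simp: cosets_def)
        have G: "r X \<in> carrier G" "r X' \<in> carrier G" "z \<in> carrier G" "z' \<in> carrier G"
          using r * z by auto
        have "(r X \<otimes> z) \<rhd> Q = (r X' \<otimes> z') \<rhd> Q" using * z r by (simp add: move)
        then have "inv (r X \<otimes> z) \<otimes> (r X' \<otimes> z') \<in> Q" using G by (simp add: l_coset_eq_iff[OF Q])
        then have "inv (r X \<otimes> z) \<otimes> (r X' \<otimes> z') \<in> D" using QD by blast
        then have "z \<otimes> (inv (r X \<otimes> z) \<otimes> (r X' \<otimes> z')) \<otimes> inv z' \<in> D" using z by simp
        then have "inv (r X) \<otimes> r X' \<in> D" using G by (simp add: inv_mult_group m_assoc)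
        then have "r X \<rhd> D = r X' \<rhd> D" using G by (simp add: l_coset_eq_iff[OF D])
        then have X: "X = X'" using r * by simp
        have "inv (r X) \<rhd> (r X \<rhd> Z) = inv (r X) \<rhd> (r X \<rhd> Z')" using *(5) X by simp
        moreover have "inv (r X) \<rhd> (r X \<rhd> Z) = Z" if "Z \<subseteq> carrier G" for Z
          using that G by (simp add: lcos_m_assoc lcos_mult_one)
        moreover have "Z \<subseteq> carrier G" "Z' \<subseteq> carrier G"
          using z G l_coset_subset_G[OF Q.subset] by simp_all
        ultimately show "X = X' \<and> Z = Z'" using X by simp
      qed
      show "(\<lambda>(X, Z). r X \<rhd> Z) ` (cosets N D \<times> cosets D Q) = cosets N Q"
      proof (intro equalityI subsetI)
        fix Y assume "Y \<in> (\<lambda>(X, Z). r X \<rhd> Z) ` (cosets N D \<times> cosets D Q)"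
        then obtain X z where "X \<in> cosets N D" "z \<in> D" "Y = r X \<rhd> (z \<rhd> Q)" by (auto simp: cosets_def)
        then show "Y \<in> cosets N Q" using r DN by (auto simp: move cosets_def)
      next
        fix Y assume "Y \<in> cosets N Q"
        then obtain x where x: "x \<in> N" "Y = x \<rhd> Q" by (auto simp: cosets_def)
        define X where "X = x \<rhd> D"
        have X: "X \<in> cosets N D" using x by (auto simp: X_def cosets_def)
        have d: "inv (r X) \<otimes> x \<in> D"
          using r(2)[OF X] l_coset_eq_iff[OF D, of "r X" x] r(1)[OF X] x by (simp add: X_def)
        have "Y = r X \<rhd> ((inv (r X) \<otimes> x) \<rhd> Q)"
          using r(1)[OF X] x d by (simp add: move)
        then show "Y \<in> (\<lambda>(X, Z). r X \<rhd> Z) ` (cosets N D \<times> cosets D Q)"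
          using X d by (auto simp: cosets_def)
      qed
    qed
    from sum.reindex_bij_betw[OF this, of "\<lambda>Y. coset_act Y a"]
    show ?thesis by (simp add: case_prod_beta)
  qed
  finally show ?thesis by (simp add: trace_def)
qed

lemma coset_fixed_iff:
  assumes D: "subgroup D G" and S: "S \<subseteq> carrier G" and x: "x \<in> carrier G"
  shows "(\<forall>s\<in>S. s \<rhd> (x \<rhd> D) = x \<rhd> D) \<longleftrightarrow> S \<subseteq> cset x D"
proof -
  interpret D: subgroup D G by fact
  have "s \<rhd> (x \<rhd> D) = x \<rhd> D \<longleftrightarrow> s \<in> cset x D" if s: "s \<in> S" for s
  proof -
    have sG: "s \<in> carrier G" using s S by blast
    have "s \<rhd> (x \<rhd> D) = x \<rhd> D \<longleftrightarrow> inv x \<otimes> (s \<otimes> x) \<in> D"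
      using sG x D.subset l_coset_eq_iff[OF D x, of "s \<otimes> x"] by (auto simp: lcos_m_assoc)
    then show ?thesis using sG x by (simp add: mem_cset D.subset m_assoc)
  qed
  then show ?thesis by blast
qed

lemma act_basis:
  assumes x: "x \<in> carrier G" and r: "r \<in> carrier G"
  shows "act x (scale c (basis_elem r)) = scale c (basis_elem (conj_elem G x r))"
proof -
  have "inv x \<otimes> g \<otimes> x = r \<longleftrightarrow> g = conj_elem G x r" if "g \<in> carrier G" for g
    using that x r conj_elem_inv[of x]
    by (metis conj_elem_def inv_closed inv_inv conj_elem_closed)
  then show ?thesis
    using x r by (auto simp: act_def scale_def basis_elem_def fun_eq_iff conj_elem_closed)
qed

lemma stab_subgroup:
  assumes R: "subgroup R G" and r: "r \<in> carrier G"
  shows "subgroup {x \<in> R. conj_elem G x r = r} G"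
proof -
  interpret R: subgroup R G by fact
  show ?thesis
  proof
    fix x assume "x \<in> {x \<in> R. conj_elem G x r = r}"
    then show "inv x \<in> {x \<in> R. conj_elem G x r = r}" using r conj_elem_inv(1)[of x r] by auto
  qed (use r in \<open>auto simp: conj_elem_one conj_elem_mult\<close>)
qed

lemma scale_basis_fixed:
  assumes R: "subgroup R G" and r: "r \<in> carrier G"
  shows "scale c (basis_elem r) \<in> fixed {x \<in> R. conj_elem G x r = r}"
proof -
  have "scale c (basis_elem r) \<in> alg (carrier G)"
    using r by (auto simp: alg_def scale_def basis_elem_def)
  then show ?thesis using r subgroup.subset[OF R] by (auto simp: fixed_def act_basis subset_iff)
qed

text \<open>The set \<open>X\<close> contains one representative of each \<open>R\<close>-conjugacy orbit in the support of \<open>a\<close>; the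
  trace from its stabilizer produces the orbit sum.\<close>

lemma fixed_eq_sum_trace:
  assumes R: "subgroup R G" and a: "a \<in> fixed R"
  shows "\<exists>X. finite X \<and> (\<forall>r\<in>X. r \<in> carrier G \<and> a r \<noteq> 0) \<and>
    a = (\<Sum>r\<in>X. trace {x \<in> R. conj_elem G x r = r} R (scale (a r) (basis_elem r)))"
proof -
  interpret R: subgroup R G by fact
  define orb where "orb g = (\<lambda>x. conj_elem G x g) ` R" for g
  define rp where "rp g = (SOME h. h \<in> orb g)" for g
  define St where "St r = {x \<in> R. conj_elem G x r = r}" for r
  have self: "g \<in> orb g" if "g \<in> carrier G" for g
    using conj_elem_one[OF that] R.one_closed unfolding orb_def by (metis imageI)
  have rel: "orb h = orb g" if g: "g \<in> carrier G" and h: "h \<in> orb g" for g h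
  proof -
    obtain x where x: "x \<in> R" "h = conj_elem G x g" using h by (auto simp: orb_def)
    have move: "conj_elem G y h = conj_elem G (y \<otimes> x) g" "conj_elem G y g = conj_elem G (y \<otimes> inv x) h"
      if "y \<in> R" for y
      using that x \<open>g \<in> carrier G\<close> by (simp_all add: conj_elem_mult conj_elem_closed)
    show ?thesis unfolding orb_def
    proof (intro equalityI image_subsetI)
      fix y assume y: "y \<in> R"
      show "conj_elem G y h \<in> (\<lambda>x. conj_elem G x g) ` R"
        unfolding move(1)[OF y] by (rule imageI) (use x y in simp)
      show "conj_elem G y g \<in> (\<lambda>x. conj_elem G x h) ` R"
        unfolding move(2)[OF y] by (rule imageI) (use x y in simp)
    qed
  qed
  have rp: "rp g \<in> orb g" if "g \<in> carrier G" for g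
    unfolding rp_def using self[OF that] by (rule someI[of "\<lambda>h. h \<in> orb g"])
  have orbG: "h \<in> carrier G" if "g \<in> carrier G" "h \<in> orb g" for g h
    using that by (auto simp: orb_def conj_elem_closed)
  have const: "a h = a g" if g: "g \<in> carrier G" and h: "h \<in> orb g" for g h
  proof -
    obtain x where x: "x \<in> R" "h = conj_elem G x g" using h by (auto simp: orb_def)
    then show ?thesis using fixed_apply[OF a, of "inv x" g] g by (simp add: conj_elem_def)
  qed
  have St: "subgroup (St r) G" if "r \<in> carrier G" for r
    unfolding St_def by (rule stab_subgroup[OF R that])
  have point: "trace (St r) R (scale c (basis_elem r)) h = (if h \<in> orb r then c else 0)"
    if r: "r \<in> carrier G" for r c h
  proof -
    have fx: "scale c (basis_elem r) \<in> fixed (St r)"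
      unfolding St_def by (rule scale_basis_fixed[OF R r])
    have val: "coset_act (x \<rhd> St r) (scale c (basis_elem r)) h = (if h = conj_elem G x r then c else 0)"
      if "x \<in> R" for x
    proof -
      have "coset_act (x \<rhd> St r) (scale c (basis_elem r)) = scale c (basis_elem (conj_elem G x r))"
        using that r by (simp add: coset_act_eq[OF St[OF r] _ fx] act_basis)
      then show ?thesis by (simp add: scale_def basis_elem_def)
    qed
    have "trace (St r) R (scale c (basis_elem r)) h
        = (\<Sum>X\<in>cosets R (St r). coset_act X (scale c (basis_elem r)) h)"
      by (simp add: trace_def sum_fun_apply)
    also have "\<dots> = (if h \<in> orb r then c else 0)"
    proof (cases "h \<in> orb r")
      case True
      then obtain y where y: "y \<in> R" "h = conj_elem G y r" by (auto simp: orb_def)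
      have eqv: "conj_elem G y r = conj_elem G x r \<longleftrightarrow> x \<rhd> St r = y \<rhd> St r" if x: "x \<in> R" for x
      proof -
        have "conj_elem G y r = conj_elem G x r \<longleftrightarrow> conj_elem G (inv x \<otimes> y) r = r"
        proof
          assume "conj_elem G y r = conj_elem G x r"
          then have "conj_elem G (inv x) (conj_elem G y r) = r" using x r by simp
          then show "conj_elem G (inv x \<otimes> y) r = r" using x y r by (simp add: conj_elem_mult)
        next
          assume "conj_elem G (inv x \<otimes> y) r = r"
          then have "conj_elem G x (conj_elem G (inv x \<otimes> y) r) = conj_elem G x r" by simp
          then show "conj_elem G y r = conj_elem G x r"
            using x y r by (simp add: conj_elem_mult conj_elem_closed)
        qed
        also have "\<dots> \<longleftrightarrow> inv x \<otimes> y \<in> St r" using x y by (simp add: St_def)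
        also have "\<dots> \<longleftrightarrow> x \<rhd> St r = y \<rhd> St r"
          using x y by (simp add: l_coset_eq_iff[OF St[OF r]])
        finally show ?thesis .
      qed
      have "coset_act X (scale c (basis_elem r)) h = (if X = y \<rhd> St r then c else 0)"
        if X: "X \<in> cosets R (St r)" for X
      proof -
        obtain x where x: "x \<in> R" "X = x \<rhd> St r" using X by (auto simp: cosets_def)
        have "h = conj_elem G x r \<longleftrightarrow> X = y \<rhd> St r" using eqv[OF x(1)] x(2) y(2) by simp
        then show ?thesis using val[OF x(1)] x(2) by simp
      qed
      then have "(\<Sum>X\<in>cosets R (St r). coset_act X (scale c (basis_elem r)) h)
          = (\<Sum>X\<in>cosets R (St r). if X = y \<rhd> St r then c else 0)"
        by (rule sum.cong[OF refl])
      also have "\<dots> = c"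
        using y cosets_finite[OF R.subset] by (auto simp: cosets_def)
      finally show ?thesis using True by simp
    next
      case False
      then have "coset_act X (scale c (basis_elem r)) h = 0" if "X \<in> cosets R (St r)" for X
        using that by (auto simp: cosets_def val orb_def)
      then show ?thesis using False by simp
    qed
    finally show ?thesis .
  qed
  define X where "X = rp ` {g \<in> carrier G. a g \<noteq> 0}"
  have X: "r \<in> carrier G" "a r \<noteq> 0" if r: "r \<in> X" for r
  proof -
    obtain g where g: "g \<in> carrier G" "a g \<noteq> 0" "r = rp g" using r by (auto simp: X_def)
    then show "r \<in> carrier G" "a r \<noteq> 0" using orbG[OF g(1) rp] const[OF g(1) rp] by auto
  qed
  have finX: "finite X" using finG by (simp add: X_def)
  have val: "a h = (\<Sum>r\<in>X. if h \<in> orb r then a r else 0)" for h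
  proof (cases "h \<in> carrier G \<and> a h \<noteq> 0")
    case True
    have uniq: "r = rp h" if r: "r \<in> X" "h \<in> orb r" for r
    proof -
      obtain g where g: "g \<in> carrier G" "r = rp g" using r by (auto simp: X_def)
      have "orb r = orb g" using rel[OF g(1)] rp[OF g(1)] g(2) by simp
      then have "orb h = orb g" using rel[OF g(1)] r by simp
      then show ?thesis using g by (simp add: rp_def)
    qed
    have "rp h \<in> X" using True by (auto simp: X_def)
    have mem: "h \<in> orb (rp h)" using rel[of h "rp h"] rp self True by simp
    have "(if h \<in> orb r then a r else 0) = (if r = rp h then a (rp h) else 0)" if "r \<in> X" for r
      using uniq[OF that] mem by (cases "h \<in> orb r") auto
    then have "(\<Sum>r\<in>X. if h \<in> orb r then a r else 0) = (\<Sum>r\<in>X. if r = rp h then a (rp h) else 0)"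
      by (rule sum.cong[OF refl])
    also have "\<dots> = a (rp h)" using \<open>rp h \<in> X\<close> finX by simp
    finally show ?thesis using const[of h "rp h"] rp True by simp
  next
    case False
    then have "a h = 0" using a by (auto simp: fixed_def alg_def)
    moreover have "a r = 0" if "r \<in> X" "h \<in> orb r" for r
      using const[of r h] X(1) that \<open>a h = 0\<close> by auto
    ultimately show ?thesis by (simp add: sum.neutral)
  qed
  have "a = (\<Sum>r\<in>X. trace (St r) R (scale (a r) (basis_elem r)))"
  proof
    fix h
    have "(\<Sum>r\<in>X. trace (St r) R (scale (a r) (basis_elem r))) h = (\<Sum>r\<in>X. if h \<in> orb r then a r else 0)"
      unfolding sum_fun_apply using X(1) by (intro sum.cong refl) (simp only: point)
    then show "a h = (\<Sum>r\<in>X. trace (St r) R (scale (a r) (basis_elem r))) h" using val by simp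
  qed
  then show ?thesis using finX X unfolding St_def by blast
qed

section \<open>Normalizers in p-groups\<close>

definition nrm :: "'g set \<Rightarrow> 'g set \<Rightarrow> 'g set" where
  "nrm P Q = {x \<in> P. cset x Q = Q}"

lemma nrm_subgroup:
  assumes P: "subgroup P G" and Q: "Q \<subseteq> carrier G"
  shows "subgroup (nrm P Q) G"
proof -
  interpret P: subgroup P G by fact
  show ?thesis
  proof
    fix x assume "x \<in> nrm P Q"
    then show "inv x \<in> nrm P Q" using Q cset_inv(1)[of x Q] by (auto simp: nrm_def)
  qed (use Q in \<open>auto simp: nrm_def cset_one cset_mult\<close>)
qed

lemma sub_nrm: "subgroup Q G \<Longrightarrow> Q \<subseteq> P \<Longrightarrow> Q \<subseteq> nrm P Q"
  by (auto simp: nrm_def dest: cset_self)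

lemma nrm_sub: "nrm P Q \<subseteq> P"
  by (auto simp: nrm_def)

lemma cset_eqI:
  assumes "x \<in> carrier G" "Q \<subseteq> carrier G" "Q \<subseteq> cset x Q"
  shows "cset x Q = Q"
proof -
  have "finite (cset x Q)" using assms(2) finG finite_subset by blast
  then show ?thesis using card_subset_eq[OF _ assms(3)] card_cset[OF assms(1,2)] by simp
qed

lemma fixed_cosets_eq:
  assumes P: "P \<subseteq> carrier G" and Q: "subgroup Q G"
  shows "{X \<in> cosets P Q. \<forall>s\<in>Q. s \<rhd> X = X} = cosets (nrm P Q) Q"
proof -
  note QG = subgroup.subset[OF Q]
  have "(\<forall>s\<in>Q. s \<rhd> (x \<rhd> Q) = x \<rhd> Q) \<longleftrightarrow> cset x Q = Q" if "x \<in> P" for x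
  proof -
    have x: "x \<in> carrier G" using that P by blast
    show ?thesis
      unfolding coset_fixed_iff[OF Q QG x] using cset_eqI[OF x QG] by blast
  qed
  then show ?thesis unfolding cosets_def nrm_def by blast
qed

text \<open>The number of fixed points of \<open>Q\<close> on the cosets \<open>P/Q\<close> is divisible by \<open>p\<close>, and they are the
  cosets in \<open>N\<^sub>P(Q)/Q\<close>.\<close>

lemma nrm_grows:
  assumes P: "psub P" and Q: "subgroup Q G" "Q \<subseteq> P" "Q \<noteq> P"
  shows "nrm P Q \<noteq> Q"
proof
  assume nrm: "nrm P Q = Q"
  note PD = psubD[OF P]
  have Qp: "psub Q" using psub_subset[OF P Q(1,2)] .
  interpret Q: subgroup Q G by fact
  interpret P: subgroup P G by (rule PD)
  obtain n where n: "card Q = CHAR('k) ^ n" using Qp by (auto simp: p_subgroup_def char_eq)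
  obtain m where m: "card P = CHAR('k) ^ m" using P by (auto simp: p_subgroup_def char_eq)
  let ?Q = "G\<lparr>carrier := Q\<rparr>"
  have sub: "X \<subseteq> carrier G" if X: "X \<in> cosets P Q" for X
  proof -
    obtain x where "x \<in> P" "X = x \<rhd> Q" using X unfolding cosets_def by (rule imageE)
    then show ?thesis using l_coset_subset_G[OF Q.subset] P.subset by simp
  qed
  have "(\<Sum>X\<in>cosets P Q. 1 :: 'k) = (\<Sum>X \<in> {X \<in> cosets P Q. \<forall>s \<in> carrier ?Q. s \<rhd> X = X}. 1)"
  proof (rule sum_invariant_eq_sum_fixed[where n = n])
    show "group ?Q" by (rule subgroup_imp_group[OF Q(1)])
    fix s X assume sX: "s \<in> carrier ?Q" "X \<in> cosets P Q"
    then show "s \<rhd> X \<in> cosets P Q" using cosets_translate(1)[OF PD(1) Q.subset, of s] Q(2) by auto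
  qed (use n char_pos cosets_finite[OF P.subset] sub in \<open>auto simp: lcos_mult_one lcos_m_assoc\<close>)
  also have "{X \<in> cosets P Q. \<forall>s \<in> carrier ?Q. s \<rhd> X = X} = cosets Q Q"
    using fixed_cosets_eq[OF P.subset Q(1)] nrm by simp
  also have "(\<Sum>X\<in>cosets Q Q. 1 :: 'k) = 1"
  proof -
    have "card (cosets Q Q) * card Q = card Q" using card_cosets[OF Q(1) Q(1)] by simp
    moreover have "card Q \<noteq> 0" using n char_pos by simp
    ultimately show ?thesis by simp
  qed
  finally have one: "of_nat (card (cosets P Q)) = (1 :: 'k)" by simp
  have mult: "card (cosets P Q) * card Q = card P" by (rule card_cosets[OF PD(1) Q(1,2)])
  then have "card (cosets P Q) dvd CHAR('k) ^ m" by (metis dvd_triv_left m)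
  then obtain l where l: "card (cosets P Q) = CHAR('k) ^ l"
    using divides_primepow_nat[OF prime_CHAR_field[OF char_pos]] by blast
  have "l \<noteq> 0"
  proof
    assume "l = 0"
    then have "card Q = card P" using mult l by simp
    then show False
      using card_subset_eq[OF finite_subset[OF P.subset finG] Q(2)] Q(3) by simp
  qed
  then have "of_nat (card (cosets P Q)) = (0 :: 'k)" unfolding of_nat_eq_0_iff_char_dvd l by simp
  then show False using one by simp
qed

section \<open>Inclusion of Brauer pairs\<close>

text \<open>Blocks of \<open>kC\<^sub>G(Q)\<close> in nontrivial \<open>R\<close>-orbits are killed by \<open>Br\<^sub>R\<close>, so the stable ones
  give a decomposition of \<open>1\<close> in \<open>kC\<^sub>G(R)\<close>.\<close>

lemma stable_block_exists:
  assumes R: "brauer_pair G R g" and Q: "Q \<subseteq> R" and nrm: "\<And>x. x \<in> R \<Longrightarrow> cset x Q = Q"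
  shows "\<exists>b. blk Q b \<and> b \<in> fixed R \<and> Br R b \<star> g = g"
proof -
  note D = brauer_pairD[OF R]
  interpret R: subgroup R G by (rule D)
  have QG: "Q \<subseteq> carrier G" using Q D(4) by blast
  let ?B = "{b. blk Q b}" and ?R = "G\<lparr>carrier := R\<rparr>"
  let ?F = "{b \<in> ?B. \<forall>s \<in> carrier ?R. act s b = b}"
  obtain n where n: "card R = CHAR('k) ^ n" using D(1) by (auto simp: p_subgroup_def char_eq)
  have bG: "b \<in> alg (carrier G)" if "blk Q b" for b
    using primD(1)[OF that] centerD(1) alg_cen_carrier by blast
  have val: "unit x = (\<Sum>b\<in>?F. b x)" if x: "x \<in> cen R" for x
  proof -
    have xG: "x \<in> carrier G" using x cen_subset by blast
    have "unit x = (\<Sum>b\<in>?B. b x)" using blk_sum(2)[OF QG] by (metis sum_fun_apply)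
    also have "\<dots> = (\<Sum>b\<in>?F. b x)"
    proof (rule sum_invariant_eq_sum_fixed[where n = n])
      show "group ?R" by (rule subgroup_imp_group[OF D(3)])
      fix s b assume sb: "s \<in> carrier ?R" "b \<in> ?B"
      then have s: "s \<in> R" "s \<in> carrier G" by auto
      show "act s b \<in> ?B" using blk_act[OF s(2) QG, of b] sb nrm[OF s(1)] by simp
      have "inv s \<otimes> x \<otimes> s = x" using x xG s(1) cen_conj[OF D(4) xG] by blast
      then show "act s b x = b x" using xG by (simp add: act_def)
    qed (use n char_pos blk_sum(1)[OF QG] bG in \<open>auto simp: act_one act_mult\<close>)
    finally show ?thesis .
  qed
  have "unit = (\<Sum>b\<in>?F. Br R b)"
  proof
    fix x
    have "unit x = (\<Sum>b\<in>?F. Br R b x)"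
    proof (cases "x \<in> cen R")
      case True
      then show ?thesis unfolding brauer_hom_def by (simp only: if_True val)
    next
      case False
      then show ?thesis using unit_alg[OF D(5)] by (simp add: brauer_hom_def alg_def)
    qed
    then show "unit x = (\<Sum>b\<in>?F. Br R b) x" by (simp only: sum_fun_apply)
  qed
  then have "g = (\<Sum>b\<in>?F. Br R b) \<star> g" using unit_conv(1)[OF D(8)] by simp
  then have "(\<Sum>b\<in>?F. Br R b \<star> g) \<noteq> 0" using D(11) by (simp only: conv_sum_left) metis
  then obtain b where b: "b \<in> ?F" "Br R b \<star> g \<noteq> 0"
    by (rule sum.not_neutral_contains_not_neutral)
  have bF: "b \<in> fixed R" using b(1) bG by (simp add: fixed_def)
  have blk: "blk Q b" using b(1) by simp
  have "Br R b \<in> center (cen R)" by (rule Br_center[OF D(1) Q primD(1)[OF blk] bF])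
  moreover have "Br R b \<star> Br R b = Br R b"
    using Br_conv[OF D(1) bF bF] primD(2)[OF blk] by simp
  ultimately have "Br R b \<star> g = g" using blk_cases[OF D(4) D(2)] b(2) by blast
  then show ?thesis using bF blk by blast
qed

lemma brauer_le_refl: "brauer_pair G P (e :: 'g \<Rightarrow> 'k) \<Longrightarrow> brauer_le G P e P e"
  by (rule brauer_leI) auto

lemma sub_pair_unique:
  fixes e f f' :: "'g \<Rightarrow> 'k"
  assumes "brauer_le G Q f P e" "brauer_le G Q f' P e"
  shows "f = f'"
proof -
  note D = brauer_leD[OF assms(1)] and D' = brauer_leD[OF assms(2)]
  obtain i where "prim (fixed P) i" "associated_idempotent G i P e"
    using brauer_pair_has_prim'[OF D(2)] by blast
  then show ?thesis using associated_unique'[OF D(1) D(4) D'(1) D'(4)] by blast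
qed

text \<open>The block at \<open>Q\<close> is the stable block below the one at \<open>N\<^sub>P(Q)\<close>. For \<open>i\<close> associated to
  \<open>(P, e)\<close>, the part of \<open>Br\<^sub>Q(i)\<close> outside of it vanishes on \<open>C\<^sub>G(S)\<close> for all larger \<open>S\<close>, hence is
  a trace from \<open>Q\<close>, and therefore the image of a trace from \<open>Q\<close> to \<open>P\<close>. It is thus the
  image of an element of the local ring at \<open>i\<close>, and that element is nilpotent because \<open>Br\<^sub>P\<close> kills
  such traces.\<close>

lemma sub_pair_exists:
  fixes e :: "'g \<Rightarrow> 'k"
  assumes P: "brauer_pair G P e" and Q: "subgroup Q G" "Q \<subseteq> P"
  shows "\<exists>f. brauer_le G Q f P e"
  using Q
proof (induction "card P - card Q" arbitrary: Q rule: less_induct)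
  case (less Q)
  note PD = brauer_pairD[OF P]
  interpret Q: subgroup Q G by (rule less.prems)
  interpret P: subgroup P G by (rule PD)
  have finP: "finite P" using finite_subset[OF PD(4) finG] .
  show ?case
  proof (cases "Q = P")
    case True
    then show ?thesis using brauer_le_refl[OF P] by blast
  next
    case False
    define R where "R = nrm P Q"
    have R: "subgroup R G" "R \<subseteq> P" "Q \<subseteq> R" "Q \<noteq> R"
      unfolding R_def using nrm_subgroup[OF PD(3) Q.subset] nrm_sub sub_nrm[OF less.prems]
        nrm_grows[OF PD(1) less.prems False] by auto
    have nrm: "cset x Q = Q" if "x \<in> R" for x using that by (simp add: R_def nrm_def)
    have IH: "\<exists>f. brauer_le G S f P e" if S: "subgroup S G" "S \<subseteq> P" "Q \<subseteq> S" "Q \<noteq> S" for S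
    proof (rule less.hyps)
      have "card Q < card S" using S finite_subset[OF S(2) finP] by (intro psubset_card_mono) auto
      moreover have "card S \<le> card P" using S finP by (intro card_mono)
      ultimately show "card P - card S < card P - card Q" by linarith
    qed (use S in auto)
    obtain g where g: "brauer_le G R g P e" using IH[OF R] by blast
    note gD = brauer_pairD[OF brauer_leD(1)[OF g]]
    have RG: "R \<subseteq> carrier G" by (rule gD)
    obtain b where b: "blk Q b" "b \<in> fixed R" "Br R b \<star> g = g"
      using stable_block_exists[OF brauer_leD(1)[OF g] R(3) nrm] by blast
    have Qp: "psub Q" by (rule psub_subset[OF PD(1) less.prems])
    have Qb: "brauer_pair G Q b" using b Qp by (simp add: brauer_pair_iff)
    note bD = brauer_pairD[OF Qb]
    have "brauer_le G Q b P e"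
    proof (rule brauer_leI[OF Qb P less.prems(2)])
      fix i assume i: "prim (fixed P) i" and ie: "associated_idempotent G i P e"
      note iD = associatedD[OF P ie]
      have iR: "i \<in> fixed R" and iQ: "i \<in> fixed Q" and bQ: "b \<in> fixed Q"
        using iD(1) b(2) fixed_antimono[OF R(2)] fixed_antimono[OF R(3)] by blast+
      note cl = subalgD[OF fixed_subalg[OF PD(4)]]
      note clR = subalgD[OF fixed_subalg[OF RG]]
      note clQ = subalgD[OF fixed_subalg[OF Q.subset]]
      have QPi: "Br P (Br Q i) = Br P i" by (rule Br_Br[OF less.prems(2)])
      then have ne: "Br Q i \<noteq> 0" using iD(5) by auto
      have idemQ: "Br Q i \<star> Br Q i = Br Q i" using Br_conv[OF Qp iQ iQ] iD(2) by simp
      have bi: "Br Q (b \<star> i) = b \<star> Br Q i" using Br_conv[OF Qp bQ iQ] by (simp add: Br_id[OF bD(7)])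
      \<comment> \<open>By induction \<open>Br\<^sub>S(i)\<close> lies in a single block \<open>f\<close>. If \<open>Br\<^sub>S(b)\<close> annihilated \<open>f\<close>, then
        \<open>Br\<^sub>R(b)\<close> would annihilate \<open>Br\<^sub>R(i)\<close>, but it fixes \<open>g\<close>.\<close>
      have above: "Br S (i - b \<star> i) = 0"
        if S: "subgroup S G" "S \<subseteq> R" "Q \<subseteq> S" "Q \<noteq> S" for S
      proof -
        obtain f where f: "brauer_le G S f P e" using IH[of S] S R(2) by blast
        note fD = brauer_pairD[OF brauer_leD(1)[OF f]]
        have bS: "b \<in> fixed S" and iS: "i \<in> fixed S"
          using b(2) iR fixed_antimono[OF S(2)] by blast+
        have fi: "f \<star> Br S i = Br S i"
          using associatedD(3)[OF brauer_leD(1)[OF f] brauer_leD(4)[OF f i ie]] .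
        have gi: "g \<star> Br R i = Br R i"
          using associatedD(3)[OF brauer_leD(1)[OF g] brauer_leD(4)[OF g i ie]] .
        have "Br R i \<noteq> 0" using associatedD(5)[OF brauer_leD(1)[OF g] brauer_leD(4)[OF g i ie]] .
        have bc: "Br S b \<in> center (cen S)" by (rule Br_center[OF fD(1) S(3) bD(6) bS])
        have bi': "Br S (b \<star> i) = Br S b \<star> (f \<star> Br S i)" using Br_conv[OF fD(1) bS iS] fi by simp
        have "Br S b \<star> f = f \<or> Br S b \<star> f = 0"
          using blk_cases[OF fD(4,2) bc] Br_conv[OF fD(1) bS bS] bD(10) by simp
        moreover have "Br S b \<star> f \<noteq> 0"
        proof
          assume "Br S b \<star> f = 0"
          then have "Br S (b \<star> i) = 0" unfolding bi' conv_assoc[symmetric] by simp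
          then have "Br R (b \<star> i) = 0" using Br_Br[OF S(2), of "b \<star> i"] by simp
          moreover have "Br R b \<star> Br R i = Br R i" using b(3) gi by (metis conv_assoc)
          ultimately have "Br R i = 0" using Br_conv[OF gD(1) b(2) iR] by simp
          then show False using \<open>Br R i \<noteq> 0\<close> by simp
        qed
        ultimately have "Br S (b \<star> i) = Br S i" using bi' fi by (metis conv_assoc)
        then show ?thesis by (simp add: Br_diff)
      qed
      define j where "j = Br Q (i - b \<star> i)"
      have j_eq: "j = Br Q i - b \<star> Br Q i" by (simp add: j_def Br_diff bi)
      have bcomm: "b \<star> Br Q i = Br Q i \<star> b" by (rule centerD(2)[OF bD(6) Br_alg])
      have bb: "b \<star> (b \<star> Br Q i) = b \<star> Br Q i" by (simp only: conv_assoc[symmetric] bD(10))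
      have bj: "b \<star> j = 0" by (simp add: j_eq conv_distribs bb)
      have ij: "Br Q i \<star> j = j"
      proof -
        have "Br Q i \<star> (b \<star> Br Q i) = b \<star> Br Q i"
          unfolding bcomm by (simp only: conv_assoc[symmetric] idemQ)
        then show ?thesis by (simp add: j_eq conv_distribs idemQ)
      qed
      have ji: "j \<star> Br Q i = j" by (simp add: j_eq conv_distribs conv_assoc idemQ)
      have jj: "j \<star> j = j"
        by (subst (1) j_eq) (simp add: conv_distribs conv_assoc ij bj)
      have jR: "j \<in> fixed R"
        unfolding j_def by (rule Br_fixed[OF RG Q.subset nrm]) (use b iR clR in auto)
      obtain X where X: "finite X" "\<forall>r\<in>X. r \<in> carrier G \<and> j r \<noteq> 0"
        "j = (\<Sum>r\<in>X. trace {x \<in> R. conj_elem G x r = r} R (scale (j r) (basis_elem r)))"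
        using fixed_eq_sum_trace[OF R(1) jR] by blast
      have rC: "r \<in> cen Q" if "r \<in> X" for r
        using X(2) that by (auto simp: j_def brauer_hom_def split: if_splits)
      \<comment> \<open>As \<open>j\<close> vanishes on the centralizers of all larger groups, its support consists of elements
        whose stabilizer is \<open>Q\<close>.\<close>
      have stab: "{x \<in> R. conj_elem G x r = r} = Q" if r: "r \<in> X" for r
      proof (rule ccontr)
        let ?S = "{x \<in> R. conj_elem G x r = r}"
        have rG: "r \<in> carrier G" and jr: "j r \<noteq> 0" using X(2) r by auto
        have comm: "conj_elem G x r = r \<longleftrightarrow> r \<otimes> x = x \<otimes> r" if "x \<in> carrier G" for x
          using that rG by (rule conj_elem_eq_iff)
        assume "?S \<noteq> Q"
        moreover have "Q \<subseteq> ?S"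
          using rC[OF r] R(3) Q.subset comm by (auto simp: centralizer_def)
        moreover have "subgroup ?S G" by (rule stab_subgroup[OF R(1) rG])
        ultimately have "Br ?S (i - b \<star> i) = 0" using above[of ?S] by blast
        moreover have "Br ?S j = Br ?S (i - b \<star> i)" unfolding j_def by (rule Br_Br) fact
        moreover have "r \<in> cen ?S" using rG RG comm by (auto simp: centralizer_def)
        ultimately have "j r = 0" by (metis brauer_hom_def zero_fun_apply)
        then show False using jr by simp
      qed
      define b' where "b' = (\<Sum>r\<in>X. scale (j r) (basis_elem r))"
      have b'C: "b' \<in> alg (cen Q)"
        unfolding b'_def using rC by (intro alg_sum) (auto simp: alg_def scale_def basis_elem_def)
      have b'Q: "b' \<in> fixed Q" by (rule alg_cen_fixed[OF Q.subset b'C])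
      have jtr: "j = trace Q R b'"
        unfolding b'_def trace_sum[OF R(1) less.prems(1) R(3)] by (subst X(3)) (simp add: stab)
      define t where "t = trace Q P b'"
      have tP: "t \<in> fixed P" unfolding t_def by (rule trace_fixed[OF PD(3) less.prems b'Q])
      have Brt: "Br Q t = j"
      proof -
        have "Br Q (coset_act X b') = coset_act X b'" if X: "X \<in> cosets R Q" for X
        proof -
          obtain x where x: "x \<in> R" "X = x \<rhd> Q" using X by (auto simp: cosets_def)
          have xG: "x \<in> carrier G" using x RG by blast
          have "act x b' \<in> alg (cset x (cen Q))" by (rule act_alg[OF xG cen_subset b'C])
          then have "act x b' \<in> alg (cen Q)"
            using cen_cset[OF xG Q.subset] nrm[OF x(1)] by simp
          then show ?thesis using x xG by (simp add: coset_act_eq[OF less.prems(1) xG b'Q] Br_id)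
        qed
        then show ?thesis
          unfolding t_def Br_trace[OF PD(3) less.prems Qp less.prems(2) b'Q]
            fixed_cosets_eq[OF PD(4) less.prems(1)] R_def[symmetric] jtr
          by (simp add: trace_def)
      qed
      have BrPt: "Br P t = 0"
      proof -
        have "{X \<in> cosets P Q. \<forall>s\<in>P. s \<rhd> X = X} = {}"
        proof -
          have "\<not> (\<forall>s\<in>P. s \<rhd> (x \<rhd> Q) = x \<rhd> Q)" if x: "x \<in> P" for x
          proof
            have xG: "x \<in> carrier G" using x PD(4) by blast
            assume "\<forall>s\<in>P. s \<rhd> (x \<rhd> Q) = x \<rhd> Q"
            then have "P \<subseteq> cset x Q" using coset_fixed_iff[OF less.prems(1) PD(4) xG] by blast
            then have "card P \<le> card (cset x Q)"
              using finite_subset[OF cset_subset[OF xG Q.subset] finG] by (intro card_mono)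
            then have "card P \<le> card Q" using card_cset[OF xG Q.subset] by simp
            then show False using False card_seteq[OF finP less.prems(2)] by blast
          qed
          then show ?thesis by (auto simp: cosets_def)
        qed
        then show ?thesis
          unfolding t_def Br_trace[OF PD(3) less.prems PD(1) order_refl b'Q] by (simp only: sum.empty)
      qed
      have homQ: "Br Q (a \<star> c) = Br Q a \<star> Br Q c" if "a \<in> fixed P" "c \<in> fixed P" for a c
        using Br_conv[OF Qp] that fixed_antimono[OF less.prems(2)] by blast
      have img: "Br Q (i \<star> t \<star> i) = j"
        using iD(1) tP cl(6) by (simp add: homQ Brt ij ji)
      have "j = 0 \<or> (\<exists>u\<in>fixed P. i = i \<star> t \<star> i \<star> u)"
        using prim_corner_image[OF fixed_subalg[OF PD(4)] i tP, of "Br Q"]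
        by (simp add: homQ img jj)
      moreover have "\<not> (\<exists>u\<in>fixed P. i = i \<star> t \<star> i \<star> u)"
      proof
        assume "\<exists>u\<in>fixed P. i = i \<star> t \<star> i \<star> u"
        then obtain u where u: "u \<in> fixed P" "i = i \<star> t \<star> i \<star> u" by blast
        have "Br P (i \<star> t \<star> i \<star> u) = Br P i \<star> Br P t \<star> Br P i \<star> Br P u"
          using iD(1) tP u(1) cl(6) by (simp add: Br_conv[OF PD(1)])
        then show False using iD(5) BrPt u(2) by simp
      qed
      ultimately have "b \<star> Br Q i = Br Q i" using j_eq by simp
      then show "associated_idempotent G i Q b"
        using iQ iD(2) ne by (simp add: associated_iff[OF bD(4,7)])
    qed
    then show ?thesis by blast
  qed
qed

text \<open>An idempotent \<open>j\<close> that realizes the inclusion of \<open>(Q, f)\<close> in \<open>(R, h)\<close> can be chosen with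
  \<open>Br\<^sub>R(i) Br\<^sub>R(j) \<noteq> 0\<close> for a given \<open>i\<close> associated to \<open>(P, e)\<close>. Then \<open>Br\<^sub>Q(i) Br\<^sub>Q(j) \<noteq> 0\<close>, so \<open>i\<close>
  and \<open>j\<close> select the same block at \<open>Q\<close>.\<close>

lemma brauer_le_trans:
  fixes e f h :: "'g \<Rightarrow> 'k"
  assumes QR: "brauer_le G Q f R h" and RP: "brauer_le G R h P e"
  shows "brauer_le G Q f P e"
proof -
  note QRD = brauer_leD[OF QR] and RPD = brauer_leD[OF RP]
  note QD = brauer_pairD[OF QRD(1)] and RD = brauer_pairD[OF RPD(1)]
  obtain f' where f': "brauer_le G Q f' P e"
    using sub_pair_exists[OF RPD(2) QD(3)] QRD(3) RPD(3) by blast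
  obtain i where i: "prim (fixed P) i" "associated_idempotent G i P e"
    using brauer_pair_has_prim'[OF RPD(2)] by blast
  note iR = associatedD[OF RPD(1) RPD(4)[OF i]]
  have "h \<star> Br R i \<noteq> 0" using iR by simp
  then obtain j where j: "prim (fixed R) j" "associated_idempotent G j R h" "Br R i \<star> Br R j \<noteq> 0"
    using brauer_pair_has_prim[OF RPD(1) Br_alg, of i] by blast
  note jR = associatedD[OF RPD(1) j(2)]
  have sub: "fixed R \<subseteq> fixed Q" by (rule fixed_antimono[OF QRD(3)])
  have "Br R (Br Q (i \<star> j)) = Br R i \<star> Br R j"
    using Br_Br[OF QRD(3)] Br_conv[OF RD(1) iR(1) jR(1)] by simp
  then have "Br Q (i \<star> j) \<noteq> 0" using j(3) by auto
  then have "Br Q i \<star> Br Q j \<noteq> 0"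
    using Br_conv[OF QD(1) subsetD[OF sub iR(1)] subsetD[OF sub jR(1)]] by simp
  then have "f' = f"
    using associated_unique[OF brauer_leD(1)[OF f'] brauer_leD(4)[OF f' i] QRD(1) QRD(4)[OF j(1,2)]]
    by simp
  then show ?thesis using f' by simp
qed

lemma brauer_le_between:
  fixes e f h :: "'g \<Rightarrow> 'k"
  assumes Q: "brauer_le G Q f P e" and R: "brauer_le G R h P e" and QR: "Q \<subseteq> R"
  shows "brauer_le G Q f R h"
proof -
  obtain f' where f': "brauer_le G Q f' R h"
    using sub_pair_exists[OF brauer_leD(1)[OF R] brauer_pairD(3)[OF brauer_leD(1)[OF Q]] QR] by blast
  then show ?thesis using sub_pair_unique[OF Q brauer_le_trans[OF f' R]] by simp
qed

lemma brauer_le_antisym: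
  fixes e f :: "'g \<Rightarrow> 'k"
  assumes "brauer_le G P f P e"
  shows "f = e"
  using sub_pair_unique[OF assms brauer_le_refl[OF brauer_leD(2)[OF assms]]] .

lemma brauer_le_card:
  fixes h k' :: "'g \<Rightarrow> 'k"
  assumes le: "brauer_le G S h D k'" and card: "card D \<le> card S"
  shows "S = D \<and> h = k'"
proof -
  have "finite D" using brauer_pairD(4)[OF brauer_leD(2)[OF le]] finG finite_subset by blast
  then have "S = D" using card_seteq brauer_leD(3)[OF le] card by blast
  then show ?thesis using brauer_le_antisym le by blast
qed

lemma act_stable:
  assumes "brauer_pair G S h" "s \<in> S"
  shows "act s h = h"
  using brauer_pairD(9)[OF assms(1)] assms(2) by (simp add: fixed_def)

text \<open>Stability of \<open>e\<close> under \<open>S\<close> comes from the uniqueness of the block at \<open>T\<close>. The central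
  idempotent \<open>Br\<^sub>S(e)\<close> cannot annihilate \<open>h\<close>, as it fixes \<open>Br\<^sub>S(i)\<close> for each \<open>i\<close> associated to
  \<open>(S, h)\<close>.\<close>

lemma normal_sub_pair:
  fixes e h :: "'g \<Rightarrow> 'k"
  assumes le: "brauer_le G T e S h" and nrm: "\<And>s. s \<in> S \<Longrightarrow> cset s T = T"
  shows "e \<in> fixed S" and "Br S e \<star> h = h"
proof -
  note leD = brauer_leD[OF le]
  note TD = brauer_pairD[OF leD(1)] and SD = brauer_pairD[OF leD(2)]
  have "act s e = e" if s: "s \<in> S" for s
  proof -
    have sG: "s \<in> carrier G" using s SD(4) by blast
    have "brauer_le G T (act s e) S h"
      using brauer_le_conj[OF sG le] nrm[OF s] cset_self[OF SD(3) s] act_stable[OF leD(2) s] by simp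
    then show ?thesis using sub_pair_unique[OF _ le] by blast
  qed
  then show eS: "e \<in> fixed S" using TD(8) by (simp add: fixed_def)
  obtain i where i: "prim (fixed S) i" "associated_idempotent G i S h"
    using brauer_pair_has_prim'[OF leD(2)] by blast
  note iS = associatedD[OF leD(2) i(2)] and iT = associatedD[OF leD(1) leD(4)[OF i]]
  have "Br T (e \<star> i) = Br T i"
    using Br_conv[OF TD(1) TD(9) iT(1)] iT(3) by (simp add: Br_id[OF TD(7)])
  then have "Br S (e \<star> i) = Br S i" using Br_Br[OF leD(3)] by metis
  then have ei: "Br S e \<star> (h \<star> Br S i) = Br S i" using Br_conv[OF SD(1) eS iS(1)] iS(3) by simp
  have "Br S e \<star> h = h \<or> Br S e \<star> h = 0"
    using blk_cases[OF SD(4,2) Br_center[OF SD(1) leD(3) TD(6) eS]] Br_conv[OF SD(1) eS eS] TD(10)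
    by simp
  moreover have "Br S e \<star> h \<noteq> 0"
  proof
    assume "Br S e \<star> h = 0"
    then have "Br S e \<star> (h \<star> Br S i) = 0" by (simp flip: conv_assoc)
    then show False using ei iS(5) by simp
  qed
  ultimately show "Br S e \<star> h = h" by blast
qed

lemma sub_block_le:
  fixes e :: "'g \<Rightarrow> 'k"
  assumes "brauer_pair G P e" "subgroup Q G" "Q \<subseteq> P"
  shows "brauer_le G Q (sub_block G P e Q) P e"
proof -
  obtain f where f: "brauer_le G Q f P e" using sub_pair_exists[OF assms] by blast
  then have "block_idempotent (G\<lparr>carrier := cen Q\<rparr>) f"
    using brauer_leD(1)[OF f] by (simp add: brauer_pair_def)
  then have "sub_block G P e Q = f"
    unfolding sub_block_def using f sub_pair_unique by blast
  then show ?thesis using f by simp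
qed

lemma sub_block_eq:
  fixes e f :: "'g \<Rightarrow> 'k"
  assumes "brauer_le G Q f P e"
  shows "sub_block G P e Q = f"
  using sub_pair_unique[OF sub_block_le assms] brauer_leD(2,3)[OF assms]
    brauer_pairD(3)[OF brauer_leD(1)[OF assms]] by blast

section \<open>Maximal pairs above a given pair\<close>

text \<open>The local ring property: if both summands of the unit \<open>i\<close> of the corner were nilpotent, the
  second one would fix the last nonzero power of the first.\<close>

lemma prim_sum:
  assumes B: "subalg B" and i: "prim B i" and st: "s \<in> B" "t \<in> B" and sum: "i = i \<star> s \<star> i + i \<star> t \<star> i"
  shows "(\<exists>u\<in>B. i = i \<star> s \<star> i \<star> u) \<or> (\<exists>u\<in>B. i = i \<star> t \<star> i \<star> u)"
proof (rule ccontr)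
  note cl = subalgD[OF B] and iD = primD[OF i]
  assume *: "\<not> ?thesis"
  define x y where "x = i \<star> s \<star> i" and "y = i \<star> t \<star> i"
  have xy: "i = x + y" using sum by (simp add: x_def y_def)
  obtain n where n: "pow x n = 0" using prim_corner[OF B i st(1)] * by (auto simp: x_def)
  obtain m where m: "pow y m = 0" using prim_corner[OF B i st(2)] * by (auto simp: y_def)
  have i0: "i \<star> pow x 0 \<noteq> 0" using iD(3) cl(1)[OF iD(1)] by (simp add: unit_conv)
  define l where "l = (LEAST n. i \<star> pow x n = 0)"
  have l: "i \<star> pow x l = 0" unfolding l_def by (rule LeastI[of _ n]) (simp only: n conv_zero)
  have "l \<noteq> 0" using l i0 by metis
  then obtain r where r: "l = Suc r" using not0_implies_Suc by blast
  have ne: "i \<star> pow x r \<noteq> 0" using not_less_Least[of r "\<lambda>n. i \<star> pow x n = 0"] r by (auto simp: l_def)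
  have ix: "i \<star> x = x" "i \<star> y = y"
    unfolding x_def y_def using conv_assoc[of i i] iD(2) by (metis conv_assoc)+
  have "x \<star> (i \<star> pow x r) = 0"
  proof -
    have "x \<star> i = x" unfolding x_def by (simp only: conv_assoc iD(2))
    then have "x \<star> (i \<star> pow x r) = pow x l" unfolding r by (simp flip: conv_assoc)
    also have "pow x l = i \<star> pow x l" unfolding r pow.simps by (simp add: ix flip: conv_assoc)
    finally show ?thesis using l by simp
  qed
  moreover have "i \<star> (i \<star> pow x r) = i \<star> pow x r" by (simp add: iD(2) flip: conv_assoc)
  ultimately have y: "y \<star> (i \<star> pow x r) = i \<star> pow x r"
    using arg_cong[OF xy, of "\<lambda>z. z \<star> (i \<star> pow x r)"] by (simp add: conv_add_left)
  have "pow y q \<star> (i \<star> pow x r) = i \<star> pow x r" for q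
    by (induction q) (simp_all add: unit_conv conv_carrier conv_assoc y)
  from this[of m] show False using m ne by simp
qed

lemma prim_sum_many:
  assumes B: "subalg B" and i: "prim B i"
  shows "finite I \<Longrightarrow> (\<And>l. l \<in> I \<Longrightarrow> F l \<in> B) \<Longrightarrow> u \<in> B \<Longrightarrow> i = i \<star> (\<Sum>l\<in>I. F l) \<star> i \<star> u
    \<Longrightarrow> \<exists>l\<in>I. \<exists>u\<in>B. i = i \<star> F l \<star> i \<star> u"
proof (induction I arbitrary: u rule: finite_induct)
  case empty
  then have "i = 0" by (simp only: sum.empty conv_zero)
  then show ?case using primD(3)[OF i] by simp
next
  case (insert m I)
  note cl = subalgD[OF B] and iD = primD[OF i]
  let ?t = "\<Sum>l\<in>I. F l"
  have FB: "F m \<in> B" "?t \<in> B" using insert.prems by (auto intro: subalg_sum[OF B])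
  have eq: "i = i \<star> (F m + ?t) \<star> i \<star> u"
    using insert.prems(3) unfolding sum.insert[OF insert.hyps] .
  have "i = i \<star> i" by (simp add: iD(2))
  also have "\<dots> = (i \<star> (F m + ?t) \<star> i \<star> u) \<star> i"
    by (rule arg_cong[OF eq, of "\<lambda>z. z \<star> i"])
  also have "\<dots> = i \<star> (F m \<star> i \<star> u) \<star> i + i \<star> (?t \<star> i \<star> u) \<star> i"
    by (simp only: conv_add_left conv_add_right conv_assoc)
  finally have "i = i \<star> (F m \<star> i \<star> u) \<star> i + i \<star> (?t \<star> i \<star> u) \<star> i" .
  moreover have "F m \<star> i \<star> u \<in> B" "?t \<star> i \<star> u \<in> B"
    by (intro cl(6) FB iD(1) insert.prems(2))+
  ultimately consider v where "v \<in> B" "i = i \<star> (F m \<star> i \<star> u) \<star> i \<star> v"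
    | v where "v \<in> B" "i = i \<star> (?t \<star> i \<star> u) \<star> i \<star> v"
    using prim_sum[OF B i] by blast
  then show ?case
  proof cases
    case 1
    then have "i = i \<star> F m \<star> i \<star> (u \<star> i \<star> v)" by (simp only: conv_assoc)
    moreover have "u \<star> i \<star> v \<in> B" by (intro cl(6) iD(1) insert.prems(2) 1(1))
    ultimately show ?thesis by blast
  next
    case 2
    then have "i = i \<star> ?t \<star> i \<star> (u \<star> i \<star> v)" by (simp only: conv_assoc)
    moreover have "u \<star> i \<star> v \<in> B" by (intro cl(6) iD(1) insert.prems(2) 2(1))
    ultimately show ?thesis using insert.IH insert.prems(1) by blast
  qed
qed

text \<open>For a Sylow \<open>p\<close>-subgroup \<open>D\<close> of \<open>N\<close>, every \<open>N\<close>-fixed element is a trace from \<open>D\<close>, because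
  the index is invertible in \<open>k\<close>.\<close>

lemma sylow_subgroup:
  assumes N: "subgroup N G"
  shows "\<exists>D. psub D \<and> D \<subseteq> N \<and> of_nat (card (cosets N D)) \<noteq> (0 :: 'k)"
proof -
  let ?N = "G\<lparr>carrier := N\<rparr>"
  have finN: "finite N" using finite_subset[OF subgroup.subset[OF N] finG] .
  have N0: "card N \<noteq> 0" using finN subgroup.one_closed[OF N] by auto
  obtain m where m: "card N = p ^ multiplicity p (card N) * m" "\<not> p dvd m"
    using multiplicity_decompose'[OF N0, of p] prime_char not_prime_unit by blast
  obtain D where D: "subgroup D ?N" "card D = p ^ multiplicity p (card N)"
    using sylow_thm[OF prime_char subgroup_imp_group[OF N], of "multiplicity p (card N)" m] m finN
    by (auto simp: order_def)
  have DG: "subgroup D G" by (rule incl_subgroup[OF N D(1)])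
  have DN: "D \<subseteq> N" using subgroup.subset[OF D(1)] by simp
  have "card (cosets N D) * card D = card D * m" using card_cosets[OF N DG DN] m D(2) by simp
  moreover have "card D \<noteq> 0" using D(2) prime_char by (auto simp: prime_gt_0_nat)
  ultimately have "card (cosets N D) = m" by simp
  then show ?thesis
    using DG DN D(2) m(2) by (auto simp: p_subgroup_def of_nat_eq_0_iff_char_dvd simp flip: char_eq)
qed

text \<open>Write \<open>e\<close> as a trace from a smallest possible \<open>p\<close>-subgroup \<open>D\<close>, a defect group. As \<open>e\<close> is
  primitive in a commutative algebra, a single primitive idempotent \<open>j\<close> of \<open>(kG)\<^sup>D\<close> accounts for
  the trace, and \<open>Br\<^sub>D(j) \<noteq> 0\<close> by minimality; so \<open>j\<close> determines a pair \<open>(D, h)\<close>. For any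
  other pair \<open>(S, h')\<close>, expanding \<open>h' = Br\<^sub>S(e) h'\<close> by the Mackey formula yields a conjugate of
  \<open>j\<close> whose image under \<open>Br\<^sub>S\<close> meets \<open>h'\<close>.\<close>

lemma top_pair_exists:
  fixes e :: "'g \<Rightarrow> 'k"
  assumes T: "brauer_pair G T e" and N: "subgroup N G" and TN: "T \<subseteq> N" and CN: "cen T \<subseteq> N"
    and nrm: "\<And>x. x \<in> N \<Longrightarrow> cset x T = T" and stab: "\<And>x. x \<in> N \<Longrightarrow> act x e = e"
  shows "\<exists>D h. brauer_le G T e D h \<and> D \<subseteq> N \<and>
    (\<forall>S h'. brauer_le G T e S h' \<and> S \<subseteq> N \<longrightarrow> (\<exists>x\<in>N. brauer_le G S h' (cset x D) (act x h)))"
proof -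
  note TD = brauer_pairD[OF T]
  interpret N: subgroup N G by fact
  define C where "C = cen T"
  have C: "subgroup C G" unfolding C_def by (rule TD)
  note CG = subgroup.subset[OF C]
  have Cnrm: "cset x C = C" if "x \<in> N" for x
    using cen_cset[of x T] nrm[OF that] that TD(4) by (simp add: C_def)
  define Z where "Z = alg C \<inter> fixed N"
  have ZC: "Z \<subseteq> center C"
    using fixed_commute[OF CG] fixed_antimono[OF CN[folded C_def]] by (auto simp: Z_def intro!: centerI)
  note clN = subalgD[OF fixed_subalg[OF N.subset]]
  have convC: "a \<star> b \<in> alg C" if "a \<in> alg C" "b \<in> alg C" for a b
    using conv_alg_subgroup[OF C that] .
  have Z: "subalg Z"
    unfolding subalg_def Z_def using clN alg_closed unit_alg[OF C] convC by auto
  note clZ = subalgD[OF Z]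
  have eC: "e \<in> center C" "e \<in> alg C" using TD(6,7) by (auto simp: C_def)
  have eZ: "e \<in> Z" using eC TD(8) stab by (simp add: Z_def fixed_def)
  have ee: "e \<star> e = e" by (rule TD)
  have e: "prim Z e"
    using TD(2) eZ ZC unfolding C_def[symmetric] prim_def by blast
  have comm: "z \<star> a = a \<star> z" if "z \<in> Z" "a \<in> alg C" for z a
    using centerD(2) ZC that by blast
  have trZ: "trace Q N a \<in> Z" if "subgroup Q G" "Q \<subseteq> N" "a \<in> alg C" "a \<in> fixed Q" for Q a
    unfolding Z_def using trace_alg[OF N that(1,2) CG Cnrm that(4,3)] trace_fixed[OF N that(1,2,4)] by simp
  \<comment> \<open>Locality of \<open>Z\<close> at \<open>e\<close> singles out one summand of an expression of \<open>e\<close> by traces.\<close>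
  have pick: "\<exists>l\<in>I. \<exists>w\<in>Z. e = trace (Q l) N (F l \<star> w)"
    if I: "finite I" "\<And>l. l \<in> I \<Longrightarrow> subgroup (Q l) G \<and> Q l \<subseteq> N \<and> F l \<in> alg C \<and> F l \<in> fixed (Q l)"
      and sum: "e = (\<Sum>l\<in>I. trace (Q l) N (F l))" for I :: "'i set" and Q F
  proof -
    have "e = e \<star> (\<Sum>l\<in>I. trace (Q l) N (F l)) \<star> e \<star> e"
      unfolding sum[symmetric] by (simp only: ee)
    then obtain l u where lu: "l \<in> I" "u \<in> Z" "e = e \<star> trace (Q l) N (F l) \<star> e \<star> u"
      using prim_sum_many[OF Z e I(1), of "\<lambda>l. trace (Q l) N (F l)" e] trZ I(2) eZ by blast
    have Ql: "subgroup (Q l) G" "Q l \<subseteq> N" "F l \<in> alg C" "F l \<in> fixed (Q l)"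
      using I(2) lu(1) by auto
    define w where "w = e \<star> (e \<star> u)"
    have w: "w \<in> Z" unfolding w_def by (intro clZ(6) eZ lu(2))
    have "e \<star> trace (Q l) N (F l) = trace (Q l) N (F l) \<star> e"
      using comm[OF eZ] trZ[OF Ql] by (simp add: Z_def)
    then have "e = trace (Q l) N (F l) \<star> w" using lu(3) unfolding w_def by (metis conv_assoc)
    also have "\<dots> = trace (Q l) N (F l \<star> w)"
      using w by (intro conv_trace(2)[OF N Ql(1,2)]) (simp add: Z_def)
    finally show ?thesis using lu(1) w by blast
  qed
  define good where "good D \<longleftrightarrow> psub D \<and> D \<subseteq> N \<and> (\<exists>d\<in>alg C \<inter> fixed D. e = trace D N d)" for D
  have "\<exists>D. good D"
  proof -
    obtain D where D: "psub D" "D \<subseteq> N" "of_nat (card (cosets N D)) \<noteq> (0 :: 'k)"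
      using sylow_subgroup[OF N] by blast
    let ?d = "scale (inverse (of_nat (card (cosets N D)))) e"
    have d: "?d \<in> Z" by (intro clZ(7) eZ)
    then have "trace D N ?d = e"
      using trace_of_fixed[OF N psubD(1)[OF D(1)] D(2), of ?d] D(3) by (simp add: Z_def)
    moreover have "?d \<in> alg C \<inter> fixed D" using d fixed_antimono[OF D(2)] by (auto simp: Z_def)
    ultimately have "\<exists>d\<in>alg C \<inter> fixed D. e = trace D N d" by metis
    then show ?thesis using D unfolding good_def by blast
  qed
  then obtain D where "good D" and min: "\<And>D'. good D' \<Longrightarrow> card D \<le> card D'"
    using ex_has_least_nat[of good _ card] by metis
  then obtain d0 where D: "psub D" "D \<subseteq> N" and d0: "d0 \<in> alg C" "d0 \<in> fixed D" "e = trace D N d0"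
    by (auto simp: good_def)
  note DD = psubD[OF D(1)]
  interpret D: subgroup D G by (rule DD)
  note clD = subalgD[OF fixed_subalg[OF DD(2)]]
  have ZD: "w \<in> fixed D" "w \<in> alg C" if "w \<in> Z" for w
    using that fixed_antimono[OF D(2)] by (auto simp: Z_def)
  have BrTD: "Br T i \<in> fixed D" "Br T i \<in> alg C" if "i \<in> fixed D" for i
    using Br_fixed[OF DD(2) TD(4) nrm that] D(2) Br_alg[of T i] by (auto simp: C_def)
  \<comment> \<open>As \<open>T\<close> is normal in \<open>N\<close>, it lies in \<open>D\<close>: otherwise \<open>Br\<^sub>T\<close> would kill the trace \<open>e\<close>.\<close>
  have TsubD: "T \<subseteq> D"
  proof -
    have "Br T e \<noteq> 0" using TD(11) Br_id[OF TD(7)] by simp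
    then have "(\<Sum>X \<in> {X \<in> cosets N D. \<forall>s\<in>T. s \<rhd> X = X}. Br T (coset_act X d0)) \<noteq> 0"
      using Br_trace[OF N DD(1) D(2) TD(1) TN d0(2)] d0(3) by simp
    then obtain X where "X \<in> {X \<in> cosets N D. \<forall>s\<in>T. s \<rhd> X = X}"
      by (rule sum.not_neutral_contains_not_neutral)
    then obtain x where x: "x \<in> N" "\<forall>s\<in>T. s \<rhd> (x \<rhd> D) = x \<rhd> D" by (auto simp: cosets_def)
    then have "T \<subseteq> cset x D" using coset_fixed_iff[OF DD(1) TD(4)] by simp
    then have "cset (inv x) T \<subseteq> cset (inv x) (cset x D)" by (rule image_mono)
    then show ?thesis using x nrm[of "inv x"] D.subset by simp
  qed
  \<comment> \<open>A primitive idempotent \<open>j\<close> of \<open>(kG)\<^sup>D\<close> that accounts for the whole trace.\<close>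
  obtain I where I: "finite I" "\<forall>i\<in>I. prim (fixed D) i" "\<Sum>I = unit"
    using primitive_decomposition[OF fixed_subalg[OF DD(2)]] by blast
  have "d0 = d0 \<star> Br T (\<Sum>I)"
    unfolding I(3) using Br_unit[OF TD(4)] clD(1)[OF d0(2)] by (simp add: unit_conv)
  then have "d0 = (\<Sum>i\<in>I. d0 \<star> Br T i)" by (simp only: Br_sum conv_sum_right)
  then have "e = (\<Sum>i\<in>I. trace D N (d0 \<star> Br T i))"
    using d0(3) by (metis trace_sum[OF N DD(1) D(2)])
  moreover have "d0 \<star> Br T i \<in> alg C \<and> d0 \<star> Br T i \<in> fixed D" if "i \<in> I" for i
    using BrTD[OF primD(1)] I(2) that d0 convC clD(6) by blast
  ultimately obtain j w where j: "j \<in> I" and w: "w \<in> Z" "e = trace D N (d0 \<star> Br T j \<star> w)"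
    using pick[OF I(1), of "\<lambda>_. D" "\<lambda>i. d0 \<star> Br T i"] DD(1) D(2) by blast
  have jp: "prim (fixed D) j" using I(2) j by blast
  note jD = primD[OF jp]
  define d where "d = d0 \<star> w"
  have d: "d \<in> alg C" "d \<in> fixed D"
    unfolding d_def using convC clD(6) d0 ZD[OF w(1)] by blast+
  define j' where "j' = Br T j"
  have j': "j' \<in> alg C" "j' \<in> fixed D" unfolding j'_def using BrTD[OF jD(1)] by blast+
  have ed: "e = trace D N (d \<star> j')"
    using w(2) comm[OF w(1) j'(1)] unfolding d_def j'_def by (simp add: conv_assoc)
  \<comment> \<open>Otherwise \<open>j'\<close> is a sum of traces from proper subgroups of \<open>D\<close>, and by transitivity of the
    trace one of these would already suffice for \<open>e\<close>.\<close>
  have Brj: "Br D j \<noteq> 0"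
  proof
    assume "Br D j = 0"
    then have zero: "Br D j' = 0" unfolding j'_def using Br_Br[OF TsubD, of j] by simp
    define St where "St r = {x \<in> D. conj_elem G x r = r}" for r
    define F where "F r = scale (j' r) (basis_elem r)" for r
    obtain X where X: "finite X" "\<forall>r\<in>X. r \<in> carrier G \<and> j' r \<noteq> 0" "j' = (\<Sum>r\<in>X. trace (St r) D (F r))"
      using fixed_eq_sum_trace[OF DD(1) j'(2)] unfolding St_def F_def by blast
    have St: "subgroup (St r) G" "St r \<subseteq> D" "F r \<in> fixed (St r)" "F r \<in> alg C" "St r \<noteq> D"
      if r: "r \<in> X" for r
    proof -
      have rG: "r \<in> carrier G" and jr: "j' r \<noteq> 0" using X(2) r by auto
      show "subgroup (St r) G" "St r \<subseteq> D" "F r \<in> fixed (St r)"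
        unfolding St_def F_def using stab_subgroup[OF DD(1) rG] scale_basis_fixed[OF DD(1) rG] by auto
      show "F r \<in> alg C" using j'(1) jr by (auto simp: F_def alg_def scale_def basis_elem_def)
      show "St r \<noteq> D"
      proof
        assume "St r = D"
        then have "conj_elem G x r = r" if "x \<in> D" for x using that by (auto simp: St_def)
        then have "r \<in> cen D"
          using rG DD(2) conj_elem_eq_iff by (auto simp: centralizer_def subset_iff)
        then have "j' r = Br D j' r" by (simp add: brauer_hom_def)
        then show False using zero jr by simp
      qed
    qed
    have dF: "d \<star> F r \<in> fixed (St r)" "d \<star> F r \<in> alg C" if r: "r \<in> X" for r
    proof -
      have "St r \<subseteq> carrier G" using St(2)[OF r] DD(2) by blast
      moreover have "d \<in> fixed (St r)" using d(2) fixed_antimono[OF St(2)[OF r]] by blast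
      ultimately show "d \<star> F r \<in> fixed (St r)" using subalgD(6)[OF fixed_subalg] St(3)[OF r] by blast
      show "d \<star> F r \<in> alg C" by (rule convC[OF d(1) St(4)[OF r]])
    qed
    have "e = trace D N (\<Sum>r\<in>X. d \<star> trace (St r) D (F r))"
      using ed X(3) by (metis conv_sum_right)
    also have "\<dots> = (\<Sum>r\<in>X. trace D N (d \<star> trace (St r) D (F r)))" by (rule trace_sum[OF N DD(1) D(2)])
    also have "\<dots> = (\<Sum>r\<in>X. trace (St r) N (d \<star> F r))"
    proof (intro sum.cong refl)
      fix r assume r: "r \<in> X"
      have "d \<star> trace (St r) D (F r) = trace (St r) D (d \<star> F r)"
        by (rule conv_trace(1)[OF DD(1) St(1,2)[OF r] d(2)])
      then show "trace D N (d \<star> trace (St r) D (F r)) = trace (St r) N (d \<star> F r)"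
        using trace_trace[OF N DD(1) St(1)[OF r] D(2) St(2)[OF r] dF(1)[OF r]] by simp
    qed
    finally obtain r w' where r: "r \<in> X" and w': "w' \<in> Z" "e = trace (St r) N (d \<star> F r \<star> w')"
      using pick[OF X(1), of St "\<lambda>r. d \<star> F r"] St D(2) dF by blast
    have "St r \<subseteq> N" "St r \<subseteq> carrier G" using St(2)[OF r] D(2) DD(2) by blast+
    moreover have "w' \<in> fixed (St r)" "w' \<in> alg C"
      using w'(1) fixed_antimono[OF \<open>St r \<subseteq> N\<close>] by (auto simp: Z_def)
    ultimately have "d \<star> F r \<star> w' \<in> alg C \<inter> fixed (St r)"
      using dF[OF r] convC subalgD(6)[OF fixed_subalg] by blast
    then have "good (St r)"
      unfolding good_def using w'(2) psub_subset[OF D(1) St(1,2)[OF r]] \<open>St r \<subseteq> N\<close> by blast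
    then have "card D \<le> card (St r)" by (rule min)
    then show False using card_seteq[OF finite_subset[OF DD(2) finG] St(2)[OF r]] St(5)[OF r] by simp
  qed
  obtain h where h: "brauer_pair G D h" "associated_idempotent G j D h"
    using prim_associated_exists[OF D(1) jp Brj] by blast
  have TDh: "brauer_le G T e D h"
  proof -
    obtain e' where e': "brauer_le G T e' D h" using sub_pair_exists[OF h(1) TD(3) TsubD] by blast
    have e'j: "e' \<star> j' = j'"
      unfolding j'_def using associatedD(3)[OF brauer_leD(1)[OF e'] brauer_leD(4)[OF e' jp h(2)]] .
    have "e = e'"
    proof (rule ccontr)
      assume "e \<noteq> e'"
      then have "e \<star> e' = 0"
        using blk_orth[OF TD(4,2)] brauer_pairD(2)[OF brauer_leD(1)[OF e']] by blast
      then have "e \<star> j' = 0" using e'j by (metis conv_assoc conv_zero(1))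
      then have "e \<star> (d \<star> j') = 0" using comm[OF eZ d(1)] by (metis conv_assoc conv_zero(2))
      moreover have "e \<star> e = trace D N (e \<star> (d \<star> j'))"
        using conv_trace(1)[OF N DD(1) D(2), of e "d \<star> j'"] eZ ed by (simp add: Z_def)
      moreover have "trace D N 0 = 0" by (simp add: trace_def coset_act_def)
      ultimately show False using ee TD(11) by simp
    qed
    then show ?thesis using e' by simp
  qed
  have "\<exists>x\<in>N. brauer_le G S h' (cset x D) (act x h)"
    if le: "brauer_le G T e S h'" and SN: "S \<subseteq> N" for S h'
  proof -
    note leD = brauer_leD[OF le]
    note SD = brauer_pairD[OF leD(2)]
    let ?Y = "{X \<in> cosets N D. \<forall>s\<in>S. s \<rhd> X = X}"
    have dj: "d \<star> j' \<in> fixed D" by (rule clD(6)[OF d(2) j'(2)])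
    have "Br S e \<star> h' = h'" by (rule normal_sub_pair(2)[OF le nrm]) (use SN in blast)
    moreover have "Br S e = (\<Sum>X\<in>?Y. Br S (coset_act X (d \<star> j')))"
      unfolding ed by (rule Br_trace[OF N DD(1) D(2) SD(1) SN dj])
    ultimately have "(\<Sum>X\<in>?Y. Br S (coset_act X (d \<star> j')) \<star> h') \<noteq> 0"
      using SD(11) by (simp add: conv_sum_left)
    then obtain X where X: "X \<in> ?Y" "Br S (coset_act X (d \<star> j')) \<star> h' \<noteq> 0"
      by (rule sum.not_neutral_contains_not_neutral)
    then obtain x where x: "x \<in> N" "X = x \<rhd> D" by (auto simp: cosets_def)
    have xG: "x \<in> carrier G" using x(1) by simp
    have SxD: "S \<subseteq> cset x D" using X(1) x coset_fixed_iff[OF DD(1) SD(4) xG] by simp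
    have sub: "fixed (cset x D) \<subseteq> fixed S" by (rule fixed_antimono[OF SxD])
    have dS: "act x d \<in> fixed S" and jS: "act x j \<in> fixed S" and jS': "act x j' \<in> fixed S"
      using act_fixed[OF xG DD(2)] d(2) jD(1) j'(2) sub by blast+
    have "act x j' = Br T (act x j)"
      unfolding j'_def using Br_act[OF xG TD(4), of j] nrm[OF x(1)] by simp
    then have "Br S (act x j') = Br S (act x j)" using Br_Br[OF leD(3)] by simp
    then have "Br S (coset_act X (d \<star> j')) = Br S (act x d) \<star> Br S (act x j)"
      unfolding x(2) coset_act_eq[OF DD(1) xG dj] act_conv[OF xG] Br_conv[OF SD(1) dS jS'] by simp
    then have ne: "Br S (act x j) \<star> h' \<noteq> 0" using X(2) by (auto simp: conv_assoc)
    note xh = brauer_pair_conj[OF xG h(1)] associated_conj[OF xG h]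
    obtain g where g: "brauer_le G S g (cset x D) (act x h)"
      using sub_pair_exists[OF xh(1) SD(3) SxD] by blast
    note gD = brauer_leD[OF g]
    have "Br S (act x j) \<star> g = Br S (act x j)"
      by (rule associatedD(4)[OF gD(1) gD(4)[OF prim_fixed_act[OF xG DD(2) jp] xh(2)]])
    then have "g \<star> h' \<noteq> 0" using ne by (metis conv_assoc conv_zero(2))
    then have "g = h'" using blk_orth[OF SD(4) brauer_pairD(2)[OF gD(1)] SD(2)] by blast
    then show ?thesis using g x(1) by blast
  qed
  then show ?thesis using TDh D(2) by blast
qed

end

section \<open>The fusion system of a block\<close>

locale maximal_pair = modular_group_algebra G k p
  for G :: "('g, 'm) monoid_scheme" (structure) and k :: "'k::field itself" and p :: nat +
  fixes c f :: "'g \<Rightarrow> 'k" and P :: "'g set"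
  assumes block: "block_idempotent G c" and maximal: "maximal_brauer_pair G c P f"
begin

abbreviation GP :: "('g, 'm) monoid_scheme" where "GP \<equiv> G\<lparr>carrier := P\<rparr>"
abbreviation eb :: "'g set \<Rightarrow> 'g \<Rightarrow> 'k" where "eb \<equiv> sub_block G P f"
abbreviation \<F> :: "'g morphism set" where "\<F> \<equiv> block_fusion_system G P f"

definition below_P :: "'g set \<Rightarrow> bool" where "below_P Q \<longleftrightarrow> subgroup Q G \<and> Q \<subseteq> P"

text \<open>\<open>fusing x Q\<close> says that conjugation by \<open>x\<close> is a morphism of the fusion system on \<open>Q\<close>: by
  uniqueness of the blocks \<open>e\<^sub>R\<close>, the inclusion of pairs in the definition of the fusion system
  amounts to \<open>\<^sup>xe\<^sub>Q\<close> being the block belonging to \<open>\<^sup>xQ\<close>.\<close>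

definition fusing :: "'g \<Rightarrow> 'g set \<Rightarrow> bool" where
  "fusing x Q \<longleftrightarrow> x \<in> carrier G \<and> below_P Q \<and> cset x Q \<subseteq> P \<and> act x (eb Q) = eb (cset x Q)"

definition conj_map :: "'g \<Rightarrow> 'g set \<Rightarrow> 'g \<Rightarrow> 'g" where
  "conj_map x Q = (\<lambda>u\<in>Q. conj_elem G x u)"

lemma pairP: "brauer_pair G P f"
  using maximal by (simp add: maximal_brauer_pair_def block_brauer_pair_def)

lemmas pairPD = brauer_pairD[OF pairP]

sublocale P: subgroup P G by (rule pairPD)

lemma below_PD: "below_P Q \<Longrightarrow> subgroup Q G" "below_P Q \<Longrightarrow> Q \<subseteq> P" "below_P Q \<Longrightarrow> Q \<subseteq> carrier G"
  by (auto simp: below_P_def)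

lemma below_P_iff: "subgroup Q GP \<longleftrightarrow> below_P Q"
  unfolding below_P_def using subgroup_incl[OF _ pairPD(3)] incl_subgroup[OF pairPD(3)] subgroup.subset
  by fastforce

lemma sub_P: "below_P P" by (simp add: below_P_def pairPD)

lemma eb_le: "below_P Q \<Longrightarrow> brauer_le G Q (eb Q) P f"
  by (rule sub_block_le[OF pairP below_PD(1,2)])

lemma eb_P: "eb P = f"
  by (rule sub_block_eq[OF brauer_le_refl[OF pairP]])

lemma eb_between: "below_P Q \<Longrightarrow> below_P R \<Longrightarrow> Q \<subseteq> R \<Longrightarrow> brauer_le G Q (eb Q) R (eb R)"
  by (rule brauer_le_between[OF eb_le eb_le])

lemma sub_cset: "x \<in> carrier G \<Longrightarrow> below_P Q \<Longrightarrow> cset x Q \<subseteq> P \<Longrightarrow> below_P (cset x Q)"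
  by (simp add: below_P_def cset_subgroup)

lemma eb_carrier: "below_P Q \<Longrightarrow> eb Q \<in> alg (carrier G)"
  by (rule brauer_pairD(8)[OF brauer_leD(1)[OF eb_le]])

lemma fusingI:
  assumes x: "x \<in> carrier G" and Q: "below_P Q" and le: "brauer_le G (cset x Q) (act x (eb Q)) P f"
  shows "fusing x Q"
  using x Q sub_block_eq[OF le] brauer_leD(3)[OF le] by (simp add: fusing_def)

lemma fusingD:
  assumes "fusing x Q"
  shows "x \<in> carrier G" "below_P Q" "cset x Q \<subseteq> P" "act x (eb Q) = eb (cset x Q)" "below_P (cset x Q)"
    "Q \<subseteq> carrier G"
  using assms sub_cset below_PD(3) by (auto simp: fusing_def)

lemma fusing_mult:
  assumes x: "fusing x Q" and y: "fusing y (cset x Q)"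
  shows "fusing (y \<otimes> x) Q"
  using fusingD[OF x] fusingD[OF y] by (simp add: fusing_def cset_mult act_mult)

lemma fusing_inv:
  assumes x: "fusing x Q"
  shows "fusing (inv x) (cset x Q)"
  using fusingD[OF x] below_PD(2)[OF fusingD(2)[OF x]] act_inv(1)[OF fusingD(1)[OF x] eb_carrier[OF fusingD(2)[OF x]]]
  by (simp add: fusing_def)

lemma fusing_restrict:
  assumes x: "fusing x A" and Q: "below_P Q" "Q \<subseteq> A"
  shows "fusing x Q"
proof (rule fusingI[OF fusingD(1)[OF x] Q(1)])
  note xD = fusingD[OF x]
  have "brauer_le G (cset x Q) (act x (eb Q)) (cset x A) (eb (cset x A))"
    using brauer_le_conj[OF xD(1) eb_between[OF Q(1) xD(2) Q(2)]] xD(4) by simp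
  then show "brauer_le G (cset x Q) (act x (eb Q)) P f"
    by (rule brauer_le_trans[OF _ eb_le[OF xD(5)]])
qed

lemma fusing_P:
  assumes u: "u \<in> P" and Q: "below_P Q"
  shows "fusing u Q"
proof (rule fusing_restrict[OF _ Q below_PD(2)[OF Q]])
  show "fusing u P"
    using u cset_self[OF pairPD(3) u] act_stable[OF pairP u] by (simp add: fusing_def sub_P eb_P)
qed

lemma conj_map_inj: "fusing x Q \<Longrightarrow> inj_on (conj_map x Q) Q"
  unfolding conj_map_def inj_on_restrict_eq by (rule inj_on_subset[OF inj_conj[OF fusingD(1)] fusingD(6)])

lemma conj_map_image: "conj_map x Q ` Q = cset x Q"
  by (auto simp: conj_map_def)

lemma conj_map_compose:
  assumes "x \<in> carrier G" "y \<in> carrier G" "Q \<subseteq> carrier G" "cset x Q \<subseteq> R"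
  shows "compose Q (conj_map y R) (conj_map x Q) = conj_map (y \<otimes> x) Q"
  using assms by (auto simp: compose_def conj_map_def fun_eq_iff conj_elem_mult subset_iff)

lemma conj_map_inverse:
  assumes x: "fusing x Q"
  shows "(\<lambda>v\<in>conj_map x Q ` Q. inv_into Q (conj_map x Q) v) = conj_map (inv x) (cset x Q)"
proof
  fix v
  note xD = fusingD[OF x]
  have "inv_into Q (conj_map x Q) (conj_map x Q u) = conj_elem G (inv x) (conj_map x Q u)" if "u \<in> Q" for u
    using that inv_into_f_f[OF conj_map_inj[OF x] that] xD(1,6) by (auto simp: conj_map_def)
  then show "(\<lambda>v\<in>conj_map x Q ` Q. inv_into Q (conj_map x Q) v) v = conj_map (inv x) (cset x Q) v"
    unfolding conj_map_image[symmetric] by (auto simp: conj_map_def[of "inv x"])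
qed

lemma mem_F_iff:
  "(Q, \<phi>, R) \<in> \<F> \<longleftrightarrow> below_P R \<and> (\<exists>x. fusing x Q \<and> cset x Q \<subseteq> R \<and> \<phi> = conj_map x Q)"
proof
  assume "(Q, \<phi>, R) \<in> \<F>"
  then obtain x where x: "x \<in> carrier G" "below_P Q" "below_P R" "\<phi> \<in> extensional Q"
    "\<forall>u\<in>Q. \<phi> u = conj_elem G x u" "brauer_le G (cset x Q) (act x (eb Q)) R (eb R)"
    by (auto simp: block_fusion_system_def subgroup_morphisms_def below_P_iff conj_alg_eq_act)
  have "fusing x Q"
    using brauer_le_trans[OF x(6) eb_le[OF x(3)]] by (rule fusingI[OF x(1,2)])
  moreover have "cset x Q \<subseteq> R" using brauer_leD(3)[OF x(6)] .
  moreover have "\<phi> = conj_map x Q"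
    using x(4,5) by (auto simp: conj_map_def fun_eq_iff extensional_def)
  ultimately show "below_P R \<and> (\<exists>x. fusing x Q \<and> cset x Q \<subseteq> R \<and> \<phi> = conj_map x Q)" using x(3) by blast
next
  assume "below_P R \<and> (\<exists>x. fusing x Q \<and> cset x Q \<subseteq> R \<and> \<phi> = conj_map x Q)"
  then obtain x where x: "below_P R" "fusing x Q" "cset x Q \<subseteq> R" "\<phi> = conj_map x Q" by blast
  note xD = fusingD[OF x(2)]
  have "\<phi> \<in> hom (GP\<lparr>carrier := Q\<rparr>) (GP\<lparr>carrier := R\<rparr>)"
  proof (rule homI)
    fix u v assume "u \<in> carrier (GP\<lparr>carrier := Q\<rparr>)" "v \<in> carrier (GP\<lparr>carrier := Q\<rparr>)"
    then have uv: "u \<in> Q" "v \<in> Q" "u \<in> carrier G" "v \<in> carrier G" using xD(6) by auto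
    then have "u \<otimes> v \<in> Q" using subgroup.m_closed[OF below_PD(1)[OF xD(2)]] by simp
    then show "\<phi> (u \<otimes>\<^bsub>GP\<lparr>carrier := Q\<rparr>\<^esub> v) = \<phi> u \<otimes>\<^bsub>GP\<lparr>carrier := R\<rparr>\<^esub> \<phi> v"
      using uv xD(1) by (simp add: x(4) conj_map_def conj_elem_def m_assoc)
  qed (use x in \<open>auto simp: conj_map_def\<close>)
  moreover have "brauer_le G (cset x Q) (conj_alg G x (eb Q)) R (eb R)"
    using eb_between[OF xD(5) x(1,3)] xD(1,4) by (simp add: conj_alg_eq_act)
  ultimately show "(Q, \<phi>, R) \<in> \<F>"
    using x xD(1,2)
    by (auto simp: block_fusion_system_def subgroup_morphisms_def below_P_iff conj_map_def)
qed

lemma conj_elem_GP: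
  assumes "x \<in> P" shows "conj_elem GP x u = conj_elem G x u"
  using m_inv_consistent[OF pairPD(3) assms] by (simp add: conj_elem_def)

lemma fusing_one: "below_P Q \<Longrightarrow> fusing \<one> Q"
  by (rule fusing_P[OF P.one_closed])

lemma conj_map_one: "below_P Q \<Longrightarrow> conj_map \<one> Q = (\<lambda>u\<in>Q. u)"
  using below_PD(3) by (auto simp: conj_map_def fun_eq_iff conj_elem_one subset_iff)

lemma fusion_system_F: "fusion_system GP \<F>"
  unfolding fusion_system_def Hom_def mem_Collect_eq
proof (intro conjI allI ballI impI)
  show "\<F> \<subseteq> subgroup_morphisms GP" by (auto simp: block_fusion_system_def)
next
  fix Q assume "subgroup Q GP"
  then have Q: "below_P Q" by (simp add: below_P_iff)
  then show "(Q, \<lambda>u\<in>Q. u, Q) \<in> \<F>"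
    unfolding mem_F_iff using fusing_one[OF Q] conj_map_one[OF Q] cset_one[OF below_PD(3)[OF Q]] by force
next
  fix Q R S \<phi> \<psi> assume "\<phi> \<in> {\<phi>. (Q, \<phi>, R) \<in> \<F>}" "\<psi> \<in> {\<phi>. (R, \<phi>, S) \<in> \<F>}"
  then obtain x y where x: "fusing x Q" "cset x Q \<subseteq> R" "\<phi> = conj_map x Q"
    and y: "fusing y R" "cset y R \<subseteq> S" "\<psi> = conj_map y R" and S: "below_P S" by (auto simp: mem_F_iff)
  note xD = fusingD[OF x(1)] and yD = fusingD[OF y(1)]
  have "fusing (y \<otimes> x) Q" by (rule fusing_mult[OF x(1) fusing_restrict[OF y(1) xD(5) x(2)]])
  moreover have "cset (y \<otimes> x) Q \<subseteq> S" using x(2) y(2) xD yD by (auto simp: cset_mult)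
  moreover have "compose Q \<psi> \<phi> = conj_map (y \<otimes> x) Q"
    unfolding x(3) y(3) by (rule conj_map_compose[OF xD(1) yD(1) xD(6) x(2)])
  ultimately show "(Q, compose Q \<psi> \<phi>, S) \<in> \<F>" using S by (auto simp: mem_F_iff)
next
  fix Q R x
  assume "x \<in> carrier GP" and "subgroup Q GP \<and> subgroup R GP \<and> conj_elem GP x ` Q \<subseteq> R"
  then have x: "x \<in> P" and Q: "below_P Q" and R: "below_P R" and QR: "cset x Q \<subseteq> R"
    by (auto simp: below_P_iff conj_elem_GP)
  show "(Q, \<lambda>u\<in>Q. conj_elem GP x u, R) \<in> \<F>"
    unfolding mem_F_iff conj_elem_GP[OF x] conj_map_def[symmetric] using fusing_P[OF x Q] R QR by blast
next
  fix Q R \<phi> assume "\<phi> \<in> {\<phi>. (Q, \<phi>, R) \<in> \<F>}"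
  then obtain x where x: "fusing x Q" "\<phi> = conj_map x Q" by (auto simp: mem_F_iff)
  show "inj_on \<phi> Q" using conj_map_inj[OF x(1)] x(2) by simp
  show "(Q, \<phi>, \<phi> ` Q) \<in> \<F>"
    unfolding mem_F_iff x(2) conj_map_image using x(1) fusingD(5)[OF x(1)] by blast
  have "cset (inv x) (cset x Q) = Q" using fusingD(1,6)[OF x(1)] by simp
  then show "(\<phi> ` Q, \<lambda>v\<in>\<phi> ` Q. inv_into Q \<phi> v, Q) \<in> \<F>"
    unfolding mem_F_iff x(2) conj_map_inverse[OF x(1)] unfolding conj_map_image
    using fusing_inv[OF x(1)] fusingD(2)[OF x(1)] by auto
qed

lemma fusion_isomorphic_iff:
  "fusion_isomorphic \<F> Q R \<longleftrightarrow> (\<exists>x. fusing x Q \<and> cset x Q = R)"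
proof
  assume "fusion_isomorphic \<F> Q R"
  then obtain \<phi> \<psi> where \<phi>: "(Q, \<phi>, R) \<in> \<F>" and \<psi>: "(R, \<psi>, Q) \<in> \<F>"
    and id: "compose R \<phi> \<psi> = (\<lambda>v\<in>R. v)" by (auto simp: fusion_isomorphic_def Hom_def)
  obtain x where x: "fusing x Q" "cset x Q \<subseteq> R" "\<phi> = conj_map x Q" using \<phi> by (auto simp: mem_F_iff)
  have "v \<in> cset x Q" if v: "v \<in> R" for v
  proof -
    have "\<psi> v \<in> Q" using \<psi> v by (auto simp: mem_F_iff conj_map_def)
    moreover have "\<phi> (\<psi> v) = v" using fun_cong[OF id, of v] v by (simp add: compose_def)
    ultimately show ?thesis using conj_map_image[of x Q] x(3) by (metis imageI)
  qed
  then show "\<exists>x. fusing x Q \<and> cset x Q = R" using x by blast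
next
  assume "\<exists>x. fusing x Q \<and> cset x Q = R"
  then obtain x where x: "fusing x Q" "R = cset x Q" by blast
  note xD = fusingD[OF x(1)]
  have "cset (inv x) (cset x Q) = Q" using xD by simp
  then have "(Q, conj_map x Q, R) \<in> \<F>" "(R, conj_map (inv x) R, Q) \<in> \<F>"
    unfolding mem_F_iff using x xD(2,5) fusing_inv[OF x(1)] by blast+
  moreover have "compose Q (conj_map (inv x) R) (conj_map x Q) = (\<lambda>u\<in>Q. u)"
    using conj_map_compose[of x "inv x" Q R] xD conj_map_one[OF xD(2)] by (simp add: x(2))
  moreover have "compose R (conj_map x Q) (conj_map (inv x) R) = (\<lambda>v\<in>R. v)"
    using conj_map_compose[of "inv x" x R Q] xD conj_map_one[OF xD(5)] below_PD(3)[OF xD(5)] by (simp add: x(2))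
  ultimately show "fusion_isomorphic \<F> Q R" unfolding fusion_isomorphic_def Hom_def by blast
qed

lemma normalizer_GP:
  assumes R: "below_P R"
  shows "normalizer GP R = nrm P R"
proof -
  have "g \<in> normalizer GP R \<longleftrightarrow> g \<in> P \<and> cset g R = R" for g
  proof (cases "g \<in> P")
    case g: True
    have "g <#\<^bsub>GP\<^esub> R #>\<^bsub>GP\<^esub> (inv\<^bsub>GP\<^esub> g) = cset g R"
      using m_inv_consistent[OF pairPD(3) g] by (auto simp: l_coset_def r_coset_def conj_elem_def)
    then show ?thesis using g below_PD(2)[OF R] by (auto simp: normalizer_def stabilizer_def)
  qed (auto simp: normalizer_def stabilizer_def)
  then show ?thesis by (auto simp: nrm_def)
qed

lemma all_isomorphic_iff:
  "(\<forall>R. subgroup R GP \<and> fusion_isomorphic \<F> Q R \<longrightarrow> X R) \<longleftrightarrow> (\<forall>x. fusing x Q \<longrightarrow> X (cset x Q))"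
  unfolding below_P_iff fusion_isomorphic_iff using fusingD(5) by blast

lemma fully_normalized_iff:
  assumes Q: "below_P Q"
  shows "fully_normalized GP \<F> Q \<longleftrightarrow>
    (\<forall>x. fusing x Q \<longrightarrow> card (nrm P (cset x Q)) \<le> card (nrm P Q))"
  unfolding fully_normalized_def all_isomorphic_iff normalizer_GP[OF Q]
  using normalizer_GP[OF fusingD(5)] by simp

lemma fusion_centric_iff:
  "fusion_centric GP \<F> Q \<longleftrightarrow> (\<forall>x. fusing x Q \<longrightarrow> P \<inter> cen (cset x Q) \<subseteq> cset x Q)"
proof -
  have "centralizer GP R = centralizer (GP\<lparr>carrier := R\<rparr>) R \<longleftrightarrow> P \<inter> cen R \<subseteq> R" if "below_P R" for R
    using below_PD[OF that] by (auto simp: centralizer_def)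
  note * = this[OF fusingD(5)]
  show ?thesis
    unfolding fusion_centric_def all_isomorphic_iff by (intro iff_allI imp_cong refl *)
qed

lemma sub_trivial: "below_P {\<one>}"
  by (simp add: below_P_def triv_subgroup)

lemma cen_trivial: "cen {\<one>} = carrier G"
  by (auto simp: centralizer_def)

text \<open>If the block below \<open>(P, f)\<close> at the trivial subgroup were not \<open>c\<close>, it would be orthogonal to
  \<open>c\<close>, and \<open>Br\<^sub>P\<close> would carry this over to \<open>f\<close>.\<close>

lemma eb_trivial: "eb {\<one>} = c"
proof (rule ccontr)
  assume ne: "eb {\<one>} \<noteq> c"
  have c: "blk {\<one>} c"
    using block block_idempotent_iff[OF subgroup_self] by (simp add: cen_trivial)
  have trivial: "cset s {\<one>} = {\<one>}" if "s \<in> P" for s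
    using that by (simp add: conj_elem_def)
  note le = eb_le[OF sub_trivial] and e = brauer_pairD[OF brauer_leD(1)[OF eb_le[OF sub_trivial]]]
  have "eb {\<one>} \<star> c = 0" using blk_orth[OF _ e(2) c] ne by auto
  moreover have "eb {\<one>} \<in> fixed P" "Br P (eb {\<one>}) \<star> f = f"
    using normal_sub_pair[OF le trivial] by auto
  moreover have cP: "c \<in> fixed P"
    using center_fixed[OF subgroup_self] primD(1)[OF c] fixed_antimono[OF P.subset]
    by (auto simp: cen_trivial)
  moreover have "Br P c \<star> f = f"
    using maximal mult_subgroup[OF pairPD(5) Br_alg pairPD(7)]
    by (simp add: maximal_brauer_pair_def block_brauer_pair_def)
  ultimately have "f = 0" using Br_conv[OF pairPD(1), of "eb {\<one>}" c] by (metis conv_assoc conv_zero(1) Br_zero)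
  then show False using pairPD(11) by simp
qed

lemma block_brauer_pairI:
  assumes le: "brauer_le G {\<one>} c S h"
  shows "block_brauer_pair G c S h"
proof -
  note SD = brauer_pairD[OF brauer_leD(2)[OF le]]
  have "cset s {\<one>} = {\<one>}" if "s \<in> S" for s
    using that SD(4) by (auto simp: conj_elem_def subset_iff)
  then have "Br S c \<star> h = h" by (rule normal_sub_pair(2)[OF le])
  then show ?thesis
    using brauer_leD(2)[OF le] mult_subgroup[OF SD(5) Br_alg SD(7)] by (simp add: block_brauer_pair_def)
qed

text \<open>The \<open>(kG, c)\<close>-Brauer pairs are the pairs above \<open>(1, c)\<close>, so the conjugacy theorem for \<open>N = G\<close>
  applies to them, and maximality makes \<open>(P, f)\<close> conjugate to the pair that it yields.\<close>

lemma le_conj_P: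
  assumes le: "brauer_le G {\<one>} c S h"
  shows "\<exists>x\<in>carrier G. brauer_le G S h (cset x P) (act x f)"
proof -
  have c: "brauer_pair G {\<one>} c" by (rule brauer_leD(1)[OF le])
  note cD = brauer_pairD[OF c]
  have stab: "act x c = c" if "x \<in> carrier G" for x
    using center_fixed[OF subgroup_self, of c] cD(6) that by (simp add: cen_trivial fixed_def)
  have trivial: "cset x {\<one>} = {\<one>}" if "x \<in> carrier G" for x
    using that by (simp add: conj_elem_def)
  obtain D h0 where D: "brauer_le G {\<one>} c D h0"
    and top': "\<forall>S h. brauer_le G {\<one>} c S h \<and> S \<subseteq> carrier G \<longrightarrow>
      (\<exists>x\<in>carrier G. brauer_le G S h (cset x D) (act x h0))"
    using top_pair_exists[OF c subgroup_self cD(4) cen_subset trivial stab] by blast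
  have top: "\<exists>x\<in>carrier G. brauer_le G S h (cset x D) (act x h0)" if "brauer_le G {\<one>} c S h" for S h
    using top' that brauer_pairD(4)[OF brauer_leD(2)[OF that]] by blast
  note DD = brauer_pairD[OF brauer_leD(2)[OF D]]
  have cP: "brauer_le G {\<one>} c P f" using eb_le[OF sub_trivial] by (simp add: eb_trivial)
  obtain x where x: "x \<in> carrier G" "brauer_le G P f (cset x D) (act x h0)" using top[OF cP] by blast
  have "block_brauer_pair G c (cset x D) (act x h0)"
    by (rule block_brauer_pairI[OF brauer_le_trans[OF cP x(2)]])
  then have eq: "cset x D = P" "act x h0 = f"
    using maximal x(2) by (auto simp: maximal_brauer_pair_def)
  obtain y where y: "y \<in> carrier G" "brauer_le G S h (cset y D) (act y h0)" using top[OF le] by blast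
  have "cset (y \<otimes> inv x) P = cset y D" "act (y \<otimes> inv x) f = act y h0"
    using x(1) y(1) DD(4,8) P.subset by (simp_all add: cset_mult act_mult flip: eq)
  then show ?thesis using x(1) y by (intro bexI[of _ "y \<otimes> inv x"]) auto
qed

section \<open>The normalizer of a fully normalized subgroup\<close>

text \<open>The stabilizer \<open>N\<^sub>G(T, e\<^sub>T)\<close> of the pair belonging to \<open>T\<close>.\<close>

definition Ns :: "'g set \<Rightarrow> 'g set" where
  "Ns T = {x \<in> carrier G. cset x T = T \<and> act x (eb T) = eb T}"

text \<open>The elements of \<open>N\<^sub>G(T, e\<^sub>T)\<close> that act on \<open>T\<close> as elements of \<open>T\<close>, that is,
  \<open>T C\<^sub>G(T)\<close>.\<close>

definition Ms :: "'g set \<Rightarrow> 'g set" where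
  "Ms T = {x \<in> Ns T. \<exists>t\<in>T. \<forall>u\<in>T. conj_elem G x u = conj_elem G t u}"

lemma Ns_subgroup:
  assumes T: "below_P T"
  shows "subgroup (Ns T) G"
proof
  fix x assume "x \<in> Ns T"
  then show "inv x \<in> Ns T"
    using cset_inv(1)[of x T] act_inv(1)[of x "eb T"] below_PD(3)[OF T] eb_carrier[OF T]
    by (auto simp: Ns_def)
qed (use below_PD(3)[OF T] eb_carrier[OF T] in \<open>auto simp: Ns_def cset_mult act_mult cset_one act_one\<close>)

lemma NsD:
  "x \<in> Ns T \<Longrightarrow> x \<in> carrier G" "x \<in> Ns T \<Longrightarrow> cset x T = T" "x \<in> Ns T \<Longrightarrow> act x (eb T) = eb T"
  by (auto simp: Ns_def)

lemma fusing_Ns: "below_P T \<Longrightarrow> x \<in> Ns T \<longleftrightarrow> fusing x T \<and> cset x T = T"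
  using below_PD(2) by (auto simp: fusing_def Ns_def)

lemma nrm_Ns: "below_P T \<Longrightarrow> nrm P T \<subseteq> Ns T"
  using fusing_P by (auto simp: fusing_Ns nrm_def)

lemma sub_Ns: "below_P T \<Longrightarrow> T \<subseteq> Ns T"
  using sub_nrm[OF below_PD(1,2)] nrm_Ns by blast

lemma cen_Ns:
  assumes T: "below_P T"
  shows "cen T \<subseteq> Ns T"
proof
  fix x assume x: "x \<in> cen T"
  note e = brauer_pairD[OF brauer_leD(1)[OF eb_le[OF T]]]
  have xG: "x \<in> carrier G" using x cen_subset by blast
  have "conj_elem G x u = u" if "u \<in> T" for u
    using x that below_PD(3)[OF T] conj_elem_eq_iff[OF xG, of u] by (auto simp: centralizer_def)
  then have "cset x T = T" by simp
  moreover have "act x (eb T) = eb T" using center_fixed[OF e(5,6)] x by (simp add: fixed_def)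
  ultimately show "x \<in> Ns T" using xG by (simp add: Ns_def)
qed

lemma pair_in_Ns:
  assumes le: "brauer_le G T (eb T) S h" and nrm: "\<And>s. s \<in> S \<Longrightarrow> cset s T = T"
  shows "S \<subseteq> Ns T"
  using normal_sub_pair(1)[OF le nrm] nrm brauer_pairD(4)[OF brauer_leD(2)[OF le]]
  by (auto simp: Ns_def fixed_def)

lemma sub_nrmP: "below_P T \<Longrightarrow> below_P (nrm P T)"
  using nrm_subgroup[OF pairPD(3) below_PD(3)] nrm_sub by (auto simp: below_P_def)

text \<open>A largest pair \<open>(D, h)\<close> above \<open>(T, e\<^sub>T)\<close> in the stabilizer has a conjugate below \<open>(P, f)\<close>. This
  makes \<open>D\<close> conjugate to a subgroup of the normalizer in \<open>P\<close> of a conjugate of \<open>T\<close>, so \<open>D\<close> is no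
  larger than \<open>N\<^sub>P(T)\<close> because \<open>T\<close> is fully normalized.\<close>

lemma nrm_top:
  assumes T: "below_P T" and fn: "\<And>x. fusing x T \<Longrightarrow> card (nrm P (cset x T)) \<le> card (nrm P T)"
    and le: "brauer_le G T (eb T) S h" and S: "S \<subseteq> Ns T"
  shows "\<exists>x\<in>Ns T. brauer_le G S h (cset x (nrm P T)) (act x (eb (nrm P T)))"
proof -
  let ?NT = "nrm P T"
  note NT = sub_nrmP[OF T]
  note TG = below_PD(3)[OF T]
  note Tp = brauer_leD(1)[OF eb_le[OF T]]
  obtain D h0 where D: "brauer_le G T (eb T) D h0" "D \<subseteq> Ns T"
    and top: "\<And>S h. brauer_le G T (eb T) S h \<Longrightarrow> S \<subseteq> Ns T \<Longrightarrow>
      \<exists>x\<in>Ns T. brauer_le G S h (cset x D) (act x h0)"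
    using top_pair_exists[OF Tp Ns_subgroup[OF T] sub_Ns[OF T] cen_Ns[OF T] NsD(2,3)] by blast
  note DD = brauer_pairD[OF brauer_leD(2)[OF D(1)]]
  have TNT: "brauer_le G T (eb T) ?NT (eb ?NT)"
    by (rule eb_between[OF T NT sub_nrm[OF below_PD(1,2)[OF T]]])
  obtain n where n: "n \<in> Ns T" "brauer_le G ?NT (eb ?NT) (cset n D) (act n h0)"
    using top[OF TNT nrm_Ns[OF T]] by blast
  have nG: "n \<in> carrier G" by (rule NsD(1)[OF n(1)])
  have "brauer_le G {\<one>} c T (eb T)"
    using eb_between[OF sub_trivial T] subgroup.one_closed[OF below_PD(1)[OF T]] by (simp add: eb_trivial)
  then obtain g where g: "g \<in> carrier G" "brauer_le G D h0 (cset g P) (act g f)"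
    using le_conj_P[OF brauer_le_trans[OF _ D(1)]] by blast
  have ig: "inv g \<in> carrier G" using g(1) by simp
  have Dg: "brauer_le G (cset (inv g) D) (act (inv g) h0) P f"
    using brauer_le_conj[OF ig g(2)] g(1) P.subset pairPD(8) by simp
  have Tg: "fusing (inv g) T"
    by (rule fusingI[OF ig T brauer_le_trans[OF brauer_le_conj[OF ig D(1)] Dg]])
  have "cset (inv g) D \<subseteq> nrm P (cset (inv g) T)"
  proof
    fix y assume y: "y \<in> cset (inv g) D"
    then obtain d where d: "d \<in> D" "y = conj_elem G (inv g) d" by blast
    have dG: "d \<in> carrier G" "cset d T = T" using d D(2) NsD by blast+
    have yG: "y \<in> carrier G" using d dG ig by (simp add: conj_elem_closed)
    have "y \<otimes> inv g = inv g \<otimes> d" using d(2) dG(1) g(1) by (simp add: conj_elem_def m_assoc)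
    then have "cset y (cset (inv g) T) = cset (inv g) T"
      using dG yG ig TG by (metis cset_mult)
    then show "y \<in> nrm P (cset (inv g) T)" using y brauer_leD(3)[OF Dg] by (auto simp: nrm_def)
  qed
  moreover have "finite (nrm P (cset (inv g) T))"
    using finite_subset[OF _ finG] nrm_sub P.subset by (metis order_trans)
  ultimately have "card (cset (inv g) D) \<le> card (nrm P (cset (inv g) T))" by (rule card_mono[rotated])
  also have "\<dots> \<le> card ?NT" by (rule fn[OF Tg])
  finally have "card (cset n D) \<le> card ?NT" using card_cset[OF ig DD(4)] card_cset[OF nG DD(4)] by simp
  then have eq: "?NT = cset n D" "eb ?NT = act n h0" using brauer_le_card[OF n(2)] by auto
  obtain y where y: "y \<in> Ns T" "brauer_le G S h (cset y D) (act y h0)" using top[OF le S] by blast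
  have yG: "y \<in> carrier G" by (rule NsD(1)[OF y(1)])
  have 1: "cset (y \<otimes> inv n) ?NT = cset y D"
    using nG yG DD(4) by (simp add: eq(1) cset_mult cset_subset)
  have 2: "act (y \<otimes> inv n) (eb ?NT) = act y h0"
    using nG yG DD(8) by (simp add: eq(2) act_mult)
  have "y \<otimes> inv n \<in> Ns T"
    using n(1) y(1) Ns_subgroup[OF T] by (simp add: subgroup.m_closed subgroup.m_inv_closed)
  moreover have "brauer_le G S h (cset (y \<otimes> inv n) ?NT) (act (y \<otimes> inv n) (eb ?NT))"
    unfolding 1 2 by (rule y(2))
  ultimately show ?thesis by blast
qed

text \<open>Conjugation by \<open>x\<close> carries the pair of \<open>N\<^sub>P(Q)\<close> to a pair normalizing \<open>(T, e\<^sub>T)\<close>, and the pair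
  of \<open>N\<^sub>P(T)\<close> is a largest one of these up to conjugation.\<close>

lemma extension:
  assumes x: "fusing x Q" and T: "T = cset x Q"
    and fn: "\<And>y. fusing y T \<Longrightarrow> card (nrm P (cset y T)) \<le> card (nrm P T)"
  shows "\<exists>z. fusing z (nrm P Q) \<and> cset z Q = T"
proof -
  note xD = fusingD[OF x]
  have Ts: "below_P T" using xD(5) T by simp
  note TG = below_PD(3)[OF Ts]
  let ?S = "cset x (nrm P Q)" and ?h = "act x (eb (nrm P Q))"
  note NQ = sub_nrmP[OF xD(2)]
  note NQG = below_PD(3)[OF NQ]
  have le: "brauer_le G T (eb T) ?S ?h"
    using brauer_le_conj[OF xD(1) eb_between[OF xD(2) NQ sub_nrm[OF below_PD(1,2)[OF xD(2)]]]] xD(4) T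
    by simp
  have "cset s T = T" if s: "s \<in> ?S" for s
  proof -
    obtain u where u: "u \<in> nrm P Q" "s = conj_elem G x u" using s by blast
    have uG: "u \<in> carrier G" using u(1) NQG by blast
    have sG: "s \<in> carrier G" using u(2) uG xD(1) by (simp add: conj_elem_closed)
    have "s \<otimes> x = x \<otimes> u" using u(2) uG xD(1) by (simp add: conj_elem_def m_assoc)
    then have "cset s (cset x Q) = cset x (cset u Q)" using sG uG xD(1,6) by (metis cset_mult)
    then show ?thesis using u(1) T by (simp add: nrm_def)
  qed
  then have "?S \<subseteq> Ns T" by (rule pair_in_Ns[OF le])
  then obtain m where m: "m \<in> Ns T" "brauer_le G ?S ?h (cset m (nrm P T)) (act m (eb (nrm P T)))"
    using nrm_top[OF Ts fn le] by blast
  have mG: "m \<in> carrier G" by (rule NsD(1)[OF m(1)])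
  have im: "inv m \<in> Ns T" using m(1) Ns_subgroup[OF Ts] by (simp add: subgroup.m_inv_closed)
  note NT = sub_nrmP[OF Ts]
  let ?z = "inv m \<otimes> x"
  have "brauer_le G (cset (inv m) ?S) (act (inv m) ?h) (nrm P T) (eb (nrm P T))"
    using brauer_le_conj[OF NsD(1)[OF im] m(2)] mG below_PD(3)[OF NT] eb_carrier[OF NT] by simp
  then have "brauer_le G (cset ?z (nrm P Q)) (act ?z (eb (nrm P Q))) P f"
    using brauer_le_trans[OF _ eb_le[OF NT]] mG xD(1) NQG by (simp add: cset_mult act_mult)
  then have "fusing ?z (nrm P Q)" using mG xD(1) by (intro fusingI[OF _ NQ]) auto
  moreover have "cset ?z Q = T" using mG xD(1,6) T NsD(2)[OF im] by (simp add: cset_mult)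
  ultimately show ?thesis by blast
qed

lemma Ms_subgroup:
  assumes T: "below_P T"
  shows "subgroup (Ms T) G"
proof -
  interpret T: subgroup T G by (rule below_PD[OF T])
  interpret N: subgroup "Ns T" G by (rule Ns_subgroup[OF T])
  have clT: "conj_elem G t u \<in> T" if "t \<in> T" "u \<in> T" for t u
    using that by (simp add: conj_elem_def)
  show ?thesis
  proof
    show "Ms T \<subseteq> carrier G" by (auto simp: Ms_def)
    fix x y assume "x \<in> Ms T" "y \<in> Ms T"
    then obtain s t where *: "x \<in> Ns T" "y \<in> Ns T" "s \<in> T" "t \<in> T"
      "\<forall>u\<in>T. conj_elem G x u = conj_elem G s u" "\<forall>u\<in>T. conj_elem G y u = conj_elem G t u"
      by (auto simp: Ms_def)
    have "conj_elem G (x \<otimes> y) u = conj_elem G (s \<otimes> t) u" if "u \<in> T" for u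
      using * that clT by (simp add: conj_elem_mult)
    moreover have "x \<otimes> y \<in> Ns T" "s \<otimes> t \<in> T" using * by simp_all
    ultimately show "x \<otimes> y \<in> Ms T" unfolding Ms_def by blast
  next
    show "\<one> \<in> Ms T" unfolding Ms_def using N.one_closed T.one_closed by blast
  next
    fix x assume "x \<in> Ms T"
    then obtain t where *: "x \<in> Ns T" "t \<in> T" "\<forall>u\<in>T. conj_elem G x u = conj_elem G t u"
      by (auto simp: Ms_def)
    have "conj_elem G (inv x) u = conj_elem G (inv t) u" if u: "u \<in> T" for u
    proof -
      let ?v = "conj_elem G (inv t) u"
      have v: "?v \<in> T" using * u clT by simp
      have "conj_elem G x ?v = u" using *(3)[rule_format, OF v] *(2) u by simp
      then have "conj_elem G (inv x) u = conj_elem G (inv x) (conj_elem G x ?v)" by simp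
      also have "\<dots> = ?v" by (rule conj_elem_inv(1)) (use * v in auto)
      finally show ?thesis .
    qed
    moreover have "inv x \<in> Ns T" "inv t \<in> T" using * by simp_all
    ultimately show "inv x \<in> Ms T" unfolding Ms_def by blast
  qed
qed

lemma Ms_contains:
  assumes T: "below_P T"
  shows "T \<subseteq> Ms T" "cen T \<subseteq> Ms T" "Ms T \<subseteq> Ns T"
proof -
  show "T \<subseteq> Ms T" using sub_Ns[OF T] by (auto simp: Ms_def)
  show "cen T \<subseteq> Ms T"
  proof
    fix x assume x: "x \<in> cen T"
    have "conj_elem G x u = conj_elem G \<one> u" if "u \<in> T" for u
      using x that below_PD(3)[OF T] conj_elem_eq_iff[of x u] conj_elem_one[of u]
      by (auto simp: centralizer_def)
    then show "x \<in> Ms T" using x cen_Ns[OF T] subgroup.one_closed[OF below_PD(1)[OF T]] unfolding Ms_def by blast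
  qed
qed (auto simp: Ms_def)

lemma Ms_normal:
  assumes T: "below_P T" and x: "x \<in> Ns T" and y: "y \<in> Ms T"
  shows "conj_elem G x y \<in> Ms T"
proof -
  interpret T: subgroup T G by (rule below_PD[OF T])
  interpret N: subgroup "Ns T" G by (rule Ns_subgroup[OF T])
  obtain t where t: "y \<in> Ns T" "t \<in> T" "\<forall>u\<in>T. conj_elem G y u = conj_elem G t u"
    using y by (auto simp: Ms_def)
  have clT: "conj_elem G z u \<in> T" if "z \<in> Ns T" "u \<in> T" for z u
    using NsD(2)[OF that(1)] that(2) by blast
  have "conj_elem G (conj_elem G x y) u = conj_elem G (conj_elem G x t) u" if u: "u \<in> T" for u
  proof -
    have "conj_elem G (conj_elem G x z) u = conj_elem G x (conj_elem G z (conj_elem G (inv x) u))"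
      if "z \<in> carrier G" for z
      using that u x by (simp add: conj_elem_def m_assoc inv_mult_group)
    then show ?thesis using t x u clT[of "inv x" u] by simp
  qed
  moreover have "conj_elem G x y \<in> Ns T" using x t(1) by (simp add: conj_elem_def)
  ultimately show ?thesis using clT[OF x t(2)] unfolding Ms_def by blast
qed

text \<open>A Frattini argument in \<open>N\<^sub>G(T, e\<^sub>T)\<close> with respect to its normal subgroup \<open>T C\<^sub>G(T)\<close>.\<close>

lemma frattini:
  assumes T: "below_P T" and fn: "\<And>x. fusing x T \<Longrightarrow> card (nrm P (cset x T)) \<le> card (nrm P T)"
    and x: "x \<in> Ns T"
  defines "U \<equiv> nrm P T \<inter> Ms T"
  shows "\<exists>m\<in>Ms T. fusing (inv m \<otimes> x) U"
proof -
  note TG = below_PD(3)[OF T] and NT = sub_nrmP[OF T] and Tp = brauer_leD(1)[OF eb_le[OF T]]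
  have MG: "subgroup (Ms T) G" by (rule Ms_subgroup[OF T])
  have U: "below_P U" "U \<subseteq> nrm P T" "T \<subseteq> U"
    using subgroups_Inter_pair[OF below_PD(1)[OF NT] MG] below_PD(2)[OF NT] sub_nrm[OF below_PD(1,2)[OF T]]
      Ms_contains(1)[OF T] by (auto simp: below_P_def U_def)
  note UG = below_PD(3)[OF U(1)]
  obtain V g where V: "brauer_le G T (eb T) V g" "V \<subseteq> Ms T"
    and top: "\<And>S h. brauer_le G T (eb T) S h \<Longrightarrow> S \<subseteq> Ms T \<Longrightarrow>
      \<exists>x\<in>Ms T. brauer_le G S h (cset x V) (act x g)"
    using top_pair_exists[OF Tp MG Ms_contains(1,2)[OF T]
        NsD(2)[OF subsetD[OF Ms_contains(3)[OF T]]] NsD(3)[OF subsetD[OF Ms_contains(3)[OF T]]]]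
    by blast
  note VD = brauer_pairD[OF brauer_leD(2)[OF V(1)]]
  have conjM: "cset z H \<subseteq> Ms T" if "z \<in> Ns T" "H \<subseteq> Ms T" for z H
    using that Ms_normal[OF T] by blast
  have invN: "inv z \<in> Ns T" if "z \<in> Ns T" for z
    using that Ns_subgroup[OF T] by (simp add: subgroup.m_inv_closed)
  obtain n where n: "n \<in> Ns T" "brauer_le G V g (cset n (nrm P T)) (act n (eb (nrm P T)))"
    using nrm_top[OF T fn V(1)] V(2) Ms_contains(3)[OF T] by blast
  have nG: "n \<in> carrier G" by (rule NsD(1)[OF n(1)])
  have "cset (inv n) V \<subseteq> cset (inv n) (cset n (nrm P T))" using brauer_leD(3)[OF n(2)] by blast
  then have "cset (inv n) V \<subseteq> U"
    using conjM[OF invN[OF n(1)] V(2)] nG below_PD(3)[OF NT] by (simp add: U_def)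
  then have "card (cset (inv n) V) \<le> card U" using finite_subset[OF UG finG] by (rule card_mono[rotated])
  then have card: "card V \<le> card U" using card_cset[of "inv n" V] nG VD(4) by simp
  \<comment> \<open>Each conjugate of the pair of \<open>U\<close> lies below an \<open>Ms T\<close>-conjugate of \<open>(V, g)\<close>, and \<open>V\<close> is no
    larger than \<open>U\<close>.\<close>
  have top_U: "\<exists>m\<in>Ms T. cset z U = cset m V \<and> act z (eb U) = act m g" if z: "z \<in> Ns T" for z
  proof -
    have zG: "z \<in> carrier G" by (rule NsD(1)[OF z])
    have "brauer_le G T (eb T) (cset z U) (act z (eb U))"
      using brauer_le_conj[OF zG eb_between[OF T U(1,3)]] NsD(2,3)[OF z] by simp
    moreover have "cset z U \<subseteq> Ms T" by (rule conjM[OF z]) (simp add: U_def)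
    ultimately obtain m where
      m: "m \<in> Ms T" "brauer_le G (cset z U) (act z (eb U)) (cset m V) (act m g)"
      using top by blast
    have mG: "m \<in> carrier G" using m(1) subgroup.subset[OF MG] by blast
    have "card (cset m V) \<le> card (cset z U)"
      using card card_cset[OF mG VD(4)] card_cset[OF zG UG] by simp
    then show ?thesis using brauer_le_card[OF m(2)] m(1) by blast
  qed
  have xG: "x \<in> carrier G" by (rule NsD(1)[OF x])
  obtain m1 where m1: "m1 \<in> Ms T" "cset x U = cset m1 V" "act x (eb U) = act m1 g"
    using top_U[OF x] by blast
  have one: "\<one> \<in> Ns T" by (rule subgroup.one_closed[OF Ns_subgroup[OF T]])
  obtain m0 where m0: "m0 \<in> Ms T" "U = cset m0 V" "eb U = act m0 g"
    using top_U[OF one] cset_one[OF UG] act_one[OF eb_carrier[OF U(1)]] by auto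
  have mG: "m0 \<in> carrier G" "m1 \<in> carrier G" using m0(1) m1(1) subgroup.subset[OF MG] by blast+
  let ?m = "m1 \<otimes> inv m0"
  have m: "?m \<in> Ms T" using m0(1) m1(1) MG by (simp add: subgroup.m_closed subgroup.m_inv_closed)
  have inv: "inv ?m = m0 \<otimes> inv m1" using mG by (simp add: inv_mult_group)
  have "cset (inv ?m \<otimes> x) U = U"
    unfolding inv using mG xG UG VD(4) m0(2) m1(2) by (simp add: cset_mult cset_subset)
  moreover have "act (inv ?m \<otimes> x) (eb U) = eb U"
    unfolding inv using mG xG VD(8) m0(3) m1(3) by (simp add: act_mult)
  ultimately have "fusing (inv ?m \<otimes> x) U"
    using U(1) below_PD(2)[OF U(1)] mG xG by (simp add: fusing_def)
  then show ?thesis using m by blast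
qed

section \<open>Alperin's fusion theorem\<close>

definition centric_normalized :: "'g morphism set" where
  "centric_normalized = {(Q, \<phi>, Q) | Q \<phi>. subgroup Q GP \<and> fusion_centric GP \<F> Q \<and>
     fully_normalized GP \<F> Q \<and> \<phi> \<in> Hom \<F> Q Q}"

context
  fixes E :: "'g morphism set"
  assumes E: "fusion_system GP E"
begin

text \<open>For an arbitrary fusion system \<open>E\<close> over \<open>P\<close>, \<open>realized x Q\<close> says that the isomorphism of
  the block fusion system on \<open>Q\<close> that is given by \<open>x\<close> already belongs to \<open>E\<close>.\<close>

definition realized :: "'g \<Rightarrow> 'g set \<Rightarrow> bool" where
  "realized x Q \<longleftrightarrow> fusing x Q \<and> (Q, conj_map x Q, cset x Q) \<in> E"

lemma E_compose:
  assumes "(Q, \<phi>, R) \<in> E" "(R, \<psi>, S) \<in> E"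
  shows "(Q, compose Q \<psi> \<phi>, S) \<in> E"
proof -
  have "\<forall>Q R S. \<forall>\<phi> \<in> Hom E Q R. \<forall>\<psi> \<in> Hom E R S. compose Q \<psi> \<phi> \<in> Hom E Q S"
    using E unfolding fusion_system_def by (elim conjE)
  then show ?thesis using assms by (simp add: Hom_def)
qed

lemma E_iso:
  assumes "(Q, \<phi>, R) \<in> E"
  shows "(Q, \<phi>, \<phi> ` Q) \<in> E" "(\<phi> ` Q, \<lambda>v\<in>\<phi> ` Q. inv_into Q \<phi> v, Q) \<in> E"
proof -
  have "\<forall>Q R. \<forall>\<phi> \<in> Hom E Q R. \<phi> \<in> Hom E Q (\<phi> ` Q) \<and>
        (\<lambda>v\<in>\<phi> ` Q. inv_into Q \<phi> v) \<in> Hom E (\<phi> ` Q) Q"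
    using E unfolding fusion_system_def by (elim conjE)
  then show "(Q, \<phi>, \<phi> ` Q) \<in> E" "(\<phi> ` Q, \<lambda>v\<in>\<phi> ` Q. inv_into Q \<phi> v, Q) \<in> E"
    using assms unfolding Hom_def by blast+
qed

lemma E_conj:
  assumes x: "x \<in> P" and QR: "below_P Q" "below_P R" "cset x Q \<subseteq> R"
  shows "(Q, conj_map x Q, R) \<in> E"
proof -
  have "\<forall>Q R. \<forall>x \<in> carrier GP. subgroup Q GP \<and> subgroup R GP \<and> conj_elem GP x ` Q \<subseteq> R
        \<longrightarrow> (\<lambda>u\<in>Q. conj_elem GP x u) \<in> Hom E Q R"
    using E unfolding fusion_system_def by (elim conjE)
  from this[rule_format, of x Q R]
  have "cset x Q \<subseteq> R \<Longrightarrow> (\<lambda>u\<in>Q. conj_elem G x u) \<in> Hom E Q R"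
    using x QR(1,2) unfolding conj_elem_GP[OF x] by (simp add: below_P_iff)
  then show ?thesis using QR(3) by (simp add: conj_map_def Hom_def)
qed

lemma realized_P: "u \<in> P \<Longrightarrow> below_P Q \<Longrightarrow> realized u Q"
  unfolding realized_def using fusing_P E_conj[OF _ _ fusingD(5)[OF fusing_P] order_refl] by blast

lemma realized_compose:
  assumes x: "realized x Q" and y: "realized y (cset x Q)"
  shows "realized (y \<otimes> x) Q"
proof -
  have a: "fusing x Q" "fusing y (cset x Q)" using x y by (auto simp: realized_def)
  note xD = fusingD[OF a(1)] and yD = fusingD[OF a(2)]
  have "(Q, compose Q (conj_map y (cset x Q)) (conj_map x Q), cset y (cset x Q)) \<in> E"
    using x y by (auto simp: realized_def intro: E_compose)
  then have "(Q, conj_map (y \<otimes> x) Q, cset (y \<otimes> x) Q) \<in> E"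
    unfolding conj_map_compose[OF xD(1) yD(1) xD(6) order_refl] cset_mult[OF yD(1) xD(1,6)] .
  then show ?thesis using fusing_mult[OF a] by (simp add: realized_def)
qed

lemma realized_inv:
  assumes x: "realized x Q"
  shows "realized (inv x) (cset x Q)"
proof -
  have a: "fusing x Q" and e: "(Q, conj_map x Q, cset x Q) \<in> E" using x by (auto simp: realized_def)
  have "(cset x Q, conj_map (inv x) (cset x Q), Q) \<in> E"
    using E_iso(2)[OF e] unfolding conj_map_inverse[OF a] unfolding conj_map_image .
  then show ?thesis using fusing_inv[OF a] fusingD(1,6)[OF a] by (simp add: realized_def)
qed

lemma E_into:
  assumes x: "realized x Q" and R: "below_P R" "cset x Q \<subseteq> R"
  shows "(Q, conj_map x Q, R) \<in> E"
proof -
  have a: "fusing x Q" and e: "(Q, conj_map x Q, cset x Q) \<in> E" using x by (auto simp: realized_def)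
  note D = fusingD[OF a]
  have "(cset x Q, conj_map \<one> (cset x Q), R) \<in> E"
    using R(2) cset_one[OF below_PD(3)[OF D(5)]] by (intro E_conj P.one_closed D(5) R(1)) simp
  from E_compose[OF e this] show ?thesis
    using conj_map_compose[OF D(1) one_closed D(6) order_refl] D(1) by simp
qed

lemma realized_restrict:
  assumes x: "realized x A" and Q: "below_P Q" "Q \<subseteq> A"
  shows "realized x Q"
proof -
  have a: "fusing x A" and e: "(A, conj_map x A, cset x A) \<in> E" using x by (auto simp: realized_def)
  note D = fusingD[OF a]
  have "(Q, conj_map \<one> Q, A) \<in> E"
    using Q(2) cset_one[OF below_PD(3)[OF Q(1)]] by (intro E_conj P.one_closed D(2) Q(1)) simp
  from E_compose[OF this e] have "(Q, conj_map x Q, cset x A) \<in> E"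
    using conj_map_compose[OF one_closed D(1) below_PD(3)[OF Q(1)], of A] cset_one[OF below_PD(3)[OF Q(1)]] Q(2) D(1)
    by simp
  from E_iso(1)[OF this] show ?thesis
    unfolding conj_map_image realized_def using fusing_restrict[OF a Q] by blast
qed

text \<open>Conjugation by \<open>x\<close> on a fully normalized subgroup \<open>T\<close> that is not centric agrees, up to an
  inner automorphism of \<open>T\<close>, with an automorphism of the larger subgroup
  \<open>N\<^sub>P(T) \<inter> T C\<^sub>G(T) = T C\<^sub>P(T)\<close>.\<close>

lemma realized_aut:
  assumes T: "below_P T" and fn: "\<And>x. fusing x T \<Longrightarrow> card (nrm P (cset x T)) \<le> card (nrm P T)"
    and S: "centric_normalized \<subseteq> E"
    and IH: "\<And>A x. below_P A \<Longrightarrow> card T < card A \<Longrightarrow> fusing x A \<Longrightarrow> realized x A"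
    and x: "fusing x T" "cset x T = T"
  shows "realized x T"
proof (cases "fusion_centric GP \<F> T")
  case True
  have "(T, conj_map x T, T) \<in> centric_normalized"
    unfolding centric_normalized_def
    using True T fn x by (auto simp: below_P_iff fully_normalized_iff Hom_def mem_F_iff)
  then show ?thesis using S x by (auto simp: realized_def)
next
  case False
  note TG = below_PD(3)[OF T]
  obtain y a where y: "fusing y T" "a \<in> P" "a \<in> cen (cset y T)" "a \<notin> cset y T"
    using False by (auto simp: fusion_centric_iff)
  note yD = fusingD[OF y(1)]
  let ?R = "cset y T"
  have inv: "cset (inv y) ?R = T" using yD(1) TG by simp
  obtain z where z: "fusing z (nrm P ?R)" "cset z ?R = T"
    using extension[OF fusing_inv[OF y(1)] inv[symmetric]] fn by blast
  note zD = fusingD[OF z(1)]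
  have aG: "a \<in> carrier G" using y(2) by simp
  have RG: "?R \<subseteq> carrier G" by (rule below_PD(3)[OF yD(5)])
  \<comment> \<open>An element of \<open>P\<close> that centralizes some conjugate of \<open>T\<close> from outside moves along with the
    normalizer to an element that does the same for \<open>T\<close>.\<close>
  define b where "b = conj_elem G z a"
  have "conj_elem G a u = u" if "u \<in> ?R" for u
    using y(3) that RG conj_elem_eq_iff[OF aG, of u] by (auto simp: centralizer_def subset_iff)
  then have "cset a ?R = ?R" by simp
  then have "a \<in> nrm P ?R" using y(2) by (simp add: nrm_def)
  then have bP: "b \<in> P" using zD(3) by (auto simp: b_def)
  have "b \<in> cset z (cen ?R)" using y(3) by (simp add: b_def)
  then have bC: "b \<in> cen T" using cen_cset[OF zD(1) RG] z(2) by simp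
  have bT: "b \<notin> T"
  proof
    assume "b \<in> T"
    then obtain r where r: "r \<in> ?R" "conj_elem G z a = conj_elem G z r" using z(2) by (auto simp: b_def)
    then have "a = r" using inj_onD[OF inj_conj[OF zD(1)]] aG RG by blast
    then show False using r y(4) by simp
  qed
  define U where "U = nrm P T \<inter> Ms T"
  have "conj_elem G b u = u" if "u \<in> T" for u
    using bC bP that TG conj_elem_eq_iff[of b u] by (auto simp: centralizer_def subset_iff)
  then have "cset b T = T" by simp
  then have "b \<in> U" using bP bC Ms_contains(2)[OF T] by (auto simp: U_def nrm_def)
  moreover have TU: "T \<subseteq> U"
    using sub_nrm[OF below_PD(1,2)[OF T]] Ms_contains(1)[OF T] by (simp add: U_def)
  ultimately have "T \<subset> U" using bT by blast
  have "x \<in> Ns T" using x fusing_Ns[OF T] by simp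
  then obtain m where m: "m \<in> Ms T" "fusing (inv m \<otimes> x) U"
    using frattini[OF T fn] unfolding U_def by blast
  let ?w = "inv m \<otimes> x"
  have U: "below_P U" by (rule fusingD(2)[OF m(2)])
  have "card T < card U"
    using \<open>T \<subset> U\<close> finite_subset[OF below_PD(3)[OF U] finG] by (rule psubset_card_mono[rotated])
  from IH[OF U this m(2)] have wU: "realized ?w U" .
  have w: "realized ?w T" by (rule realized_restrict[OF wU T TU])
  have mN: "m \<in> Ns T" using m(1) Ms_contains(3)[OF T] by blast
  have mG: "m \<in> carrier G" by (rule NsD(1)[OF mN])
  have xG: "x \<in> carrier G" by (rule fusingD(1)[OF x(1)])
  have "cset (inv m) T = T" using cset_inv(1)[OF mG TG] NsD(2)[OF mN] by simp
  then have wT: "cset ?w T = T" using x(2) mG xG TG by (simp add: cset_mult)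
  obtain t where t: "t \<in> T" "\<forall>u\<in>T. conj_elem G m u = conj_elem G t u"
    using m(1) by (auto simp: Ms_def)
  have tP: "t \<in> P" using t(1) below_PD(2)[OF T] by blast
  have tG: "t \<in> carrier G" using tP by simp
  have "realized (t \<otimes> ?w) T" by (rule realized_compose[OF w]) (simp add: wT realized_P[OF tP T])
  moreover have "conj_elem G (t \<otimes> ?w) u = conj_elem G x u" if u: "u \<in> T" for u
  proof -
    have uG: "u \<in> carrier G" using u TG by blast
    have wG: "?w \<in> carrier G" using mG xG by simp
    have "conj_elem G ?w u \<in> T" using wT u by blast
    then have "conj_elem G t (conj_elem G ?w u) = conj_elem G m (conj_elem G ?w u)" using t(2) by simp
    also have "\<dots> = conj_elem G (m \<otimes> ?w) u" using mG wG uG by (simp only: conj_elem_mult)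
    also have "m \<otimes> ?w = x" using mG xG by simp
    finally show ?thesis using tG wG uG by (simp only: conj_elem_mult)
  qed
  then have "conj_map (t \<otimes> ?w) T = conj_map x T" "cset (t \<otimes> ?w) T = cset x T"
    by (simp_all add: conj_map_def cong: restrict_cong)
  ultimately show ?thesis using x(1) by (simp add: realized_def)
qed

text \<open>Both ends of an isomorphism are carried to a common fully normalized conjugate \<open>T\<close> by maps
  that extend to normalizers, which are larger; the defect is an automorphism of \<open>T\<close>.\<close>

lemma realized_all:
  assumes S: "centric_normalized \<subseteq> E" and x: "fusing x Q"
  shows "realized x Q"
  using x
proof (induction "card P - card Q" arbitrary: x Q rule: less_induct)
  case less
  note x = less.prems
  note xD = fusingD[OF x]
  have finP: "finite P" using finite_subset[OF P.subset finG] .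
  have IH: "realized z A" if A: "below_P A" "card Q < card A" "fusing z A" for A z
  proof (rule less.hyps[OF _ A(3)])
    have "card A \<le> card P" using card_mono[OF finP below_PD(2)[OF A(1)]] .
    then show "card P - card A < card P - card Q" using A(2) by linarith
  qed
  have "\<forall>y. fusing y Q \<longrightarrow> card (nrm P (cset y Q)) < Suc (card P)"
    using card_mono[OF finP nrm_sub] by (simp add: less_Suc_eq_le)
  then obtain y where y: "fusing y Q"
    and ymax: "\<And>z. fusing z Q \<Longrightarrow> card (nrm P (cset z Q)) \<le> card (nrm P (cset y Q))"
    using ex_has_greatest_nat[of "\<lambda>y. fusing y Q" x "\<lambda>y. card (nrm P (cset y Q))"] x by blast
  note yD = fusingD[OF y]
  \<comment> \<open>a fully normalized conjugate of \<open>Q\<close>\<close>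
  define T where "T = cset y Q"
  have T: "below_P T" unfolding T_def by (rule yD)
  note TG = below_PD(3)[OF T]
  have cardT: "card T = card Q" unfolding T_def by (rule card_cset[OF yD(1,6)])
  have fn: "card (nrm P (cset z T)) \<le> card (nrm P T)" if z: "fusing z T" for z
  proof -
    have "fusing (z \<otimes> y) Q" using fusing_mult[OF y] z by (simp add: T_def)
    then show ?thesis using ymax[of "z \<otimes> y"] fusingD(1)[OF z] yD(1,6) by (simp add: T_def cset_mult)
  qed
  \<comment> \<open>The normalizer of a proper subgroup \<open>A\<close> is larger than \<open>A\<close>, so the induction hypothesis applies to
    the extension.\<close>
  have to_T: "\<exists>z. realized z A \<and> cset z A = T" if v: "fusing v A" "cset v A = T" for v A
  proof (cases "A = P")
    case True
    have "card A = card T" using card_cset[OF fusingD(1,6)[OF v(1)]] v(2) by simp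
    then have "T = P" using True card_subset_eq[OF finP below_PD(2)[OF T]] by simp
    then have "realized \<one> A" "cset \<one> A = T"
      using True realized_P[OF P.one_closed sub_P] cset_one[OF P.subset] by simp_all
    then show ?thesis by blast
  next
    case False
    note A = fusingD(2)[OF v(1)]
    obtain z where z: "fusing z (nrm P A)" "cset z A = T"
      using extension[OF v(1) v(2)[symmetric] fn] by blast
    have "A \<subseteq> nrm P A" by (rule sub_nrm[OF below_PD(1,2)[OF A]])
    moreover have "nrm P A \<noteq> A" by (rule nrm_grows[OF pairPD(1) below_PD(1,2)[OF A] False])
    ultimately have "card A < card (nrm P A)"
      using finite_subset[OF below_PD(3)[OF sub_nrmP[OF A]] finG] by (intro psubset_card_mono) auto
    moreover have "card A = card Q" using card_cset[OF fusingD(1,6)[OF v(1)]] v(2) cardT by simp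
    ultimately have "realized z (nrm P A)" using IH[OF sub_nrmP[OF A] _ z(1)] by simp
    then show ?thesis using realized_restrict[OF _ A \<open>A \<subseteq> nrm P A\<close>] z(2) by blast
  qed
  let ?R = "cset x Q"
  have xi: "fusing (y \<otimes> inv x) ?R"
    by (rule fusing_mult[OF fusing_inv[OF x]]) (use y xD in simp)
  have "cset (y \<otimes> inv x) ?R = T" using xD yD by (simp add: T_def cset_mult cset_subset)
  then obtain z2 where z2: "realized z2 ?R" "cset z2 ?R = T" using to_T[OF xi] by blast
  obtain z1 where z1: "realized z1 Q" "cset z1 Q = T" using to_T[OF y] by (auto simp: T_def)
  have a: "fusing z1 Q" "fusing z2 ?R" using z1 z2 by (auto simp: realized_def)
  have G: "z1 \<in> carrier G" "z2 \<in> carrier G" "x \<in> carrier G" using a fusingD(1) xD(1) by blast+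
  have QG: "Q \<subseteq> carrier G" by (rule xD)
  have iz1: "cset (inv z1) T = Q" using z1(2) G QG by (metis cset_inv(1))
  \<comment> \<open>The automorphism of \<open>T\<close> by which \<open>x\<close> differs from \<open>z2\<inverse> z1\<close>.\<close>
  let ?w = "z2 \<otimes> (x \<otimes> inv z1)"
  have "fusing (inv z1) T" using fusing_inv[OF a(1)] z1(2) by simp
  then have "fusing (x \<otimes> inv z1) T" using fusing_mult[of "inv z1" T x] iz1 x by simp
  moreover have xz: "cset (x \<otimes> inv z1) T = ?R" using G TG iz1 by (simp add: cset_mult)
  ultimately have w: "fusing ?w T" using fusing_mult[of "x \<otimes> inv z1" T z2] a(2) by simp
  have wT: "cset ?w T = T" using cset_mult[OF G(2), of "x \<otimes> inv z1" T] G TG xz z2(2) by simp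
  have "realized ?w T"
    by (rule realized_aut[OF T fn S _ w wT]) (use IH cardT in auto)
  then have "realized (?w \<otimes> z1) Q" using realized_compose[OF z1(1)] z1(2) by simp
  moreover have "?w \<otimes> z1 = z2 \<otimes> x" using G by (simp add: m_assoc)
  ultimately have zx: "realized (z2 \<otimes> x) Q" by simp
  have "cset (z2 \<otimes> x) Q = T" using z2(2) G QG by (simp add: cset_mult)
  moreover have "realized (inv z2) T" using realized_inv[OF z2(1)] z2(2) by simp
  ultimately have "realized (inv z2 \<otimes> (z2 \<otimes> x)) Q" using realized_compose[OF zx] by simp
  then show ?case using G by simp
qed

lemma F_subset:
  assumes S: "centric_normalized \<subseteq> E"
  shows "\<F> \<subseteq> E"
proof
  fix \<tau> assume "\<tau> \<in> \<F>"
  moreover obtain Q \<phi> R where \<tau>: "\<tau> = (Q, \<phi>, R)" by (rule prod_cases3)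
  ultimately obtain x where "below_P R" "fusing x Q" "cset x Q \<subseteq> R" "\<phi> = conj_map x Q" by (auto simp: mem_F_iff)
  then show "\<tau> \<in> E" unfolding \<tau> using E_into[OF realized_all[OF S]] by simp
qed

end

lemma alperin_weak_fusion_block_fusion_system: "alperin_weak_fusion GP \<F>"
proof -
  have "\<F> = generated_fusion_system GP centric_normalized"
  proof
    show "\<F> \<subseteq> generated_fusion_system GP centric_normalized"
      unfolding generated_fusion_system_def using F_subset by blast
    have "centric_normalized \<subseteq> \<F>" by (auto simp: centric_normalized_def Hom_def)
    then show "generated_fusion_system GP centric_normalized \<subseteq> \<F>"
      unfolding generated_fusion_system_def using fusion_system_F by blast
  qed
  then show ?thesis unfolding alperin_weak_fusion_def centric_normalized_def .
qed

end

theorem theorem6p5: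
  fixes G :: "('g, 'm) monoid_scheme"
    and c f :: "'g \<Rightarrow> 'k::field"
    and P :: "'g set"
  assumes "group G" and "finite (carrier G)"
    and "CHAR('k) > 0"
    and "block_idempotent G c"
    and "maximal_brauer_pair G c P f"
  shows "alperin_weak_fusion (G\<lparr>carrier := P\<rparr>) (block_fusion_system G P f)"
proof -
  interpret maximal_pair G "TYPE('k)" "CHAR('k)" c f P
    using assms
    by (simp add: maximal_pair_def maximal_pair_axioms_def modular_group_algebra_def
        modular_group_algebra_axioms_def)
  show ?thesis by (rule alperin_weak_fusion_block_fusion_system)
qed

end
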